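(* Up to Riemannian local isometry (and multiplication of the metric by a positive constant), the only manifolds that admit CC-Kropina structures are the Euclidean spaces $\mathbb{E}^n$, $n\ge2$, and the odd-dimensional spheres $\mathbb{S}^{2m-1}$, $m\ge2$. That is: (a) each of $\mathbb{E}^n$ ($n\ge2$) and $\mathbb{S}^{2m-1}$ ($m\ge2$), with its standard metric, admits a globally defined Killing vector field of unit length, hence a CC-Kropina metric; and (b) if $(M,h)$ is a Riemannian manifold of dimension $n\ge 2$ and of constant sectional curvature that admits a globally defined Killing vector field $W$ of unit length, then either $(M,h)$ is locally isometric to $\mathbb{E}^n$, or $n=2m-1$ is odd with $m\ge2$ and $(M,h)$ is locally isometric to $\mathbb{S}^{2m-1}$ with its standard metric multiplied by a positive constant.
   Context: CC-Kropina metric (structure) on $M$: given a Riemannian metric $h$ of constant sectional curvature on $M$ and a globally defined Killing vector field $W$ of $(M,h)$ with $h(W,W)=1$ everywhere, it is the function $F(x,y)=\frac{h(y,y)}{2h(y,W)}$ defined on $A=\{(x,y)\in TM: h(y,W_x)>0\}$; $(h,W)$ is called its navigation data. Standard metrics: the flat metric $\delta_{ij}$ on $\mathbb{E}^n$, and the metric of constant curvature $1$ on $\mathbb{S}^{2m-1}$. *)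

theory Defs
  imports "HOL-Analysis.Analysis"
begin

section \<open>Smooth maps between Euclidean spaces\<close>

abbreviation dirderiv ::
  "('a::real_normed_vector \<Rightarrow> 'b::real_normed_vector) \<Rightarrow> 'a \<Rightarrow> 'a \<Rightarrow> 'b"
  where "dirderiv f x \<equiv> frechet_derivative f (at x)"

text \<open>The following two notions are only used for open sets \<open>S\<close>.\<close>

primrec Ck_on ::
  "nat \<Rightarrow> 'a::real_normed_vector set \<Rightarrow> ('a \<Rightarrow> 'b::real_normed_vector) \<Rightarrow> bool"
where
  "Ck_on 0 S f \<longleftrightarrow> continuous_on S f"
| "Ck_on (Suc k) S f \<longleftrightarrow>
     (\<forall>x\<in>S. f differentiable (at x)) \<and> (\<forall>v. Ck_on k S (\<lambda>x. dirderiv f x v))"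

definition smooth_on ::
  "'a::real_normed_vector set \<Rightarrow> ('a \<Rightarrow> 'b::real_normed_vector) \<Rightarrow> bool"
  where "smooth_on S f \<longleftrightarrow> (\<forall>k. Ck_on k S f)"


section \<open>Smooth manifolds\<close>

text \<open>
  A chart \<open>(U, \<phi>)\<close> has domain \<open>U\<close>; the values of \<open>\<phi>\<close> outside \<open>U\<close> are irrelevant. The model
  space is a Euclidean space \<open>'e\<close>, so the dimension of the manifold is \<open>DIM('e)\<close>.
\<close>

type_synonym ('m, 'e) chart = "'m set \<times> ('m \<Rightarrow> 'e)"

record ('m, 'e) mfd =
  top_of :: "'m topology"
  atlas :: "('m, 'e) chart set"

abbreviation points :: "('m, 'e) mfd \<Rightarrow> 'm set"
  where "points M \<equiv> topspace (top_of M)"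

abbreviation chart_dom :: "('m, 'e) chart \<Rightarrow> 'm set"
  where "chart_dom c \<equiv> fst c"

abbreviation coord :: "('m, 'e) chart \<Rightarrow> 'm \<Rightarrow> 'e"
  where "coord c \<equiv> snd c"

abbreviation chart_img :: "('m, 'e) chart \<Rightarrow> 'e set"
  where "chart_img c \<equiv> coord c ` chart_dom c"

definition param :: "('m, 'e) chart \<Rightarrow> 'e \<Rightarrow> 'm"
  where "param c = inv_into (chart_dom c) (coord c)"

definition transition :: "('m, 'e) chart \<Rightarrow> ('m, 'e) chart \<Rightarrow> 'e \<Rightarrow> 'e"
  where "transition c d = coord d \<circ> param c"

definition smooth_manifold :: "('m, 'e::euclidean_space) mfd \<Rightarrow> bool"
  where "smooth_manifold M \<longleftrightarrow>
    Hausdorff_space (top_of M) \<and> second_countable (top_of M) \<and>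
    (\<forall>c\<in>atlas M. openin (top_of M) (chart_dom c) \<and> open (chart_img c) \<and>
       homeomorphic_map (subtopology (top_of M) (chart_dom c)) (top_of_set (chart_img c)) (coord c)) \<and>
    (\<Union>c\<in>atlas M. chart_dom c) = points M \<and>
    (\<forall>c\<in>atlas M. \<forall>d\<in>atlas M. smooth_on (coord c ` (chart_dom c \<inter> chart_dom d)) (transition c d))"

definition chart_at :: "('m, 'e) mfd \<Rightarrow> 'm \<Rightarrow> ('m, 'e) chart"
  where "chart_at M p = (SOME c. c \<in> atlas M \<and> p \<in> chart_dom c)"


section \<open>Tangent vectors\<close>

text \<open>
  A tangent vector at \<open>p\<close> is the family of its coordinate vectors in all charts around \<open>p\<close>,
  related by the derivatives of the chart transitions. The value \<open>0\<close> at the other charts is a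
  convention that makes the representation unique.
\<close>

type_synonym ('m, 'e) tangent = "('m, 'e) chart \<Rightarrow> 'e"

definition tangent_space ::
  "('m, 'e::euclidean_space) mfd \<Rightarrow> 'm \<Rightarrow> ('m, 'e) tangent set"
  where "tangent_space M p =
    {v. (\<forall>c. \<not> (c \<in> atlas M \<and> p \<in> chart_dom c) \<longrightarrow> v c = 0) \<and>
        (\<forall>c\<in>atlas M. \<forall>d\<in>atlas M. p \<in> chart_dom c \<inter> chart_dom d \<longrightarrow>
           v d = dirderiv (transition c d) (coord c p) (v c))}"

text \<open>The tangent vector at \<open>p\<close> whose coordinate vector in the chart \<open>c\<close> is \<open>\<xi>\<close>.\<close>

definition tangent_of ::
  "('m, 'e::euclidean_space) mfd \<Rightarrow> 'm \<Rightarrow> ('m, 'e) chart \<Rightarrow> 'e \<Rightarrow> ('m, 'e) tangent"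
  where "tangent_of M p c \<xi> =
    (\<lambda>d. if d \<in> atlas M \<and> p \<in> chart_dom d then dirderiv (transition c d) (coord c p) \<xi> else 0)"

definition smooth_map_on ::
  "('m, 'e::euclidean_space) mfd \<Rightarrow> ('n, 'f::euclidean_space) mfd \<Rightarrow> 'm set \<Rightarrow> ('m \<Rightarrow> 'n) \<Rightarrow> bool"
  where "smooth_map_on M N U f \<longleftrightarrow>
    continuous_map (subtopology (top_of M) U) (top_of N) f \<and>
    (\<forall>c\<in>atlas M. \<forall>d\<in>atlas N.
       smooth_on (coord c ` (chart_dom c \<inter> U \<inter> f -` chart_dom d)) (coord d \<circ> f \<circ> param c))"

text \<open>The differential of \<open>f\<close> at \<open>p\<close>; it does not depend on the chart chosen at \<open>p\<close>.\<close>

definition differential ::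
  "('m, 'e::euclidean_space) mfd \<Rightarrow> ('n, 'f::euclidean_space) mfd \<Rightarrow> ('m \<Rightarrow> 'n) \<Rightarrow> 'm \<Rightarrow>
   ('m, 'e) tangent \<Rightarrow> ('n, 'f) tangent"
  where "differential M N f p v =
    (\<lambda>d. if d \<in> atlas N \<and> f p \<in> chart_dom d
         then (let c = chart_at M p
               in dirderiv (coord d \<circ> f \<circ> param c) (coord c p) (v c))
         else 0)"


section \<open>Riemannian metrics\<close>

type_synonym ('m, 'e) metric = "'m \<Rightarrow> ('m, 'e) tangent \<Rightarrow> ('m, 'e) tangent \<Rightarrow> real"

definition inner_product_on_tangent_space ::
  "('m, 'e::euclidean_space) mfd \<Rightarrow> 'm \<Rightarrow>
   (('m, 'e) tangent \<Rightarrow> ('m, 'e) tangent \<Rightarrow> real) \<Rightarrow> bool"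
  where "inner_product_on_tangent_space M p b \<longleftrightarrow>
    (\<forall>u\<in>tangent_space M p. \<forall>v\<in>tangent_space M p. \<forall>w\<in>tangent_space M p. \<forall>r s.
       b (\<lambda>c. r *\<^sub>R u c + s *\<^sub>R v c) w = r * b u w + s * b v w) \<and>
    (\<forall>u\<in>tangent_space M p. \<forall>v\<in>tangent_space M p. b u v = b v u) \<and>
    (\<forall>u\<in>tangent_space M p. u \<noteq> (\<lambda>c. 0) \<longrightarrow> b u u > 0)"

text \<open>The metric \<open>h\<close> in the coordinates of the chart \<open>c\<close>, as a form on the model space.\<close>

definition metric_rep ::
  "('m, 'e::euclidean_space) mfd \<Rightarrow> ('m, 'e) metric \<Rightarrow> ('m, 'e) chart \<Rightarrow> 'e \<Rightarrow> 'e \<Rightarrow> 'e \<Rightarrow> real"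
  where "metric_rep M h c x \<xi> \<eta> =
    h (param c x) (tangent_of M (param c x) c \<xi>) (tangent_of M (param c x) c \<eta>)"

definition riemannian_manifold ::
  "('m, 'e::euclidean_space) mfd \<Rightarrow> ('m, 'e) metric \<Rightarrow> bool"
  where "riemannian_manifold M h \<longleftrightarrow>
    smooth_manifold M \<and>
    (\<forall>p\<in>points M. inner_product_on_tangent_space M p (h p)) \<and>
    (\<forall>c\<in>atlas M. \<forall>\<xi> \<eta>. smooth_on (chart_img c) (\<lambda>x. metric_rep M h c x \<xi> \<eta>))"

text \<open>
  In the next three definitions \<open>g\<close> is a metric on an open subset of the model space and vectors
  are identified with constant vector fields. \<open>levi_civita g x u v\<close> is the Levi-Civita covariant
  derivative of \<open>v\<close> along \<open>u\<close> at \<open>x\<close>, given by Koszul's formula, and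
  \<open>curvature g x u v w\<close> is \<open>R(u,v)w\<close>.
\<close>

definition levi_civita ::
  "('e::euclidean_space \<Rightarrow> 'e \<Rightarrow> 'e \<Rightarrow> real) \<Rightarrow> 'e \<Rightarrow> 'e \<Rightarrow> 'e \<Rightarrow> 'e"
  where "levi_civita g x u v =
    (THE z. \<forall>w. 2 * g x z w =
       dirderiv (\<lambda>y. g y v w) x u + dirderiv (\<lambda>y. g y u w) x v - dirderiv (\<lambda>y. g y u v) x w)"

definition curvature ::
  "('e::euclidean_space \<Rightarrow> 'e \<Rightarrow> 'e \<Rightarrow> real) \<Rightarrow> 'e \<Rightarrow> 'e \<Rightarrow> 'e \<Rightarrow> 'e \<Rightarrow> 'e"
  where "curvature g x u v w =
    dirderiv (\<lambda>y. levi_civita g y v w) x u + levi_civita g x u (levi_civita g x v w)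
    - (dirderiv (\<lambda>y. levi_civita g y u w) x v + levi_civita g x v (levi_civita g x u w))"

definition sectional_curvature ::
  "('e::euclidean_space \<Rightarrow> 'e \<Rightarrow> 'e \<Rightarrow> real) \<Rightarrow> 'e \<Rightarrow> 'e \<Rightarrow> 'e \<Rightarrow> real"
  where "sectional_curvature g x u v =
    g x (curvature g x u v v) u / (g x u u * g x v v - (g x u v)\<^sup>2)"

definition constant_curvature ::
  "('m, 'e::euclidean_space) mfd \<Rightarrow> ('m, 'e) metric \<Rightarrow> real \<Rightarrow> bool"
  where "constant_curvature M h \<kappa> \<longleftrightarrow>
    (\<forall>c\<in>atlas M. \<forall>x\<in>chart_img c. \<forall>u v. u \<noteq> v \<and> independent {u, v} \<longrightarrow>
       sectional_curvature (metric_rep M h c) x u v = \<kappa>)"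


section \<open>Killing vector fields\<close>

type_synonym ('m, 'e) vector_field = "'m \<Rightarrow> ('m, 'e) tangent"

definition field_rep :: "('m, 'e) vector_field \<Rightarrow> ('m, 'e) chart \<Rightarrow> 'e \<Rightarrow> 'e"
  where "field_rep W c x = W (param c x) c"

definition smooth_vector_field ::
  "('m, 'e::euclidean_space) mfd \<Rightarrow> ('m, 'e) vector_field \<Rightarrow> bool"
  where "smooth_vector_field M W \<longleftrightarrow>
    (\<forall>p\<in>points M. W p \<in> tangent_space M p) \<and>
    (\<forall>c\<in>atlas M. smooth_on (chart_img c) (field_rep W c))"

text \<open>
  The Lie derivative of the metric \<open>g\<close> along the vector field \<open>w\<close> in coordinates, that is
  \<open>w\<^sup>k \<partial>\<^sub>k g\<^sub>i\<^sub>j + g\<^sub>k\<^sub>j \<partial>\<^sub>i w\<^sup>k + g\<^sub>i\<^sub>k \<partial>\<^sub>j w\<^sup>k\<close> contracted with \<open>u\<^sup>i v\<^sup>j\<close>.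
\<close>

definition lie_derivative_metric ::
  "('e::euclidean_space \<Rightarrow> 'e) \<Rightarrow> ('e \<Rightarrow> 'e \<Rightarrow> 'e \<Rightarrow> real) \<Rightarrow> 'e \<Rightarrow> 'e \<Rightarrow> 'e \<Rightarrow> real"
  where "lie_derivative_metric w g x u v =
    dirderiv (\<lambda>y. g y u v) x (w x) + g x (dirderiv w x u) v + g x u (dirderiv w x v)"

definition killing_field ::
  "('m, 'e::euclidean_space) mfd \<Rightarrow> ('m, 'e) metric \<Rightarrow> ('m, 'e) vector_field \<Rightarrow> bool"
  where "killing_field M h W \<longleftrightarrow>
    smooth_vector_field M W \<and>
    (\<forall>c\<in>atlas M. \<forall>x\<in>chart_img c. \<forall>u v.
       lie_derivative_metric (field_rep W c) (metric_rep M h c) x u v = 0)"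

definition unit_length ::
  "('m, 'e::euclidean_space) mfd \<Rightarrow> ('m, 'e) metric \<Rightarrow> ('m, 'e) vector_field \<Rightarrow> bool"
  where "unit_length M h W \<longleftrightarrow> (\<forall>p\<in>points M. h p (W p) (W p) = 1)"


section \<open>CC-Kropina metrics\<close>

text \<open>
  \<open>F\<close> is the CC-Kropina metric on \<open>M\<close> with navigation data \<open>(h, W)\<close>, where \<open>A\<close> is its domain;
  the values of \<open>F\<close> outside \<open>A\<close> are irrelevant.
\<close>

definition CC_Kropina_metric ::
  "('m, 'e::euclidean_space) mfd \<Rightarrow> ('m, 'e) metric \<Rightarrow> ('m, 'e) vector_field \<Rightarrow>
   ('m \<times> ('m, 'e) tangent) set \<Rightarrow> ('m \<times> ('m, 'e) tangent \<Rightarrow> real) \<Rightarrow> bool"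
  where "CC_Kropina_metric M h W A F \<longleftrightarrow>
    riemannian_manifold M h \<and> (\<exists>\<kappa>. constant_curvature M h \<kappa>) \<and>
    killing_field M h W \<and> unit_length M h W \<and>
    A = {(p, y). p \<in> points M \<and> y \<in> tangent_space M p \<and> h p y (W p) > 0} \<and>
    (\<forall>(p, y)\<in>A. F (p, y) = h p y y / (2 * h p y (W p)))"


section \<open>Local isometries\<close>

definition isometry_between ::
  "('m, 'e::euclidean_space) mfd \<Rightarrow> ('m, 'e) metric \<Rightarrow> 'm set \<Rightarrow>
   ('n, 'f::euclidean_space) mfd \<Rightarrow> ('n, 'f) metric \<Rightarrow> 'n set \<Rightarrow> ('m \<Rightarrow> 'n) \<Rightarrow> bool"
  where "isometry_between M h U N k V f \<longleftrightarrow>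
    bij_betw f U V \<and> smooth_map_on M N U f \<and> smooth_map_on N M V (inv_into U f) \<and>
    (\<forall>p\<in>U. \<forall>u\<in>tangent_space M p. \<forall>v\<in>tangent_space M p.
       k (f p) (differential M N f p u) (differential M N f p v) = h p u v)"

definition locally_isometric ::
  "('m, 'e::euclidean_space) mfd \<Rightarrow> ('m, 'e) metric \<Rightarrow>
   ('n, 'f::euclidean_space) mfd \<Rightarrow> ('n, 'f) metric \<Rightarrow> bool"
  where "locally_isometric M h N k \<longleftrightarrow>
    (\<forall>p\<in>points M. \<exists>U V f. openin (top_of M) U \<and> p \<in> U \<and> openin (top_of N) V \<and>
       isometry_between M h U N k V f)"

definition scale_metric :: "real \<Rightarrow> ('m, 'e) metric \<Rightarrow> ('m, 'e) metric"
  where "scale_metric r h = (\<lambda>p u v. r * h p u v)"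


section \<open>Euclidean spaces and spheres\<close>

definition Euclid :: "('e::euclidean_space, 'e) mfd"
  where "Euclid = \<lparr>top_of = euclidean, atlas = {(UNIV, id)}\<rparr>"

definition Euclid_metric :: "('e::euclidean_space, 'e) metric"
  where "Euclid_metric p u v = u (UNIV, id) \<bullet> v (UNIV, id)"

text \<open>
  The unit sphere of dimension \<open>n = DIM('e)\<close> in the Euclidean space \<open>'e \<times> real\<close> of dimension
  \<open>n + 1\<close>, with the stereographic projections from the two poles as charts and with the metric
  induced from the ambient space.
\<close>

definition Sphere :: "('e::euclidean_space \<times> real, 'e) mfd"
  where "Sphere =
    \<lparr>top_of = top_of_set (sphere 0 1),
     atlas = {(sphere 0 1 - {(0, 1)}, \<lambda>(x, t). x /\<^sub>R (1 - t)),
              (sphere 0 1 - {(0, -1)}, \<lambda>(x, t). x /\<^sub>R (1 + t))}\<rparr>"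

definition Sphere_metric :: "('e::euclidean_space \<times> real, 'e) metric"
  where "Sphere_metric p u v =
    Euclid_metric p (differential Sphere Euclid id p u) (differential Sphere Euclid id p v)"

end

theory Submission
  imports Defs
begin

text \<open>
  The covariant derivative \<open>A = \<nabla>W\<close> of a unit Killing field \<open>W\<close> is skew and kills \<open>W\<close>, and differentiating
  these two identities yields \<open>g(R(u, W)W, u) = |Au|\<^sup>2\<close>. In constant curvature \<open>\<kappa>\<close> this says
  \<open>|Au|\<^sup>2 = \<kappa> (|u|\<^sup>2 - g(u, W)\<^sup>2)\<close>. Hence \<open>\<kappa> \<ge> 0\<close>, and if \<open>\<kappa> > 0\<close>, then the skew map \<open>A\<close> is invertible on the
  orthogonal complement of \<open>W\<close>, which therefore has even dimension.

  In constant curvature \<open>\<kappa>\<close> the linear system \<open>\<nabla>V = - \<kappa> f id\<close>, \<open>df = g(V, \<cdot>)\<close> for a vector field \<open>V\<close> and a function \<open>f\<close>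
  is integrable, so it has local solutions with arbitrary initial values; these come from a Picard iteration
  along rays. As \<open>g(V, V') + \<kappa> f f'\<close> is constant for any two solutions, the functions \<open>f\<close> belonging to
  orthonormal initial values are the components of a local isometry onto an open subset of Euclidean space
  (\<open>\<kappa> = 0\<close>) or of the sphere of radius \<open>1 / sqrt \<kappa>\<close> (\<open>\<kappa> > 0\<close>).

  Constant fields on Euclidean space and Hopf fields on odd-dimensional spheres are unit Killing fields.
\<close>

section \<open>Smooth maps\<close>

text \<open>The geometry takes place in one chart, on an open subset of \<open>real^'n\<close> with
  a metric depending on the point; manifolds enter only when the result is transported. Three
  obstacles shape the proof. A local isometry needs several solutions on a common neighbourhood.
  Next, the inverse function theorem provides only a differentiable inverse of the developing map;
  its smoothness is read off from an explicit total differential equation which the inverse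
  satisfies. Finally, the orthogonal complement of W has no type of its own. Its parity is therefore
  extracted from a determinant on the whole tangent space, where the row and the column belonging to
  W vanish and a single nonzero diagonal entry is put in their place.\<close>

lemma Ck_on_subset: "Ck_on k S f \<Longrightarrow> T \<subseteq> S \<Longrightarrow> Ck_on k T f"
  by (induction k arbitrary: f) (auto intro: continuous_on_subset)

lemma Ck_on_Suc_imp: "Ck_on (Suc k) S f \<Longrightarrow> Ck_on k S f"
proof (induction k arbitrary: f)
  case 0
  then show ?case
    by (auto intro!: continuous_at_imp_continuous_on differentiable_imp_continuous_within)
next
  case (Suc k)
  have "Ck_on k S (\<lambda>x. dirderiv f x v)" for v
    using Suc.prems by (intro Suc.IH) simp
  with Suc.prems show ?case by simp
qed

text \<open>Frechet derivatives at a point of \<open>S\<close> see a whole neighbourhood, so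
  agreement on \<open>S\<close> is inherited by the derivatives only because \<open>S\<close> is
  open.\<close>

lemma Ck_on_cong:
  assumes "open S" "\<And>x. x \<in> S \<Longrightarrow> f x = g x" "Ck_on k S f"
  shows "Ck_on k S g"
  using assms(2,3)
proof (induction k arbitrary: f g)
  case 0
  then show ?case using continuous_on_cong[of S S f g] by simp
next
  case (Suc k)
  have d: "dirderiv g x = dirderiv f x" "g differentiable (at x)" if "x \<in> S" for x
  proof -
    have "(f has_derivative dirderiv f x) (at x)"
      using Suc.prems(2) that by (simp add: frechet_derivative_works)
    then have "(g has_derivative dirderiv f x) (at x)"
      by (rule has_derivative_transform_within_open[OF _ \<open>open S\<close> that]) (use Suc.prems in auto)
    then show "dirderiv g x = dirderiv f x" "g differentiable (at x)"
      by (auto simp: frechet_derivative_at[symmetric] differentiable_def)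
  qed
  have "Ck_on k S (\<lambda>x. dirderiv g x v)" for v
    by (rule Suc.IH[of "\<lambda>x. dirderiv f x v"]) (use Suc.prems d in auto)
  with d show ?case by simp
qed

text \<open>Allows any formula for the derivative in place of \<open>dirderiv\<close>. Each
  differentiation rule below enters its induction through this lemma.\<close>

lemma Ck_on_SucI:
  assumes "open S" "\<And>x. x \<in> S \<Longrightarrow> (f has_derivative f' x) (at x)"
    "\<And>v. Ck_on k S (\<lambda>x. f' x v)"
  shows "Ck_on (Suc k) S f"
proof -
  have "dirderiv f x = f' x" if "x \<in> S" for x
    using frechet_derivative_at[OF assms(2)[OF that]] by simp
  then have "Ck_on k S (\<lambda>x. dirderiv f x v)" for v
    by (intro Ck_on_cong[OF assms(1) _ assms(3)[of v]]) auto
  with assms(2) show ?thesis by (auto simp: differentiable_def)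
qed

lemma Ck_on_has_derivative:
  assumes "Ck_on (Suc k) S f" "x \<in> S"
  shows "(f has_derivative dirderiv f x) (at x)"
  using assms by (simp add: frechet_derivative_works)

lemma Ck_on_const [simp]: "open S \<Longrightarrow> Ck_on k S (\<lambda>x. c)"
  by (induction k arbitrary: c) auto

lemma Ck_on_linear:
  assumes "open S" "bounded_linear L"
  shows "Ck_on k S L"
proof (cases k)
  case 0
  then show ?thesis by (simp add: assms(2) linear_continuous_on)
next
  case (Suc j)
  show ?thesis unfolding Suc
    by (rule Ck_on_SucI[where f' = "\<lambda>x. L"]) (use assms in \<open>auto intro: bounded_linear_imp_has_derivative\<close>)
qed

lemma Ck_on_add:
  assumes "open S" "Ck_on k S f" "Ck_on k S g"
  shows "Ck_on k S (\<lambda>x. f x + g x)"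
  using assms(2,3)
proof (induction k arbitrary: f g)
  case (Suc k)
  show ?case
    by (rule Ck_on_SucI[OF \<open>open S\<close>, where f' = "\<lambda>x v. dirderiv f x v + dirderiv g x v"],
        rule has_derivative_add; rule Ck_on_has_derivative[of k S] Suc.IH)
      (use Suc.prems in auto)
qed (auto intro: continuous_intros)

lemma Ck_on_bilinear:
  assumes "open S" "bounded_bilinear B" "Ck_on k S f" "Ck_on k S g"
  shows "Ck_on k S (\<lambda>x. B (f x) (g x))"
  using assms(3,4)
proof (induction k arbitrary: f g)
  case 0
  then show ?case using bounded_bilinear.continuous_on[OF assms(2)] by auto
next
  case (Suc k)
  show ?case
  proof (rule Ck_on_SucI[OF \<open>open S\<close>])
    fix x assume "x \<in> S"
    then show "((\<lambda>x. B (f x) (g x)) has_derivative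
        (\<lambda>h. B (f x) (dirderiv g x h) + B (dirderiv f x h) (g x))) (at x)"
      using Suc.prems by (intro bounded_bilinear.FDERIV[OF assms(2)] Ck_on_has_derivative) auto
  next
    fix v
    show "Ck_on k S (\<lambda>x. B (f x) (dirderiv g x v) + B (dirderiv f x v) (g x))"
      by (intro Ck_on_add[OF \<open>open S\<close>] Suc.IH)
        (use Suc.prems Ck_on_Suc_imp[OF Suc.prems(1)] Ck_on_Suc_imp[OF Suc.prems(2)] in auto)
  qed
qed

lemma Ck_on_sum:
  assumes "open S" "\<And>i. i \<in> I \<Longrightarrow> Ck_on k S (f i)"
  shows "Ck_on k S (\<lambda>x. \<Sum>i\<in>I. f i x)"
  using assms(2)
  by (induction I rule: infinite_finite_induct) (auto intro!: Ck_on_add simp: assms(1))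

lemma Ck_on_compose:
  fixes f :: "'b::euclidean_space \<Rightarrow> 'c::real_normed_vector" and g :: "'a::real_normed_vector \<Rightarrow> 'b"
  assumes "open S" "g ` S \<subseteq> T" "Ck_on k T f" "Ck_on k S g"
  shows "Ck_on k S (\<lambda>x. f (g x))"
  using assms(2,3,4)
proof (induction k arbitrary: f g)
  case 0
  then show ?case by (auto intro: continuous_on_compose2)
next
  case (Suc k)
  show ?case
  proof (rule Ck_on_SucI[OF \<open>open S\<close>])
    fix x assume x: "x \<in> S"
    have g: "(g has_derivative dirderiv g x) (at x)"
      using Suc.prems x by (intro Ck_on_has_derivative)
    have f: "(f has_derivative dirderiv f (g x)) (at (g x))"
      using Suc.prems x by (intro Ck_on_has_derivative) auto
    have "((\<lambda>x. f (g x)) has_derivative (\<lambda>h. dirderiv f (g x) (dirderiv g x h))) (at x)"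
      using diff_chain_at[OF g f] by (simp add: o_def)
    \<comment> \<open>\<open>Ck_on\<close> controls derivatives in constant directions only, whereas
      the direction \<open>dirderiv g x h\<close> varies with \<open>x\<close>. Expanding it in the
      basis of the middle space leaves constant directions with scalar coefficients.\<close>
    moreover have "(\<lambda>h. dirderiv f (g x) (dirderiv g x h)) =
        (\<lambda>h. \<Sum>b\<in>Basis. (dirderiv g x h \<bullet> b) *\<^sub>R dirderiv f (g x) b)"
    proof
      fix h
      let ?w = "dirderiv g x h"
      have "dirderiv f (g x) ?w = dirderiv f (g x) (\<Sum>b\<in>Basis. (?w \<bullet> b) *\<^sub>R b)"
        by (simp add: euclidean_representation)
      also have "\<dots> = (\<Sum>b\<in>Basis. (?w \<bullet> b) *\<^sub>R dirderiv f (g x) b)"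
        using has_derivative_linear[OF f] by (simp add: linear_sum linear_cmul)
      finally show "dirderiv f (g x) ?w = (\<Sum>b\<in>Basis. (?w \<bullet> b) *\<^sub>R dirderiv f (g x) b)" .
    qed
    ultimately show "((\<lambda>x. f (g x)) has_derivative
        (\<lambda>h. \<Sum>b\<in>Basis. (dirderiv g x h \<bullet> b) *\<^sub>R dirderiv f (g x) b)) (at x)"
      by (rule has_derivative_eq_rhs)
  next
    fix v
    show "Ck_on k S (\<lambda>x. \<Sum>b\<in>Basis. (dirderiv g x v \<bullet> b) *\<^sub>R dirderiv f (g x) b)"
    proof (intro Ck_on_sum Ck_on_bilinear[OF _ bounded_bilinear_scaleR] \<open>open S\<close>)
      fix b :: 'b
      show "Ck_on k S (\<lambda>x. dirderiv g x v \<bullet> b)"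
        by (rule Ck_on_bilinear[OF _ bounded_bilinear_inner]) (use Suc.prems \<open>open S\<close> in auto)
      show "Ck_on k S (\<lambda>x. dirderiv f (g x) b)"
        by (rule Suc.IH) (use Suc.prems Ck_on_Suc_imp[OF Suc.prems(3)] in auto)
    qed
  qed
qed

lemma Ck_on_inverse:
  fixes f :: "'a::real_normed_vector \<Rightarrow> real"
  assumes "open S" "\<And>x. x \<in> S \<Longrightarrow> f x \<noteq> 0" "Ck_on k S f"
  shows "Ck_on k S (\<lambda>x. inverse (f x))"
  using assms(3)
proof (induction k)
  case 0
  then show ?case using assms(2) by (auto intro: continuous_on_inverse)
next
  case (Suc k)
  \<comment> \<open>The reciprocal reappears in its own derivative, so the induction hypothesis is
    applied to the reciprocal itself.\<close>
  have inv: "Ck_on k S (\<lambda>x. inverse (f x))"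
    using Suc Ck_on_Suc_imp by blast
  show ?case
  proof (rule Ck_on_SucI[OF \<open>open S\<close>])
    fix x assume "x \<in> S"
    then show "((\<lambda>x. inverse (f x)) has_derivative
        (\<lambda>h. - (inverse (f x) * dirderiv f x h * inverse (f x)))) (at x)"
      using Suc.prems assms(2) by (intro Deriv.has_derivative_inverse Ck_on_has_derivative)
  next
    fix v
    have "Ck_on k S (\<lambda>x. (-1) * ((inverse (f x) * dirderiv f x v) * inverse (f x)))"
      by (intro Ck_on_bilinear[OF \<open>open S\<close> bounded_bilinear_mult] inv Ck_on_const)
        (use Suc.prems \<open>open S\<close> in auto)
    then show "Ck_on k S (\<lambda>x. - (inverse (f x) * dirderiv f x v * inverse (f x)))" by simp
  qed
qed

section \<open>Closure properties of smooth maps\<close>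

lemma smooth_on_subset: "smooth_on S f \<Longrightarrow> T \<subseteq> S \<Longrightarrow> smooth_on T f"
  unfolding smooth_on_def using Ck_on_subset by blast

lemma smooth_on_cong:
  assumes "open S" "\<And>x. x \<in> S \<Longrightarrow> f x = g x" "smooth_on S f"
  shows "smooth_on S g"
  unfolding smooth_on_def
proof
  fix k
  show "Ck_on k S g"
    using assms by (intro Ck_on_cong[of S f g]) (auto simp: smooth_on_def)
qed

lemma smooth_on_has_derivative:
  assumes "smooth_on S f" "x \<in> S"
  shows "(f has_derivative dirderiv f x) (at x)"
  using assms Ck_on_has_derivative unfolding smooth_on_def by blast

lemma smooth_on_dirderiv:
  assumes "smooth_on S f"
  shows "smooth_on S (\<lambda>x. dirderiv f x v)"
  unfolding smooth_on_def
proof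
  fix k
  have "Ck_on (Suc k) S f" using assms unfolding smooth_on_def by blast
  then show "Ck_on k S (\<lambda>x. dirderiv f x v)" by simp
qed

lemma smooth_on_imp_continuous_on: "smooth_on S f \<Longrightarrow> continuous_on S f"
  unfolding smooth_on_def by (metis Ck_on.simps(1))

lemma smooth_on_const: "open S \<Longrightarrow> smooth_on S (\<lambda>x. c)"
  by (simp add: smooth_on_def)

lemma smooth_on_linear: "open S \<Longrightarrow> bounded_linear L \<Longrightarrow> smooth_on S L"
  by (simp add: smooth_on_def Ck_on_linear)

lemma smooth_on_ident: "open S \<Longrightarrow> smooth_on S (\<lambda>x. x)"
  by (intro smooth_on_linear bounded_linear_ident)

lemma smooth_on_add:
  assumes "open S" "smooth_on S f" "smooth_on S g"
  shows "smooth_on S (\<lambda>x. f x + g x)"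
  unfolding smooth_on_def
  using assms(2,3) by (intro allI Ck_on_add[OF assms(1)]) (simp_all add: smooth_on_def)

lemma smooth_on_bilinear:
  assumes "open S" "bounded_bilinear B" "smooth_on S f" "smooth_on S g"
  shows "smooth_on S (\<lambda>x. B (f x) (g x))"
  using assms by (simp add: smooth_on_def Ck_on_bilinear)

lemmas smooth_on_scaleR = smooth_on_bilinear[OF _ bounded_bilinear_scaleR]
lemmas smooth_on_inner = smooth_on_bilinear[OF _ bounded_bilinear_inner]

lemma smooth_on_mult:
  fixes f g :: "'a::real_normed_vector \<Rightarrow> real"
  shows "open S \<Longrightarrow> smooth_on S f \<Longrightarrow> smooth_on S g \<Longrightarrow> smooth_on S (\<lambda>x. f x * g x)"
  by (rule smooth_on_bilinear[OF _ bounded_bilinear_mult])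

lemma smooth_on_sum:
  assumes "open S" "\<And>i. i \<in> I \<Longrightarrow> smooth_on S (f i)"
  shows "smooth_on S (\<lambda>x. \<Sum>i\<in>I. f i x)"
  unfolding smooth_on_def
  using assms(2) by (intro allI Ck_on_sum[OF assms(1)]) (simp add: smooth_on_def)

lemma smooth_on_prod:
  fixes f :: "'i \<Rightarrow> 'a::real_normed_vector \<Rightarrow> real"
  assumes "open S" "\<And>i. i \<in> I \<Longrightarrow> smooth_on S (f i)"
  shows "smooth_on S (\<lambda>x. \<Prod>i\<in>I. f i x)"
  using assms(2)
  by (induction I rule: infinite_finite_induct)
    (auto intro!: smooth_on_mult smooth_on_const simp: assms(1))

lemma smooth_on_compose:
  fixes f :: "'b::euclidean_space \<Rightarrow> 'c::real_normed_vector" and g :: "'a::real_normed_vector \<Rightarrow> 'b"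
  assumes "open S" "g ` S \<subseteq> T" "smooth_on T f" "smooth_on S g"
  shows "smooth_on S (\<lambda>x. f (g x))"
  using assms Ck_on_compose unfolding smooth_on_def by blast

lemma smooth_on_minus:
  assumes "open S" "smooth_on S f"
  shows "smooth_on S (\<lambda>x. - f x)"
proof -
  have "smooth_on S (\<lambda>x. (-1) *\<^sub>R f x)"
    by (intro smooth_on_scaleR smooth_on_const assms)
  then show ?thesis by simp
qed

lemma smooth_on_diff:
  assumes "open S" "smooth_on S f" "smooth_on S g"
  shows "smooth_on S (\<lambda>x. f x - g x)"
  using smooth_on_add[OF assms(1,2) smooth_on_minus[OF assms(1,3)]] by simp

lemma smooth_on_inverse:
  fixes f :: "'a::real_normed_vector \<Rightarrow> real"
  shows "open S \<Longrightarrow> (\<And>x. x \<in> S \<Longrightarrow> f x \<noteq> 0) \<Longrightarrow> smooth_on S f \<Longrightarrow> smooth_on S (\<lambda>x. inverse (f x))"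
  by (simp add: smooth_on_def Ck_on_inverse)

lemma smooth_on_divide:
  fixes f g :: "'a::real_normed_vector \<Rightarrow> real"
  shows "open S \<Longrightarrow> (\<And>x. x \<in> S \<Longrightarrow> g x \<noteq> 0) \<Longrightarrow> smooth_on S f \<Longrightarrow> smooth_on S g \<Longrightarrow>
    smooth_on S (\<lambda>x. f x / g x)"
  unfolding divide_inverse by (intro smooth_on_mult smooth_on_inverse)

lemma smooth_on_bounded_linear:
  assumes "open S" "bounded_linear L" "smooth_on S f"
  shows "smooth_on S (\<lambda>x. L (f x))"
proof -
  have "bounded_bilinear (\<lambda>(c::real) y. c *\<^sub>R L y)"
    using bounded_bilinear.comp[OF bounded_bilinear_scaleR bounded_linear_ident assms(2)] .
  from smooth_on_bilinear[OF assms(1) this smooth_on_const[OF assms(1), of 1] assms(3)]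
  show ?thesis by simp
qed

lemmas smooth_on_fst = smooth_on_bounded_linear[OF _ bounded_linear_fst]
lemmas smooth_on_snd = smooth_on_bounded_linear[OF _ bounded_linear_snd]

lemma smooth_on_Pair:
  assumes "open S" "smooth_on S f" "smooth_on S g"
  shows "smooth_on S (\<lambda>x. (f x, g x))"
proof -
  have "bounded_linear (\<lambda>y. (y, 0))" "bounded_linear (\<lambda>y. (0, y))"
    by (auto intro: bounded_linear_Pair)
  from smooth_on_add[OF assms(1) smooth_on_bounded_linear[OF assms(1) this(1) assms(2)]
    smooth_on_bounded_linear[OF assms(1) this(2) assms(3)]]
  show ?thesis by simp
qed

lemmas smooth_on_intros = smooth_on_const smooth_on_ident smooth_on_add smooth_on_minus
  smooth_on_diff smooth_on_mult smooth_on_scaleR smooth_on_inner smooth_on_sum smooth_on_prod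
  smooth_on_inverse smooth_on_divide smooth_on_Pair smooth_on_fst smooth_on_snd

text \<open>Bootstrapping: if \<open>Y\<close> is of class \<open>C\<^sup>k\<close>, then so is the right-hand side, so \<open>Y\<close> is
  of class \<open>C\<^sup>k\<^sup>+\<^sup>1\<close>.\<close>

lemma smooth_on_total_differential_equation:
  fixes Y :: "'a::euclidean_space \<Rightarrow> 'b::euclidean_space"
  assumes "open S" "\<And>x. x \<in> S \<Longrightarrow> (x, Y x) \<in> T"
    and deriv: "\<And>x. x \<in> S \<Longrightarrow> (Y has_derivative (\<lambda>v. H v (x, Y x))) (at x)"
    and H: "\<And>v. smooth_on T (H v)"
  shows "smooth_on S Y"
  unfolding smooth_on_def
proof
  fix k
  show "Ck_on k S Y"
  proof (induction k)
    case 0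
    show ?case
      using deriv by (auto intro!: continuous_at_imp_continuous_on has_derivative_continuous)
  next
    case (Suc k)
    have "Ck_on k S (\<lambda>x. (x, 0) + (0, Y x))"
      by (intro Ck_on_add[OF \<open>open S\<close>] Ck_on_linear[OF \<open>open S\<close>] bounded_linear_Pair
          bounded_linear_ident bounded_linear_zero Ck_on_compose[OF \<open>open S\<close> subset_UNIV _ Suc])
        (auto intro!: Ck_on_linear bounded_linear_Pair bounded_linear_ident)
    then have pair: "Ck_on k S (\<lambda>x. (x, Y x))" by simp
    have "Ck_on k S (\<lambda>x. H v (x, Y x))" for v
      by (rule Ck_on_compose[OF \<open>open S\<close>, where T = T and f = "H v" and g = "\<lambda>x. (x, Y x)"])
        (use H assms(2) pair in \<open>auto simp: smooth_on_def\<close>)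
    with deriv show ?case
      by (intro Ck_on_SucI[OF \<open>open S\<close>, where f' = "\<lambda>x v. H v (x, Y x)"])
  qed
qed

text \<open>The two mean values of the second difference, taken in either order, tend to the two mixed
  derivatives.\<close>

lemma second_difference_mean_value:
  fixes f :: "'a::euclidean_space \<Rightarrow> real"
  assumes "convex S" "x \<in> S" "x + s *\<^sub>R u \<in> S" "x + s *\<^sub>R v \<in> S" "x + s *\<^sub>R u + s *\<^sub>R v \<in> S" "open S"
    "smooth_on S f" "s > 0"
  obtains a b where "a \<in> {0..s}" "b \<in> {0..s}" "x + a *\<^sub>R u + b *\<^sub>R v \<in> S"
    "f (x + s *\<^sub>R u + s *\<^sub>R v) - f (x + s *\<^sub>R u) - f (x + s *\<^sub>R v) + f x =
     s\<^sup>2 * dirderiv (\<lambda>y. dirderiv f y u) (x + a *\<^sub>R u + b *\<^sub>R v) v"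
proof -
  have in_S: "x + a *\<^sub>R u + b *\<^sub>R v \<in> S" if "a \<in> {0..s}" "b \<in> {0..s}" for a b
  proof -
    have seg: "p + (c / s) *\<^sub>R (q - p) \<in> S" if "p \<in> S" "q \<in> S" "c \<in> {0..s}" for p q c
      using convexD_alt[OF \<open>convex S\<close> that(1,2), of "c / s"] that(3) \<open>s > 0\<close>
      by (simp add: algebra_simps)
    have 1: "x + a *\<^sub>R u \<in> S" using seg[OF assms(2,3) that(1)] \<open>s > 0\<close> by simp
    have 2: "x + s *\<^sub>R v + a *\<^sub>R u \<in> S"
      using seg[OF assms(4,5) that(1)] \<open>s > 0\<close> by (simp add: algebra_simps)
    show ?thesis using seg[OF 1 2 that(2)] \<open>s > 0\<close> by (simp add: algebra_simps)
  qed
  let ?F = "\<lambda>a. f (x + a *\<^sub>R u + s *\<^sub>R v) - f (x + a *\<^sub>R u)"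
  let ?F' = "\<lambda>a. dirderiv f (x + a *\<^sub>R u + s *\<^sub>R v) u - dirderiv f (x + a *\<^sub>R u) u"
  have line: "((\<lambda>a. h (p + a *\<^sub>R w)) has_real_derivative dirderiv h (p + a *\<^sub>R w) w) (at a)"
    if "smooth_on S h" "p + a *\<^sub>R w \<in> S" for h :: "'a \<Rightarrow> real" and p w a
  proof -
    have d: "(h has_derivative dirderiv h (p + a *\<^sub>R w)) (at (p + a *\<^sub>R w))"
      using that by (rule smooth_on_has_derivative)
    have "((\<lambda>a. p + a *\<^sub>R w) has_derivative (\<lambda>t. t *\<^sub>R w)) (at a)"
      by (auto intro!: derivative_eq_intros)
    from diff_chain_at[OF this d] show ?thesis
      using linear_cmul[OF has_derivative_linear[OF d]]
      by (simp add: has_field_derivative_def o_def mult.commute[of _ "dirderiv h (p + a *\<^sub>R w) w"])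
  qed
  have "(?F has_real_derivative ?F' a) (at a)" if "0 \<le> a" "a \<le> s" for a
  proof (rule DERIV_diff)
    show "((\<lambda>a. f (x + a *\<^sub>R u)) has_real_derivative dirderiv f (x + a *\<^sub>R u) u) (at a)"
      using in_S[of a 0] that \<open>s > 0\<close> by (intro line \<open>smooth_on S f\<close>) auto
    show "((\<lambda>a. f (x + a *\<^sub>R u + s *\<^sub>R v)) has_real_derivative
        dirderiv f (x + a *\<^sub>R u + s *\<^sub>R v) u) (at a)"
      using line[OF \<open>smooth_on S f\<close>, of "x + s *\<^sub>R v" a u] in_S[of a s] that \<open>s > 0\<close>
      by (simp add: algebra_simps)
  qed
  from MVT2[OF \<open>s > 0\<close> this] obtain a where a: "0 < a" "a < s" "?F s - ?F 0 = (s - 0) * ?F' a"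
    by blast
  have "((\<lambda>b. dirderiv f (x + a *\<^sub>R u + b *\<^sub>R v) u) has_real_derivative
      dirderiv (\<lambda>y. dirderiv f y u) (x + a *\<^sub>R u + b *\<^sub>R v) v) (at b)" if "0 \<le> b" "b \<le> s" for b
    using in_S[of a b] a that by (intro line smooth_on_dirderiv \<open>smooth_on S f\<close>) auto
  from MVT2[OF \<open>s > 0\<close> this] obtain b where b: "0 < b" "b < s"
    "?F' a = (s - 0) * dirderiv (\<lambda>y. dirderiv f y u) (x + a *\<^sub>R u + b *\<^sub>R v) v"
    by auto
  show ?thesis
    by (rule that[of a b]) (use a b in_S in \<open>auto simp: power2_eq_square algebra_simps\<close>)
qed

text \<open>Schwarz's theorem: the second difference over a shrinking parallelogram is symmetric in
  the two directions, and the derivatives at both kinds of mean value points converge by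
  continuity.\<close>

lemma dirderiv_commute:
  fixes f :: "'a::euclidean_space \<Rightarrow> real"
  assumes "open S" "smooth_on S f" "x \<in> S"
  shows "dirderiv (\<lambda>y. dirderiv f y u) x v = dirderiv (\<lambda>y. dirderiv f y v) x u"
proof -
  obtain e where e: "e > 0" "ball x e \<subseteq> S" using assms by (meson openE)
  have f: "smooth_on (ball x e) f" using assms(2) e(2) by (rule smooth_on_subset)
  \<comment> \<open>The side length keeps the parallelogram inside the ball. The summand 1 covers
    \<open>u = v = 0\<close>, and the divisor \<open>n + 2\<close> gives both strictness and
    convergence to 0.\<close>
  define s where "s n = e / (1 + norm u + norm v) / (real n + 2)" for n
  have "e / (1 + norm u + norm v) > 0" using e by (auto intro!: divide_pos_pos add_pos_nonneg)
  then have s0: "s n > 0" for n unfolding s_def by (rule divide_pos_pos) simp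
  have s1: "s n * (norm u + norm v) < e" for n
  proof -
    have "s n < e / (1 + norm u + norm v)"
      using mult_strict_left_mono[OF _ \<open>e / (1 + norm u + norm v) > 0\<close>, of 1 "real n + 2"]
      unfolding s_def by (subst pos_divide_less_eq) auto
    then have "s n * (1 + norm u + norm v) < e"
      by (simp add: pos_less_divide_eq add_pos_nonneg add.assoc)
    then show ?thesis using s0[of n] by (simp add: algebra_simps)
  qed
  have "s = (\<lambda>n. e / (1 + norm u + norm v) * inverse (real (n + 2)))"
    by (auto simp: s_def divide_inverse add.commute)
  then have s_lim: "s \<longlonglongrightarrow> 0"
    using tendsto_mult_left[OF LIMSEQ_ignore_initial_segment[OF lim_inverse_n, of 2],
        of "e / (1 + norm u + norm v)"] by simp
  \<comment> \<open>Stated for arbitrary directions, with \<open>s\<close> fixed, so that it can be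
    used once for each order of the two original directions along the same sequence.\<close>
  have ex: "\<exists>z. z \<in> ball x e \<and> dist z x \<le> s n * (norm u + norm v) \<and>
      f (x + s n *\<^sub>R u + s n *\<^sub>R v) - f (x + s n *\<^sub>R u) - f (x + s n *\<^sub>R v) + f x =
      (s n)\<^sup>2 * dirderiv (\<lambda>y. dirderiv f y u) z v"
    if uv: "norm u + norm v = c" "s n * c < e" for u v n c
  proof -
    have near: "dist (x + a *\<^sub>R u + b *\<^sub>R v) x \<le> s n * (norm u + norm v)"
      if "a \<in> {0..s n}" "b \<in> {0..s n}" for a b
    proof -
      have "norm (a *\<^sub>R u + b *\<^sub>R v) \<le> a * norm u + b * norm v"
        using norm_triangle_ineq[of "a *\<^sub>R u" "b *\<^sub>R v"] that by simp
      also have "\<dots> \<le> s n * norm u + s n * norm v"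
        using that by (intro add_mono mult_right_mono) auto
      finally show ?thesis by (simp add: dist_norm algebra_simps)
    qed
    have "x + s n *\<^sub>R u \<in> ball x e" "x + s n *\<^sub>R v \<in> ball x e" "x + s n *\<^sub>R u + s n *\<^sub>R v \<in> ball x e"
      using near[of "s n" 0] near[of 0 "s n"] near[of "s n" "s n"] s0[of n] uv
      by (auto simp: dist_commute[of x])
    then obtain a b where "a \<in> {0..s n}" "b \<in> {0..s n}" "x + a *\<^sub>R u + b *\<^sub>R v \<in> ball x e"
      "f (x + s n *\<^sub>R u + s n *\<^sub>R v) - f (x + s n *\<^sub>R u) - f (x + s n *\<^sub>R v) + f x =
        (s n)\<^sup>2 * dirderiv (\<lambda>y. dirderiv f y u) (x + a *\<^sub>R u + b *\<^sub>R v) v"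
      using second_difference_mean_value[OF convex_ball, of x x e "s n" u v f] e(1) f s0[of n] by auto
    with near[of a b] show ?thesis by blast
  qed
  from ex[of u v, OF refl] s1 obtain y where y: "\<And>n. y n \<in> ball x e"
    "\<And>n. dist (y n) x \<le> s n * (norm u + norm v)"
    "\<And>n. f (x + s n *\<^sub>R u + s n *\<^sub>R v) - f (x + s n *\<^sub>R u) - f (x + s n *\<^sub>R v) + f x =
      (s n)\<^sup>2 * dirderiv (\<lambda>y. dirderiv f y u) (y n) v"
    by metis
  have "s n * (norm v + norm u) < e" for n using s1[of n] by (simp add: add.commute)
  from ex[of v u, OF refl] this obtain z where z: "\<And>n. z n \<in> ball x e"
    "\<And>n. dist (z n) x \<le> s n * (norm v + norm u)"
    "\<And>n. f (x + s n *\<^sub>R v + s n *\<^sub>R u) - f (x + s n *\<^sub>R v) - f (x + s n *\<^sub>R u) + f x =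
      (s n)\<^sup>2 * dirderiv (\<lambda>y. dirderiv f y v) (z n) u"
    by metis
  have lim: "w \<longlonglongrightarrow> x" if "\<And>n. dist (w n) x \<le> s n * c" for w c
  proof -
    have "(\<lambda>n. s n * c) \<longlonglongrightarrow> 0" using tendsto_mult_right[OF s_lim, of c] by simp
    then have "(\<lambda>n. dist (w n) x) \<longlonglongrightarrow> 0"
      by (rule Lim_null_comparison[rotated]) (use that in simp)
    then show ?thesis using tendsto_dist_iff by blast
  qed
  have cont: "(\<lambda>n. dirderiv (\<lambda>y. dirderiv f y p) (w n) q) \<longlonglongrightarrow> dirderiv (\<lambda>y. dirderiv f y p) x q"
    if "w \<longlonglongrightarrow> x" "\<And>n. w n \<in> ball x e" for p q w
    by (rule continuous_on_tendsto_compose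
        [OF smooth_on_imp_continuous_on[OF smooth_on_dirderiv[OF smooth_on_dirderiv[OF f]]] that(1)])
      (use e that in auto)
  \<comment> \<open>Both sides times \<open>(s n)\<^sup>2\<close> are the same second difference,
    and \<open>s n\<close> is positive.\<close>
  have "dirderiv (\<lambda>y. dirderiv f y u) (y n) v = dirderiv (\<lambda>y. dirderiv f y v) (z n) u" for n
    using y(3)[of n] z(3)[of n] s0[of n] by (simp add: algebra_simps)
  then show ?thesis
    using LIMSEQ_unique[OF cont[OF lim[OF y(2)] y(1), of u v]] cont[OF lim[OF z(2)] z(1), of v u]
    by presburger
qed

section \<open>Linear total differential equations\<close>

lemma linear_family_expansion:
  fixes L :: "'b::euclidean_space \<Rightarrow> 'c::real_vector"
  assumes "linear L"
  shows "L w = (\<Sum>b\<in>Basis. (w \<bullet> b) *\<^sub>R L b)"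
proof -
  have "L w = L (\<Sum>b\<in>Basis. (w \<bullet> b) *\<^sub>R b)" by (simp add: euclidean_representation)
  also have "\<dots> = (\<Sum>b\<in>Basis. (w \<bullet> b) *\<^sub>R L b)"
    using assms by (simp add: linear_sum linear_cmul)
  finally show ?thesis .
qed

text \<open>A linear map on a finite-dimensional space is determined by its values on the basis, so
  continuity for each fixed vector already gives joint continuity. The next two lemmas use the same
  expansion for differentiability classes.\<close>

lemma continuous_on_linear_family:
  fixes L :: "'a::topological_space \<Rightarrow> 'b::euclidean_space \<Rightarrow> 'c::real_normed_vector"
  assumes "\<And>x. x \<in> B \<Longrightarrow> linear (L x)" "\<And>v. continuous_on B (\<lambda>x. L x v)"
    "continuous_on S p" "p ` S \<subseteq> B" "continuous_on S q"
  shows "continuous_on S (\<lambda>s. L (p s) (q s))"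
proof -
  have "continuous_on S (\<lambda>s. \<Sum>b\<in>Basis. (q s \<bullet> b) *\<^sub>R L (p s) b)"
    by (intro continuous_intros assms continuous_on_compose2[OF assms(2) assms(3,4)])
  moreover have "L (p s) (q s) = (\<Sum>b\<in>Basis. (q s \<bullet> b) *\<^sub>R L (p s) b)" if "s \<in> S" for s
    using that assms by (intro linear_family_expansion) auto
  ultimately show ?thesis by (simp cong: continuous_on_cong_simp)
qed

lemma Ck_on_linear_family:
  fixes L :: "'a::real_normed_vector \<Rightarrow> 'b::euclidean_space \<Rightarrow> 'c::real_normed_vector"
  assumes "open S" and lin: "\<And>x. x \<in> S \<Longrightarrow> linear (L x)"
    and L: "\<And>v. Ck_on k S (\<lambda>x. L x v)" and q: "Ck_on k S q"
  shows "Ck_on k S (\<lambda>x. L x (q x))"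
proof (rule Ck_on_cong[OF \<open>open S\<close>])
  show "Ck_on k S (\<lambda>x. \<Sum>b\<in>Basis. (q x \<bullet> b) *\<^sub>R L x b)"
    by (intro Ck_on_sum Ck_on_bilinear[OF _ bounded_bilinear_scaleR]
        Ck_on_bilinear[OF _ bounded_bilinear_inner] L q Ck_on_const \<open>open S\<close>)
  show "(\<Sum>b\<in>Basis. (q x \<bullet> b) *\<^sub>R L x b) = L x (q x)" if "x \<in> S" for x
    using linear_family_expansion[OF lin[OF that], of "q x"] by simp
qed

lemma smooth_on_linear_family:
  fixes L :: "'a::real_normed_vector \<Rightarrow> 'b::euclidean_space \<Rightarrow> 'c::real_normed_vector"
  assumes "open S" "\<And>x. x \<in> S \<Longrightarrow> linear (L x)" "\<And>v. smooth_on S (\<lambda>x. L x v)" "smooth_on S q"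
  shows "smooth_on S (\<lambda>x. L x (q x))"
  unfolding smooth_on_def
proof
  fix k show "Ck_on k S (\<lambda>x. L x (q x))"
    by (rule Ck_on_linear_family[OF \<open>open S\<close>]) (use assms in \<open>auto simp: smooth_on_def\<close>)
qed

text \<open>The product rule for a varying linear map applied to a varying vector. The basis
  expansion reduces it to finitely many products with scalar factors and shows on the way that the
  derivative of the family is again linear in its vector argument.\<close>

lemma has_derivative_linear_family:
  fixes L :: "'a::real_normed_vector \<Rightarrow> 'b::euclidean_space \<Rightarrow> 'c::real_normed_vector"
  assumes "open S" "x \<in> S" and lin: "\<And>x. x \<in> S \<Longrightarrow> linear (L x)"
    and L: "\<And>w. (\<lambda>z. L z w) differentiable (at x)" and q: "(q has_derivative q') (at x)"
  shows "linear (\<lambda>w. dirderiv (\<lambda>z. L z w) x h)" (is ?A)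
    "((\<lambda>z. L z (q z)) has_derivative (\<lambda>h. L x (q' h) + dirderiv (\<lambda>z. L z (q x)) x h)) (at x)" (is ?B)
proof -
  have L': "((\<lambda>z. L z w) has_derivative dirderiv (\<lambda>z. L z w) x) (at x)" for w
    using L by (simp add: frechet_derivative_works)
  have 1: "((\<lambda>z. L z w) has_derivative (\<lambda>h. \<Sum>b\<in>Basis. (w \<bullet> b) *\<^sub>R dirderiv (\<lambda>z. L z b) x h)) (at x)" for w
  proof (rule has_derivative_transform_within_open[OF _ \<open>open S\<close> \<open>x \<in> S\<close>])
    show "((\<lambda>z. \<Sum>b\<in>Basis. (w \<bullet> b) *\<^sub>R L z b) has_derivative
        (\<lambda>h. \<Sum>b\<in>Basis. (w \<bullet> b) *\<^sub>R dirderiv (\<lambda>z. L z b) x h)) (at x)"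
      by (intro has_derivative_sum has_derivative_scaleR_right L')
    show "(\<Sum>b\<in>Basis. (w \<bullet> b) *\<^sub>R L z b) = L z w" if "z \<in> S" for z
      using linear_family_expansion[OF lin[OF that], of w] by simp
  qed
  have 2: "dirderiv (\<lambda>z. L z w) x h = (\<Sum>b\<in>Basis. (w \<bullet> b) *\<^sub>R dirderiv (\<lambda>z. L z b) x h)" for w h
    using has_derivative_unique[OF L' 1, of w] by meson
  show ?A
    by (subst 2) (auto intro!: linearI simp: inner_add_left scaleR_add_left sum.distrib scaleR_sum_right)
  have "((\<lambda>z. \<Sum>b\<in>Basis. (q z \<bullet> b) *\<^sub>R L z b) has_derivative
      (\<lambda>h. \<Sum>b\<in>Basis. (q x \<bullet> b) *\<^sub>R dirderiv (\<lambda>z. L z b) x h + (q' h \<bullet> b) *\<^sub>R L x b)) (at x)"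
    by (intro has_derivative_sum has_derivative_scaleR L' has_derivative_inner_left q)
  moreover have "(\<lambda>h. \<Sum>b\<in>Basis. (q x \<bullet> b) *\<^sub>R dirderiv (\<lambda>z. L z b) x h + (q' h \<bullet> b) *\<^sub>R L x b)
      = (\<lambda>h. L x (q' h) + dirderiv (\<lambda>z. L z (q x)) x h)"
  proof
    fix h
    show "(\<Sum>b\<in>Basis. (q x \<bullet> b) *\<^sub>R dirderiv (\<lambda>z. L z b) x h + (q' h \<bullet> b) *\<^sub>R L x b)
      = L x (q' h) + dirderiv (\<lambda>z. L z (q x)) x h"
      using 2[of "q x" h] linear_family_expansion[OF lin[OF \<open>x \<in> S\<close>], of "q' h"]
      by (simp add: sum.distrib add.commute)
  qed
  ultimately have "((\<lambda>z. \<Sum>b\<in>Basis. (q z \<bullet> b) *\<^sub>R L z b) has_derivative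
      (\<lambda>h. L x (q' h) + dirderiv (\<lambda>z. L z (q x)) x h)) (at x)"
    by (rule has_derivative_eq_rhs)
  then show ?B
  proof (rule has_derivative_transform_within_open[OF _ \<open>open S\<close> \<open>x \<in> S\<close>])
    show "(\<Sum>b\<in>Basis. (q z \<bullet> b) *\<^sub>R L z b) = L z (q z)" if "z \<in> S" for z
      using linear_family_expansion[OF lin[OF that], of "q z"] by simp
  qed
qed

lemma dirderiv_eqI: "(f has_derivative f') (at x) \<Longrightarrow> dirderiv f x = f'"
  using frechet_derivative_at by metis

text \<open>This is \<open>d K\<theta> = \<theta> - K d\<theta>\<close> for the Poincare homotopy operator \<open>K\<close> on a ball.\<close>

lemma has_derivative_radial_integral:
  fixes \<theta> :: "'a::euclidean_space \<Rightarrow> 'a \<Rightarrow> 'b::euclidean_space"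
  assumes lin: "\<And>x. x \<in> ball 0 r \<Longrightarrow> linear (\<theta> x)" and C1: "\<And>v. Ck_on 1 (ball 0 r) (\<lambda>x. \<theta> x v)"
    and x: "x \<in> ball 0 r"
  defines "D \<equiv> \<lambda>x u v. dirderiv (\<lambda>y. \<theta> y v) x u"
  shows "((\<lambda>x. integral {0..1} (\<lambda>t. \<theta> (t *\<^sub>R x) x)) has_derivative
    (\<lambda>h. \<theta> x h + integral {0..1} (\<lambda>t. t *\<^sub>R (D (t *\<^sub>R x) h x - D (t *\<^sub>R x) x h)))) (at x)"
    (is "(?P has_derivative ?P') (at x)")
    and "continuous_on (ball 0 r) (\<lambda>x. D x u v)"
    and "continuous_on (ball 0 r) (\<lambda>x. integral {0..1} (\<lambda>t. t *\<^sub>R (D (t *\<^sub>R x) h x - D (t *\<^sub>R x) x h)))"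
proof -
  let ?B = "ball (0::'a) r"
  have scale: "t *\<^sub>R y \<in> ?B" if "t \<in> {0..1}" "y \<in> ?B" for t y
  proof -
    have "\<bar>t\<bar> * norm y \<le> norm y" using that by (intro mult_left_le_one_le) auto
    then show ?thesis using that by simp
  qed
  have contT: "continuous_on ?B (\<lambda>x. \<theta> x v)" for v
    using Ck_on_Suc_imp[of 0] C1[of v] by simp
  show contD: "continuous_on ?B (\<lambda>x. D x u v)" for u v
    using C1[of v] by (simp add: D_def)
  have dT: "((\<lambda>y. \<theta> y v) has_derivative (\<lambda>u. D x u v)) (at x)" if "x \<in> ?B" for x v
    using C1[of v] that by (simp add: D_def frechet_derivative_works)
  then have Dlin1: "linear (\<lambda>u. D x u v)" if "x \<in> ?B" for x v
    using that has_derivative_linear by blast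
  have Dlin2: "linear (\<lambda>v. D x u v)" if "x \<in> ?B" for x u
    unfolding D_def using has_derivative_linear_family(1)[OF open_ball that, of \<theta> "\<lambda>x. 0" "\<lambda>x. 0"]
      dT[OF that] lin by (auto simp: differentiable_def)
  have contT2: "continuous_on S (\<lambda>s. \<theta> (p s) (q s))"
    if "continuous_on S p" "p ` S \<subseteq> ?B" "continuous_on S q" for S :: "'c::topological_space set" and p q
    by (rule continuous_on_linear_family[where B = ?B]) (use that lin contT in auto)
  have contD2: "continuous_on S (\<lambda>s. D (p s) (q s) (w s))"
    if "continuous_on S p" "p ` S \<subseteq> ?B" "continuous_on S q" "continuous_on S w"
    for S :: "'c::topological_space set" and p q w
  proof (rule continuous_on_linear_family[where B = S and p = id and L = "\<lambda>s. D (p s) (q s)", simplified])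
    show "continuous_on S (\<lambda>s. D (p s) (q s) v)" for v
      by (rule continuous_on_linear_family[where B = ?B and L = "\<lambda>x u. D x u v"]) (use that Dlin1 contD in auto)
  qed (use that Dlin2 in auto)
  have sub1: "(\<lambda>s. snd s *\<^sub>R fst s) ` (?B \<times> {0..1}) \<subseteq> ?B" using scale by force
  let ?f' = "\<lambda>x t h. \<theta> (t *\<^sub>R x) h + t *\<^sub>R D (t *\<^sub>R x) h x"
  have deriv: "((\<lambda>y. \<theta> (t *\<^sub>R y) y) has_derivative ?f' x t) (at x)"
    if "x \<in> ?B" "t \<in> {0..1}" for x t
  proof -
    have d: "((\<lambda>y. \<theta> (t *\<^sub>R y) v) has_derivative (\<lambda>u. D (t *\<^sub>R x) (t *\<^sub>R u) v)) (at x)" for v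
      by (rule has_derivative_compose[where f = "\<lambda>y. t *\<^sub>R y" and f' = "\<lambda>y. t *\<^sub>R y" and g = "\<lambda>y. \<theta> y v"
            and g' = "\<lambda>u. D (t *\<^sub>R x) u v", OF _ dT[OF scale[OF that(2,1)]]])
        (auto intro!: derivative_eq_intros)
    define T where "T = (\<lambda>y. t *\<^sub>R y) -` ?B"
    have "open T" unfolding T_def by (intro open_vimage continuous_intros) auto
    have "x \<in> T" using scale that by (auto simp: T_def)
    have "((\<lambda>y. \<theta> (t *\<^sub>R y) y) has_derivative
       (\<lambda>h. \<theta> (t *\<^sub>R x) h + dirderiv (\<lambda>z. \<theta> (t *\<^sub>R z) x) x h)) (at x)"
    proof (rule has_derivative_linear_family(2)[where L = "\<lambda>y. \<theta> (t *\<^sub>R y)", OF \<open>open T\<close> \<open>x \<in> T\<close>])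
      show "\<And>x. x \<in> T \<Longrightarrow> linear (\<theta> (t *\<^sub>R x))" using lin by (auto simp: T_def)
    qed (use d in \<open>auto simp: differentiable_def intro: has_derivative_ident\<close>)
    moreover have "dirderiv (\<lambda>z. \<theta> (t *\<^sub>R z) x) x h = t *\<^sub>R D (t *\<^sub>R x) h x" for h
      using dirderiv_eqI[OF d] linear_cmul[OF Dlin1[OF scale[OF that(2,1)]]] by simp
    ultimately show ?thesis by simp
  qed
  have bl: "bounded_linear (?f' x t)" if "x \<in> ?B" "t \<in> {0..1}" for x t
    using deriv[OF that] by (rule has_derivative_bounded_linear)
  \<comment> \<open>Differentiation under the integral is applied with the derivative as an element
    of the Banach space of operators, jointly continuous in \<open>x\<close> and
    \<open>t\<close>.\<close>
  let ?F = "\<lambda>x t. Blinfun (?f' x t)"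
  have F: "blinfun_apply (?F x t) = ?f' x t" if "x \<in> ?B" "t \<in> {0..1}" for x t
    using bl[OF that] by (rule bounded_linear_Blinfun_apply)
  have contF: "continuous_on (?B \<times> cbox 0 1) (\<lambda>(x, t). ?F x t)"
    unfolding split_beta
  proof (rule continuous_on_blinfun_componentwise)
    fix i :: 'a
    have "continuous_on (?B \<times> cbox 0 (1::real)) (\<lambda>s. ?f' (fst s) (snd s) i)"
      by (intro continuous_intros contT2 contD2) (use sub1 in auto)
    then show "continuous_on (?B \<times> cbox 0 (1::real)) (\<lambda>s. blinfun_apply (?F (fst s) (snd s)) i)"
      by (rule continuous_on_eq) (auto simp: F)
  qed
  have cont1: "continuous_on {0..1} (\<lambda>t. \<theta> (t *\<^sub>R x) h)" if "x \<in> ?B" for x h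
    by (intro contT2 continuous_intros) (use scale that in auto)
  have cont2: "continuous_on {0..1} (\<lambda>t. t *\<^sub>R D (t *\<^sub>R x) u v)" if "x \<in> ?B" for x u v
    by (intro contD2 continuous_intros) (use scale that in auto)
  have "(?P has_derivative integral (cbox 0 1) (?F x)) (at x within ?B)"
    unfolding interval_cbox[of 0 "1::real"]
  proof (rule leibniz_rule)
    show "((\<lambda>y. \<theta> (t *\<^sub>R y) y) has_derivative blinfun_apply (?F x t)) (at x within ?B)"
      if "x \<in> ?B" "t \<in> cbox 0 1" for x t
      using deriv[of x t] F[of x t] that by (auto intro: has_derivative_at_withinI)
    show "(\<lambda>t. \<theta> (t *\<^sub>R x) x) integrable_on cbox 0 1" if "x \<in> ?B" for x
      using cont1[OF that, of x] by (auto intro: integrable_continuous_real)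
  qed (use contF x in auto)
  then have "(?P has_derivative integral (cbox 0 1) (?F x)) (at x)"
    using x by (simp add: at_within_open[OF _ open_ball])
  moreover have "blinfun_apply (integral (cbox 0 1) (?F x)) = ?P'"
  proof
    fix h
    have "continuous_on (cbox 0 1) (?F x)"
      using continuous_on_compose2[OF contF, where f = "\<lambda>t. (x, t)" and s = "cbox 0 1"]
        continuous_on_Pair[OF continuous_on_const continuous_on_id, of "cbox 0 1" x] x
      by (simp add: image_subset_iff del: box_real)
    then have "blinfun_apply (integral (cbox 0 1) (?F x)) h = integral (cbox 0 1) (\<lambda>t. ?F x t h)"
      by (intro blinfun_apply_integral integrable_continuous)
    also have "\<dots> = integral {0..1} (\<lambda>t. ?f' x t h)"
      using F[OF x] by (auto intro!: integral_cong)
    \<comment> \<open>Adding and subtracting \<open>t *\<^sub>R D (t *\<^sub>R x) x h\<close> splits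
      off the derivative of \<open>t *\<^sub>R \<theta> (t *\<^sub>R x) h\<close> with respect to
      \<open>t\<close>, which integrates to \<open>\<theta> x h\<close>. What remains is the
      exterior derivative contracted with \<open>x\<close>.\<close>
    also have "\<dots> = integral {0..1} (\<lambda>t. (\<theta> (t *\<^sub>R x) h + t *\<^sub>R D (t *\<^sub>R x) x h) +
        t *\<^sub>R (D (t *\<^sub>R x) h x - D (t *\<^sub>R x) x h))"
      by (intro integral_cong) (simp add: algebra_simps)
    also have "\<dots> = integral {0..1} (\<lambda>t. \<theta> (t *\<^sub>R x) h + t *\<^sub>R D (t *\<^sub>R x) x h) +
        integral {0..1} (\<lambda>t. t *\<^sub>R (D (t *\<^sub>R x) h x - D (t *\<^sub>R x) x h))"
      by (intro integral_add integrable_continuous_real)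
        (auto simp: scaleR_diff_right intro!: continuous_intros cont1 cont2 x)
    also have "integral {0..1} (\<lambda>t. \<theta> (t *\<^sub>R x) h + t *\<^sub>R D (t *\<^sub>R x) x h) = \<theta> x h"
    proof -
      have "((\<lambda>t. \<theta> (t *\<^sub>R x) h + t *\<^sub>R D (t *\<^sub>R x) x h) has_integral
          (1 *\<^sub>R \<theta> (1 *\<^sub>R x) h - 0 *\<^sub>R \<theta> (0 *\<^sub>R x) h)) {0..1}"
      proof (rule fundamental_theorem_of_calculus)
        fix t :: real assume t: "t \<in> {0..1}"
        have "((\<lambda>t. \<theta> (t *\<^sub>R x) h) has_derivative (\<lambda>s. D (t *\<^sub>R x) (s *\<^sub>R x) h)) (at t)"
          by (rule has_derivative_compose[where f = "\<lambda>t. t *\<^sub>R x" and f' = "\<lambda>s. s *\<^sub>R x"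
                and g = "\<lambda>y. \<theta> y h" and g' = "\<lambda>u. D (t *\<^sub>R x) u h", OF _ dT[OF scale[OF t x]]])
            (auto intro!: derivative_eq_intros)
        then have "((\<lambda>t. \<theta> (t *\<^sub>R x) h) has_vector_derivative D (t *\<^sub>R x) x h) (at t)"
          using linear_cmul[OF Dlin1[OF scale[OF t x]]] by (simp add: has_vector_derivative_def)
        from has_vector_derivative_scaleR[OF DERIV_ident this]
        show "((\<lambda>t. t *\<^sub>R \<theta> (t *\<^sub>R x) h) has_vector_derivative
            \<theta> (t *\<^sub>R x) h + t *\<^sub>R D (t *\<^sub>R x) x h) (at t within {0..1})"
          by (auto simp: add.commute intro: has_vector_derivative_at_within)
      qed simp
      then show ?thesis by (simp add: integral_unique)
    qed
    finally show "blinfun_apply (integral (cbox 0 1) (?F x)) h = ?P' h" .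
  qed
  ultimately show "(?P has_derivative ?P') (at x)" by simp
  have "continuous_on (?B \<times> cbox 0 (1::real))
      (\<lambda>s. snd s *\<^sub>R (D (snd s *\<^sub>R fst s) h (fst s) - D (snd s *\<^sub>R fst s) (fst s) h))"
    by (intro continuous_intros contD2) (use sub1 in auto)
  then show "continuous_on ?B (\<lambda>x. integral {0..1} (\<lambda>t. t *\<^sub>R (D (t *\<^sub>R x) h x - D (t *\<^sub>R x) x h)))"
    unfolding interval_cbox[of 0 "1::real"] by (intro integral_continuous_on_param) (simp add: split_beta)
qed


text \<open>The system is \<open>dirderiv Y x v = A x v (Y x)\<close>, and \<open>integrable\<close>
  equates the two mixed second derivatives that a solution with value \<open>y\<close> at
  \<open>x\<close> would have. The bound \<open>C * r \<le> 1 / 8\<close> makes a Picard step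
  contract by 1/8 and leaves room for the estimate of the defects. No initial value occurs, so one
  ball serves all of them.\<close>

locale integrable_system =
  fixes A :: "'a::euclidean_space \<Rightarrow> 'a \<Rightarrow> 'b::euclidean_space \<Rightarrow> 'b" and r C :: real
  assumes r: "r > 0"
    and lin1: "\<And>x y. x \<in> ball 0 r \<Longrightarrow> linear (\<lambda>v. A x v y)"
    and lin2: "\<And>x v. x \<in> ball 0 r \<Longrightarrow> linear (A x v)"
    and smooth: "\<And>v y. smooth_on (ball 0 r) (\<lambda>x. A x v y)"
    and integrable: "\<And>x u v y. x \<in> ball 0 r \<Longrightarrow>
      dirderiv (\<lambda>z. A z v y) x u + A x v (A x u y) = dirderiv (\<lambda>z. A z u y) x v + A x u (A x v y)"
    and bound: "\<And>x v y. x \<in> ball 0 r \<Longrightarrow> norm (A x v y) \<le> C * norm v * norm y"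
    and small: "C * r \<le> 1 / 8" "C \<ge> 0"
begin

definition picard :: "'b \<Rightarrow> ('a \<Rightarrow> 'b) \<Rightarrow> 'a \<Rightarrow> 'b"
  where "picard y0 Y x = y0 + integral {0..1} (\<lambda>t. A (t *\<^sub>R x) x (Y (t *\<^sub>R x)))"

text \<open>A Picard step integrates along rays only, so the limit solves the system a priori only in radial directions. By
  integrability the defect of an iterate is controlled by the preceding defect, hence it tends to \<open>0\<close>.\<close>

definition defect :: "('a \<Rightarrow> 'b) \<Rightarrow> 'a \<Rightarrow> 'a \<Rightarrow> 'b"
  where "defect Y x h = dirderiv Y x h - A x h (Y x)"

lemma scale_in_ball: "t \<in> {0..1} \<Longrightarrow> x \<in> ball 0 r \<Longrightarrow> t *\<^sub>R x \<in> ball (0::'a) r"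
proof -
  assume that: "t \<in> {0..1}" "x \<in> ball 0 r"
  have "\<bar>t\<bar> * norm x \<le> norm x" using that by (intro mult_left_le_one_le) auto
  then show ?thesis using that by simp
qed

lemma integrand_C1:
  assumes Y: "Ck_on 1 (ball 0 r) Y"
  shows "Ck_on 1 (ball 0 r) (\<lambda>x. A x v (Y x))"
  by (rule Ck_on_linear_family[OF open_ball])
    (use lin2 Y smooth in \<open>auto simp: smooth_on_def simp del: Ck_on.simps\<close>)

lemma integrand_continuous:
  assumes Y: "continuous_on (ball 0 r) Y"
    and "continuous_on S p" "p ` S \<subseteq> ball 0 r" "continuous_on S q"
  shows "continuous_on S (\<lambda>s. A (p s) (q s) (Y (p s)))"
proof (rule continuous_on_linear_family[where B = "ball 0 r" and L = "\<lambda>x v. A x v (Y x)"])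
  fix v
  show "continuous_on (ball 0 r) (\<lambda>x. A x v (Y x))"
    by (rule continuous_on_linear_family[where B = "ball 0 r" and p = "\<lambda>x. x" and L = "\<lambda>x. A x v"])
      (use lin2 Y smooth_on_imp_continuous_on[OF smooth] in auto)
qed (use assms lin1 in auto)

text \<open>By the homotopy formula the derivative of a Picard step is the right-hand side at the
  old iterate plus an integral of an exterior derivative. Integrability cancels every term of that
  integral except those linear in the defect of the old iterate.\<close>

lemma picard_derivative:
  assumes Y: "Ck_on 1 (ball 0 r) Y"
  defines "I \<equiv> \<lambda>x h. integral {0..1} (\<lambda>t. t *\<^sub>R (A (t *\<^sub>R x) x (defect Y (t *\<^sub>R x) h) - A (t *\<^sub>R x) h (defect Y (t *\<^sub>R x) x)))"
  shows "x \<in> ball 0 r \<Longrightarrow> (picard y0 Y has_derivative (\<lambda>h. A x h (Y x) + I x h)) (at x)"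
    and "Ck_on 1 (ball 0 r) (picard y0 Y)"
proof -
  let ?D = "\<lambda>x u v. dirderiv (\<lambda>y. A y v (Y y)) x u"
  let ?J = "\<lambda>x h. integral {0..1} (\<lambda>t. t *\<^sub>R (?D (t *\<^sub>R x) h x - ?D (t *\<^sub>R x) x h))"
  note rad = has_derivative_radial_integral[of r "\<lambda>x v. A x v (Y x)", OF lin1 integrand_C1[OF Y]]
  have D: "?D x u v = A x v (dirderiv Y x u) + dirderiv (\<lambda>z. A z v (Y x)) x u" if "x \<in> ball 0 r" for x u v
  proof -
    have "(\<lambda>z. A z v w) differentiable (at x)" for w
      using smooth_on_has_derivative[OF smooth that] by (auto simp: differentiable_def)
    moreover have "(Y has_derivative dirderiv Y x) (at x)"
      using Y that by (simp add: frechet_derivative_works)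
    ultimately show ?thesis
      using dirderiv_eqI[OF has_derivative_linear_family(2)[OF open_ball that, of "\<lambda>z. A z v"]] lin2 by simp
  qed
  have IJ: "I x h = ?J x h" if "x \<in> ball 0 r" for x h
    unfolding I_def
  proof (rule integral_cong)
    fix t :: real assume "t \<in> {0..1}"
    then have t: "t *\<^sub>R x \<in> ball 0 r" using that by (rule scale_in_ball)
    then have "A (t *\<^sub>R x) x (defect Y (t *\<^sub>R x) h) - A (t *\<^sub>R x) h (defect Y (t *\<^sub>R x) x) =
      ?D (t *\<^sub>R x) h x - ?D (t *\<^sub>R x) x h"
      using integrable[OF t, of x "Y (t *\<^sub>R x)" h]
      by (simp add: D defect_def linear_diff[OF lin2] algebra_simps)
    then show "t *\<^sub>R (A (t *\<^sub>R x) x (defect Y (t *\<^sub>R x) h) - A (t *\<^sub>R x) h (defect Y (t *\<^sub>R x) x)) =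
      t *\<^sub>R (?D (t *\<^sub>R x) h x - ?D (t *\<^sub>R x) x h)"
      by simp
  qed
  show "(picard y0 Y has_derivative (\<lambda>h. A x h (Y x) + I x h)) (at x)" if x: "x \<in> ball 0 r" for x
  proof -
    have "(picard y0 Y has_derivative (\<lambda>h. 0 + (A x h (Y x) + ?J x h))) (at x)"
      unfolding picard_def[abs_def] by (intro has_derivative_add has_derivative_const rad(1) x)
    moreover have "(\<lambda>h. 0 + (A x h (Y x) + ?J x h)) = (\<lambda>h. A x h (Y x) + I x h)"
      using IJ[OF x] by simp
    ultimately show ?thesis by (rule has_derivative_eq_rhs)
  qed
  then have der: "(picard y0 Y has_derivative (\<lambda>h. A x h (Y x) + I x h)) (at x)" if "x \<in> ball 0 r" for x
    using that .
  have "Ck_on (Suc 0) (ball 0 r) (picard y0 Y)"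
  proof (rule Ck_on_SucI[OF open_ball der])
    fix h
    have "continuous_on (ball 0 r) (\<lambda>x. A x h (Y x))"
      using Ck_on_Suc_imp[of 0] integrand_C1[OF Y, of h] by simp
    \<comment> \<open>The centre serves as the point of the ball that the homotopy lemma asks for;
      its continuity statement itself concerns the whole ball.\<close>
    moreover have "continuous_on (ball 0 r) (\<lambda>x. I x h)"
      by (rule continuous_on_eq[OF rad(3)[of 0 h]]) (use r in \<open>auto simp: IJ\<close>)
    ultimately show "Ck_on 0 (ball 0 r) (\<lambda>x. A x h (Y x) + I x h)"
      by (auto intro!: continuous_on_add)
  qed
  then show "Ck_on 1 (ball 0 r) (picard y0 Y)" by simp
qed

lemma bound_le:
  assumes "x \<in> ball 0 r" "norm v \<le> a" "norm y \<le> b"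
  shows "norm (A x v y) \<le> C * a * b"
proof -
  have "norm (A x v y) \<le> C * norm v * norm y" by (rule bound[OF assms(1)])
  also have "\<dots> \<le> C * a * b"
    using assms small(2) order_trans[OF norm_ge_zero assms(2)] by (intro mult_mono) auto
  finally show ?thesis .
qed

lemma picard_contraction:
  assumes Y: "Ck_on 1 (ball 0 r) Y" and Z: "Ck_on 1 (ball 0 r) Z"
    and d: "\<And>x. x \<in> ball 0 r \<Longrightarrow> norm (Y x - Z x) \<le> d" and x: "x \<in> ball 0 r"
  shows "norm (picard y0 Y x - picard y0 Z x) \<le> d / 8"
proof -
  have c: "continuous_on {0..1} (\<lambda>t. A (t *\<^sub>R x) x (Y (t *\<^sub>R x)))" if "Ck_on 1 (ball 0 r) Y" for Y
    by (rule integrand_continuous) (use that Ck_on_Suc_imp[of 0 _ Y] scale_in_ball x in \<open>auto intro!: continuous_intros\<close>)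
  have "picard y0 Y x - picard y0 Z x =
      integral {0..1} (\<lambda>t. A (t *\<^sub>R x) x (Y (t *\<^sub>R x)) - A (t *\<^sub>R x) x (Z (t *\<^sub>R x)))"
    unfolding picard_def
    by (subst integral_diff) (auto intro!: integrable_continuous_real c Y Z)
  also have "norm \<dots> \<le> C * r * d * (1 - 0)"
  proof (rule integral_bound)
    fix t :: real assume "t \<in> {0..1}"
    then have t: "t *\<^sub>R x \<in> ball 0 r" using x by (rule scale_in_ball)
    have "norm (A (t *\<^sub>R x) x (Y (t *\<^sub>R x) - Z (t *\<^sub>R x))) \<le> C * r * d"
      by (rule bound_le) (use t x d[OF t] in auto)
    then show "norm (A (t *\<^sub>R x) x (Y (t *\<^sub>R x)) - A (t *\<^sub>R x) x (Z (t *\<^sub>R x))) \<le> C * r * d"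
      by (simp add: linear_diff[OF lin2[OF t]])
  qed (auto intro!: continuous_intros c Y Z)
  also have "\<dots> \<le> 1 / 8 * d"
    using mult_right_mono[OF small(1) order_trans[OF norm_ge_zero d[OF x]]] by simp
  finally show ?thesis by simp
qed

text \<open>The new defect has two sources. Evaluating the right-hand side at the new instead of the
  old iterate costs \<open>C * d\<close>; the two terms under the integral cost
  \<open>C * r * e\<close> each, together at most \<open>e / 4\<close>.\<close>

lemma picard_defect:
  assumes Y: "Ck_on 1 (ball 0 r) Y" and e: "\<And>x h. x \<in> ball 0 r \<Longrightarrow> norm (defect Y x h) \<le> e * norm h"
    and d: "\<And>x. x \<in> ball 0 r \<Longrightarrow> norm (picard y0 Y x - Y x) \<le> d" and x: "x \<in> ball 0 r" and "e \<ge> 0"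
  shows "norm (defect (picard y0 Y) x h) \<le> (C * d + e / 4) * norm h"
proof -
  let ?i = "\<lambda>t. t *\<^sub>R (A (t *\<^sub>R x) x (defect Y (t *\<^sub>R x) h) - A (t *\<^sub>R x) h (defect Y (t *\<^sub>R x) x))"
  have contd: "continuous_on (ball 0 r) (\<lambda>x. defect Y x h)" for h
    unfolding defect_def using Y Ck_on_Suc_imp[of 0] integrand_C1[OF Y, of h]
    by (auto intro!: continuous_intros)
  have cont: "continuous_on {0..1} (\<lambda>t. A (t *\<^sub>R x) k (defect Y (t *\<^sub>R x) l))" for k l
    by (rule integrand_continuous) (use contd scale_in_ball x in \<open>auto intro!: continuous_intros\<close>)
  have "norm (integral {0..1} ?i) \<le> e / 4 * norm h * (1 - 0)"
  proof (rule integral_bound)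
    show "continuous_on {0..1} ?i" by (intro continuous_intros cont)
    fix t :: real assume t01: "t \<in> {0..1}"
    then have t: "t *\<^sub>R x \<in> ball 0 r" using x by (rule scale_in_ball)
    have *: "norm (A (t *\<^sub>R x) x (defect Y (t *\<^sub>R x) h)) \<le> C * r * (e * norm h)"
      by (rule bound_le) (use t x e[OF t] in auto)
    have "e * norm x \<le> e * r" using x \<open>e \<ge> 0\<close> by (intro mult_left_mono) auto
    then have **: "norm (A (t *\<^sub>R x) h (defect Y (t *\<^sub>R x) x)) \<le> C * norm h * (e * r)"
      by (intro bound_le) (use t x order_trans[OF e[OF t]] in auto)
    have "norm (?i t) \<le> 1 * norm (A (t *\<^sub>R x) x (defect Y (t *\<^sub>R x) h) - A (t *\<^sub>R x) h (defect Y (t *\<^sub>R x) x))"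
      unfolding norm_scaleR using t01 by (intro mult_right_mono) auto
    also have "\<dots> \<le> C * r * (e * norm h) + C * norm h * (e * r)"
      using norm_triangle_le_diff[OF add_mono[OF * **]] by simp
    also have "\<dots> = (C * r) * (2 * e * norm h)" by simp
    also have "\<dots> \<le> 1 / 8 * (2 * e * norm h)"
      by (intro mult_right_mono small) (use \<open>e \<ge> 0\<close> in simp)
    finally show "norm (?i t) \<le> e / 4 * norm h" by simp
  qed simp
  moreover have "norm (A x h (Y x - picard y0 Y x)) \<le> C * norm h * d"
    by (rule bound_le) (use d[OF x] x in \<open>auto simp: norm_minus_commute\<close>)
  moreover have "defect (picard y0 Y) x h = A x h (Y x - picard y0 Y x) + integral {0..1} ?i"
    unfolding defect_def dirderiv_eqI[OF picard_derivative(1)[OF Y x]]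
    by (simp add: linear_diff[OF lin2[OF x]] defect_def[symmetric])
  ultimately show ?thesis
    using norm_triangle_ineq[of "A x h (Y x - picard y0 Y x)" "integral {0..1} ?i"]
    by (simp add: algebra_simps)
qed

lemma solution:
  "\<exists>Y. Y 0 = y0 \<and> (\<forall>x\<in>ball 0 r. (Y has_derivative (\<lambda>u. A x u (Y x))) (at x))"
proof -
  define P where "P k = (picard y0 ^^ k) (\<lambda>x. y0)" for k
  have P_Suc: "P (Suc k) = picard y0 (P k)" for k by (simp add: P_def)
  have C1: "Ck_on 1 (ball 0 r) (P k)" for k
    by (induction k) (auto simp: P_Suc P_def intro: picard_derivative(2) simp del: Ck_on.simps One_nat_def)
  \<comment> \<open>Increments and defects are compared at the common rate 1/2. The defect bound
    then reproduces itself if \<open>C * norm y0 + N / 4 = N / 2\<close>, which determines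
    \<open>N\<close>; it also dominates the initial defect.\<close>
  define N where "N = 4 * C * norm y0"
  have N: "N \<ge> 0" using small by (simp add: N_def)
  have diff: "norm (P (Suc k) x - P k x) \<le> norm y0 / 2 ^ k" if "x \<in> ball 0 r" for k x
    using that
  proof (induction k arbitrary: x)
    case 0
    have "P (Suc 0) x - P 0 x = integral {0..1} (\<lambda>t. A (t *\<^sub>R x) x y0)"
      by (simp add: P_def picard_def)
    also have "norm \<dots> \<le> C * r * norm y0 * (1 - 0)"
    proof (rule integral_bound)
      show "continuous_on {0..1} (\<lambda>t. A (t *\<^sub>R x) x y0)"
        by (rule integrand_continuous) (use scale_in_ball 0 in \<open>auto intro!: continuous_intros\<close>)
      show "norm (A (t *\<^sub>R x) x y0) \<le> C * r * norm y0" if "t \<in> {0..1}" for t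
        by (rule bound_le) (use scale_in_ball[OF that 0] 0 in auto)
    qed simp
    also have "\<dots> \<le> 1 / 8 * norm y0"
      unfolding diff_0_right mult_1_right by (rule mult_right_mono[OF small(1) norm_ge_zero])
    also have "\<dots> \<le> norm y0 / 2 ^ 0" by simp
    finally show ?case .
  next
    case (Suc k)
    have "norm (P (Suc (Suc k)) x - P (Suc k) x) \<le> norm y0 / 2 ^ k / 8"
      unfolding P_Suc[of "Suc k"] P_Suc[of k]
      by (rule picard_contraction) (use C1[of k] C1[of "Suc k"] Suc P_Suc[of k] in auto)
    also have "\<dots> \<le> norm y0 / 2 ^ Suc k" by (simp add: field_simps)
    finally show ?case .
  qed
  have def: "norm (defect (P k) x h) \<le> N / 2 ^ k * norm h" if "x \<in> ball 0 r" for k x h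
    using that
  proof (induction k arbitrary: x h)
    case 0
    have "defect (P 0) x h = - A x h y0" by (simp add: defect_def P_def)
    moreover have "norm (A x h y0) \<le> C * norm h * norm y0" by (rule bound[OF 0])
    moreover have "0 \<le> C * norm h * norm y0" using small by simp
    ultimately show ?case by (simp add: N_def mult_ac)
  next
    case (Suc k)
    have "norm (defect (P (Suc k)) x h) \<le> (C * (norm y0 / 2 ^ k) + N / 2 ^ k / 4) * norm h"
      unfolding P_Suc
      by (rule picard_defect) (use C1 Suc N diff in \<open>auto simp: P_Suc\<close>)
    also have "\<dots> = N / 2 ^ Suc k * norm h" by (simp add: N_def field_simps)
    finally show ?case .
  qed
  have "\<exists>l. (\<lambda>k. P k x) \<longlonglongrightarrow> l \<and> (\<forall>k. norm (l - P k x) \<le> 2 * norm y0 / 2 ^ k)"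
    if x: "x \<in> ball 0 r" for x
  proof -
    let ?d = "\<lambda>k. P (Suc k) x - P k x"
    have geo: "(\<lambda>k. norm y0 / 2 ^ m * (1 / 2) ^ k) sums (2 * norm y0 / 2 ^ m)" for m
      using sums_mult[OF geometric_sums[of "1 / 2 :: real"], of "norm y0 / 2 ^ m"]
      by (simp add: mult.commute)
    have le: "norm (?d (k + m)) \<le> norm y0 / 2 ^ m * (1 / 2) ^ k" for k m
      using diff[OF x, of "k + m"] by (simp add: power_add field_simps)
    have sm: "summable (\<lambda>k. ?d (k + m))" for m
      by (rule summable_comparison_test'[OF sums_summable[OF geo] le])
    have tel: "(\<Sum>k<n. ?d (k + m)) = P (n + m) x - P m x" for n m
      by (induction n) auto
    define l where "l = suminf ?d + P 0 x"
    have lim: "(\<lambda>k. P k x) \<longlonglongrightarrow> l"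
    proof -
      have "(\<lambda>n. (\<Sum>k<n. ?d k) + P 0 x) \<longlonglongrightarrow> l"
        unfolding l_def using summable_LIMSEQ[OF sm[of 0]] by (intro tendsto_add tendsto_const) simp
      moreover have "(\<Sum>k<n. ?d k) + P 0 x = P n x" for n using tel[of 0 n] by simp
      ultimately show ?thesis by simp
    qed
    have "norm (l - P m x) \<le> 2 * norm y0 / 2 ^ m" for m
    proof -
      have "(\<lambda>n. \<Sum>k<n. ?d (k + m)) \<longlonglongrightarrow> l - P m x"
        unfolding tel by (intro tendsto_diff tendsto_const LIMSEQ_ignore_initial_segment lim)
      moreover have "(\<lambda>n. \<Sum>k<n. ?d (k + m)) \<longlonglongrightarrow> (\<Sum>k. ?d (k + m))"
        by (rule summable_LIMSEQ[OF sm])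
      ultimately have "l - P m x = (\<Sum>k. ?d (k + m))" by (rule LIMSEQ_unique)
      also have "norm \<dots> \<le> (\<Sum>k. norm y0 / 2 ^ m * (1 / 2) ^ k)"
        by (rule norm_suminf_le[OF le sums_summable[OF geo]])
      finally show ?thesis using sums_unique[OF geo] by simp
    qed
    with lim show ?thesis by blast
  qed
  then obtain Y where Y: "\<And>x. x \<in> ball 0 r \<Longrightarrow> (\<lambda>k. P k x) \<longlonglongrightarrow> Y x"
    "\<And>x k. x \<in> ball 0 r \<Longrightarrow> norm (Y x - P k x) \<le> 2 * norm y0 / 2 ^ k" by metis
  \<comment> \<open>The derivative of \<open>P k\<close> differs from \<open>A x h (Y x)\<close> by
    the defect and by \<open>A x h (Y x - P k x)\<close>. Both tend to 0 uniformly, so limit and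
    derivative may be interchanged.\<close>
  have "\<exists>g. \<forall>x\<in>ball 0 r. (\<lambda>k. P k x) \<longlonglongrightarrow> g x \<and>
      (g has_derivative (\<lambda>u. A x u (Y x))) (at x within ball 0 r)"
  proof (rule has_derivative_sequence)
    show "(P k has_derivative dirderiv (P k) x) (at x within ball 0 r)" if "x \<in> ball 0 r" for k x
      using C1[of k] that by (auto simp: frechet_derivative_works intro: has_derivative_at_withinI)
    fix e :: real assume "e > 0"
    define K where "K = N + C * (2 * norm y0)"
    have "(\<lambda>k. K * (1 / 2) ^ k) \<longlonglongrightarrow> K * 0"
      by (intro tendsto_mult_left LIMSEQ_power_zero) simp
    then have "\<forall>\<^sub>F k in sequentially. K * (1 / 2) ^ k < e"
      using \<open>e > 0\<close> by (intro order_tendstoD(2)) auto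
    then show "\<forall>\<^sub>F k in sequentially. \<forall>x\<in>ball 0 r. \<forall>h. norm (dirderiv (P k) x h - A x h (Y x)) \<le> e * norm h"
    proof (rule eventually_mono, intro ballI allI)
      fix k and x h :: 'a assume k: "K * (1 / 2) ^ k < e" and x: "x \<in> ball 0 r"
      have "dirderiv (P k) x h - A x h (Y x) = defect (P k) x h - A x h (Y x - P k x)"
        by (simp add: defect_def linear_diff[OF lin2[OF x]])
      also have "norm \<dots> \<le> N / 2 ^ k * norm h + C * norm h * (2 * norm y0 / 2 ^ k)"
        by (rule norm_triangle_le_diff, rule add_mono[OF def[OF x]], rule bound_le) (use x Y in auto)
      also have "\<dots> = (K * (1 / 2) ^ k) * norm h" by (simp add: K_def field_simps)
      also have "\<dots> \<le> e * norm h" using k by (intro mult_right_mono) auto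
      finally show "norm (dirderiv (P k) x h - A x h (Y x)) \<le> e * norm h" .
    qed
  next
    show "(\<lambda>k. P k 0) \<longlonglongrightarrow> Y 0" using Y r by simp
  qed (use r in auto)
  then obtain g where g: "\<And>x. x \<in> ball 0 r \<Longrightarrow> (\<lambda>k. P k x) \<longlonglongrightarrow> g x"
    "\<And>x. x \<in> ball 0 r \<Longrightarrow> (g has_derivative (\<lambda>u. A x u (Y x))) (at x within ball 0 r)"
    by blast
  have gY: "g x = Y x" if "x \<in> ball 0 r" for x
    using g(1)[OF that] Y(1)[OF that] by (rule LIMSEQ_unique)
  \<comment> \<open>At the centre the ray is constant and \<open>A 0 0\<close> vanishes by linearity
    in the direction, so each Picard step keeps the initial value.\<close>
  have "P k 0 = y0" for k
  proof (cases k)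
    case (Suc j)
    have "A 0 0 (P j 0) = 0" using linear_0[OF lin1[of 0]] r by simp
    then show ?thesis by (simp add: Suc P_Suc picard_def)
  qed (simp add: P_def)
  then have "g 0 = y0" using g(1)[of 0] r by (simp add: LIMSEQ_const_iff)
  moreover have "(g has_derivative (\<lambda>u. A x u (g x))) (at x)" if "x \<in> ball 0 r" for x
    using g(2)[OF that] gY[OF that] that by (simp add: at_within_open[OF _ open_ball])
  ultimately show ?thesis by blast
qed

end

text \<open>The initial value is quantified after the radius: the latter comes from a bound on the
  coefficients over a compact ball. The rest is a translation of \<open>x0\<close> to the
  origin.\<close>

lemma frobenius_linear_system:
  fixes A :: "'a::euclidean_space \<Rightarrow> 'a \<Rightarrow> 'b::euclidean_space \<Rightarrow> 'b"
  assumes "open U" "x0 \<in> U"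
    and lin1: "\<And>x y. x \<in> U \<Longrightarrow> linear (\<lambda>v. A x v y)"
    and lin2: "\<And>x v. x \<in> U \<Longrightarrow> linear (A x v)"
    and smooth: "\<And>v y. smooth_on U (\<lambda>x. A x v y)"
    and integrable: "\<And>x u v y. x \<in> U \<Longrightarrow>
      dirderiv (\<lambda>z. A z v y) x u + A x v (A x u y) = dirderiv (\<lambda>z. A z u y) x v + A x u (A x v y)"
  obtains r where "r > 0" "ball x0 r \<subseteq> U"
    "\<And>y0. \<exists>Y. Y x0 = y0 \<and> (\<forall>x\<in>ball x0 r. (Y has_derivative (\<lambda>u. A x u (Y x))) (at x))"
proof -
  obtain R where R: "R > 0" "cball x0 R \<subseteq> U" using assms(1,2) by (meson open_contains_cball)
  have "\<exists>M. \<forall>x\<in>cball x0 R. norm (A x b c) \<le> M" for b c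
  proof -
    have "compact ((\<lambda>x. A x b c) ` cball x0 R)"
      by (intro compact_continuous_image continuous_on_subset[OF smooth_on_imp_continuous_on[OF smooth] R(2)]) simp
    then show ?thesis by (auto simp: bounded_iff dest: compact_imp_bounded)
  qed
  then obtain M where M: "\<And>x b c. x \<in> cball x0 R \<Longrightarrow> norm (A x b c) \<le> M b c" by metis
  \<comment> \<open>Expanding both linear arguments in bases, whose coefficients are at most the
    norms, bounds \<open>A\<close> by the sum over all pairs of basis vectors.\<close>
  define C where "C = (\<Sum>b\<in>Basis. \<Sum>c\<in>Basis. M b c)"
  have "M b c \<ge> 0" for b c using order_trans[OF norm_ge_zero M[of x0 b c]] R(1) by simp
  then have C: "C \<ge> 0" by (simp add: C_def sum_nonneg)
  have bound: "norm (A x v y) \<le> C * norm v * norm y" if x: "x \<in> cball x0 R" for x v y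
  proof -
    have xU: "x \<in> U" using R x by blast
    have "A x v y = (\<Sum>b\<in>Basis. (v \<bullet> b) *\<^sub>R (\<Sum>c\<in>Basis. (y \<bullet> c) *\<^sub>R A x b c))"
      by (subst linear_family_expansion[OF lin1[OF xU]], rule sum.cong[OF refl],
          subst linear_family_expansion[OF lin2[OF xU]]) simp
    also have "norm \<dots> \<le> (\<Sum>b\<in>Basis. norm v * (\<Sum>c\<in>Basis. norm y * M b c))"
    proof (rule sum_norm_le)
      fix b :: 'a assume b: "b \<in> Basis"
      have "norm (\<Sum>c\<in>Basis. (y \<bullet> c) *\<^sub>R A x b c) \<le> (\<Sum>c\<in>Basis. norm y * M b c)"
      proof (rule sum_norm_le)
        fix c :: 'b assume "c \<in> Basis"
        then show "norm ((y \<bullet> c) *\<^sub>R A x b c) \<le> norm y * M b c"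
          using M[OF x] by (simp add: mult_mono Basis_le_norm)
      qed
      then show "norm ((v \<bullet> b) *\<^sub>R (\<Sum>c\<in>Basis. (y \<bullet> c) *\<^sub>R A x b c)) \<le> norm v * (\<Sum>c\<in>Basis. norm y * M b c)"
        using b by (simp add: mult_mono Basis_le_norm)
    qed
    also have "\<dots> = C * norm v * norm y"
      by (simp add: C_def sum_distrib_left sum_distrib_right mult_ac)
    finally show ?thesis .
  qed
  \<comment> \<open>The radius achieves \<open>C * r \<le> 1 / 8\<close>; the summand 1 covers
    \<open>C = 0\<close>.\<close>
  define r where "r = min R (1 / (8 * (C + 1)))"
  have rR: "r > 0" "r \<le> R" using R C by (auto simp: r_def)
  have "C * r \<le> C * (1 / (8 * (C + 1)))" using C by (intro mult_left_mono) (auto simp: r_def)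
  also have "\<dots> \<le> 1 / 8" using C by (simp add: field_simps)
  finally have Cr: "C * r \<le> 1 / 8" .
  have mem: "x0 + x \<in> cball x0 R" "x0 + x \<in> U" if "x \<in> ball 0 r" for x
    using that rR R by (auto simp: dist_norm subset_iff)
  have shift: "dirderiv (\<lambda>z. A (x0 + z) v y) x u = dirderiv (\<lambda>z. A z v y) (x0 + x) u" if "x \<in> ball 0 r" for x u v y
  proof -
    have "((\<lambda>z. A (x0 + z) v y) has_derivative dirderiv (\<lambda>z. A z v y) (x0 + x)) (at x)"
      by (rule has_derivative_compose[where f = "\<lambda>z. x0 + z" and f' = "\<lambda>z. z" and g = "\<lambda>z. A z v y",
            OF _ smooth_on_has_derivative[OF smooth mem(2)[OF that]]])
        (auto intro!: derivative_eq_intros)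
    then show ?thesis by (simp add: dirderiv_eqI)
  qed
  interpret integrable_system "\<lambda>x. A (x0 + x)" r C
  proof (rule integrable_system.intro)
    fix x u v y assume x: "x \<in> ball (0::'a) r"
    show "norm (A (x0 + x) v y) \<le> C * norm v * norm y" using bound[OF mem(1)[OF x]] .
    show "linear (A (x0 + x) v)" by (rule lin2[OF mem(2)[OF x]])
    show "linear (\<lambda>v. A (x0 + x) v y)" by (rule lin1[OF mem(2)[OF x]])
    show "dirderiv (\<lambda>z. A (x0 + z) v y) x u + A (x0 + x) v (A (x0 + x) u y) =
      dirderiv (\<lambda>z. A (x0 + z) u y) x v + A (x0 + x) u (A (x0 + x) v y)"
      using integrable[OF mem(2)[OF x]] by (simp add: shift[OF x])
  next
    fix v y
    show "smooth_on (ball 0 r) (\<lambda>x. A (x0 + x) v y)"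
    proof (rule smooth_on_compose[where f = "\<lambda>z. A z v y" and T = U])
      show "(\<lambda>x. x0 + x) ` ball 0 r \<subseteq> U" using mem(2) by blast
      show "smooth_on (ball 0 r) (\<lambda>x. x0 + x)" by (intro smooth_on_intros open_ball)
    qed (auto intro: smooth)
  qed (use rR Cr C in auto)
  have mem': "x - x0 \<in> ball 0 r" if "x \<in> ball x0 r" for x
    using that by (simp add: dist_norm norm_minus_commute)
  show ?thesis
  proof
    show "r > 0" by fact
    show "ball x0 r \<subseteq> U" using rR(2) R(2) by (meson ball_subset_cball order_trans subset_cball)
    fix y0
    obtain Y where Y: "Y 0 = y0" "\<And>x. x \<in> ball 0 r \<Longrightarrow> (Y has_derivative (\<lambda>u. A (x0 + x) u (Y x))) (at x)"
      using solution by blast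
    have "((\<lambda>x. Y (x - x0)) has_derivative (\<lambda>u. A x u (Y (x - x0)))) (at x)" if "x \<in> ball x0 r" for x
    proof -
      have "((\<lambda>z. z - x0) has_derivative (\<lambda>z. z)) (at x)" by (auto intro!: derivative_eq_intros)
      from has_derivative_compose[OF this Y(2)[OF mem'[OF that]]] show ?thesis by simp
    qed
    with Y(1) show "\<exists>Y. Y x0 = y0 \<and> (\<forall>x\<in>ball x0 r. (Y has_derivative (\<lambda>u. A x u (Y x))) (at x))"
      by (intro exI[of _ "\<lambda>x. Y (x - x0)"]) simp
  qed
qed

lemma smooth_on_has_derivativeI:
  assumes "open S" "\<And>x. x \<in> S \<Longrightarrow> (f has_derivative f' x) (at x)" "\<And>v. smooth_on S (\<lambda>x. f' x v)"
  shows "smooth_on S f"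
  unfolding smooth_on_def
proof
  fix k
  have "Ck_on (Suc k) S f"
    using assms by (intro Ck_on_SucI[where f' = f']) (auto simp: smooth_on_def)
  then show "Ck_on k S f" by (rule Ck_on_Suc_imp)
qed

lemma smooth_on_differentiable: "smooth_on S f \<Longrightarrow> x \<in> S \<Longrightarrow> f differentiable (at x)"
  using smooth_on_has_derivative differentiable_def by blast

lemma has_derivative_eq_dirderiv:
  assumes "open S" "x \<in> S" "\<And>y. y \<in> S \<Longrightarrow> f y = h y" "(h has_derivative h') (at x)"
  shows "dirderiv f x = h'"
  by (rule dirderiv_eqI, rule has_derivative_transform_within_open[OF assms(4,1,2)]) (simp add: assms(3))

section \<open>Riemannian metrics in coordinates\<close>

locale inner_form =
  fixes b :: "'a::euclidean_space \<Rightarrow> 'a \<Rightarrow> real"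
  assumes lin_left: "linear (\<lambda>u. b u v)" and sym: "b u v = b v u" and pos: "u \<noteq> 0 \<Longrightarrow> b u u > 0"
begin

lemma lin_right: "linear (b u)"
proof -
  have "b u = (\<lambda>v. b v u)" using sym by blast
  then show ?thesis using lin_left by simp
qed

lemmas left_simps = linear_add[OF lin_left] linear_diff[OF lin_left] linear_cmul[OF lin_left]
  linear_0[OF lin_left] linear_neg[OF lin_left] linear_sum[OF lin_left]
lemmas right_simps = linear_add[OF lin_right] linear_diff[OF lin_right] linear_cmul[OF lin_right]
  linear_0[OF lin_right] linear_neg[OF lin_right] linear_sum[OF lin_right]

lemma eq_0_iff: "b u u = 0 \<longleftrightarrow> u = 0"
  using pos[of u] left_simps(4) by force

lemma nondegenerate: "(\<And>w. b u w = b v w) \<Longrightarrow> u = v"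
  using eq_0_iff[of "u - v"] by (simp add: left_simps)

lemma cauchy_schwarz_eq:
  assumes "b u u * b v v = (b u v)\<^sup>2" "v \<noteq> 0"
  shows "u = (b u v / b v v) *\<^sub>R v"
proof -
  let ?w = "u - (b u v / b v v) *\<^sub>R v"
  have "b ?w ?w = (b u u * b v v - (b u v)\<^sup>2) / b v v"
    using pos[OF assms(2)] by (simp add: left_simps right_simps sym[of v u] field_simps power2_eq_square)
  then have "?w = 0" using assms(1) eq_0_iff by simp
  then show ?thesis by simp
qed

text \<open>Equality in the Cauchy-Schwarz inequality forces dependence. This is the denominator of
  the sectional curvature.\<close>

lemma gram_det_nonzero:
  assumes "u \<noteq> v" "independent {u, v}"
  shows "b u u * b v v - (b u v)\<^sup>2 \<noteq> 0"
proof
  have "v \<noteq> 0" using assms dependent_zero[of "{u, v}"] by auto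
  moreover assume "b u u * b v v - (b u v)\<^sup>2 = 0"
  ultimately have "u = (b u v / b v v) *\<^sub>R v" using cauchy_schwarz_eq by simp
  then have "u \<in> span {v}" by (metis span_base span_scale singletonI)
  then show False using assms by (auto simp: independent_insert)
qed

definition orthonormal :: "'a set \<Rightarrow> bool"
  where "orthonormal C \<longleftrightarrow> (\<forall>u\<in>C. \<forall>v\<in>C. b u v = (if u = v then 1 else 0))"

lemma orthonormal_coefficient:
  assumes "finite C" "orthonormal C" "w \<in> C"
  shows "b (\<Sum>v\<in>C. r v *\<^sub>R v) w = r w"
proof -
  have "b (\<Sum>v\<in>C. r v *\<^sub>R v) w = (\<Sum>v\<in>C. r v * b v w)" by (simp add: left_simps)
  also have "\<dots> = (\<Sum>v\<in>C. if v = w then r v else 0)"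
    using assms by (intro sum.cong) (auto simp: orthonormal_def)
  finally show ?thesis using assms by simp
qed

lemma orthonormal_independent:
  assumes "finite C" "orthonormal C"
  shows "independent C"
  using assms orthonormal_coefficient[OF assms] linear_0[OF lin_left]
  by (auto simp: independent_explicit) metis

text \<open>The process starts from a given orthonormal set and only adds to it, so that a
  prescribed unit vector, later the Killing field, survives in the final basis.\<close>

lemma gram_schmidt:
  assumes "finite D" "finite C" "orthonormal C"
  shows "\<exists>C'. finite C' \<and> orthonormal C' \<and> C \<subseteq> C' \<and> D \<subseteq> span C'"
  using assms(1)
proof (induction D)
  case empty
  then show ?case using assms by auto
next
  case (insert d D)
  then obtain C' where C': "finite C'" "orthonormal C'" "C \<subseteq> C'" "D \<subseteq> span C'" by blast
  show ?case
  proof (cases "d \<in> span C'")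
    case True
    then show ?thesis using C' by blast
  next
    case False
    define p where "p = (\<Sum>c\<in>C'. b d c *\<^sub>R c)"
    have p: "p \<in> span C'" unfolding p_def by (intro span_sum span_scale span_base)
    have perp: "b (d - p) c = 0" if "c \<in> C'" for c
      using orthonormal_coefficient[OF C'(1,2) that, of "b d"] by (simp add: left_simps p_def)
    have "d - p \<noteq> 0" using False p by auto
    then have npos: "b (d - p) (d - p) > 0" by (rule pos)
    define e where "e = (1 / sqrt (b (d - p) (d - p))) *\<^sub>R (d - p)"
    have ee: "b e e = 1"
      unfolding e_def linear_cmul[OF lin_left] linear_cmul[OF lin_right]
      using npos by (simp add: field_simps)
    have ec: "b e c = 0" "b c e = 0" if "c \<in> C'" for c
      using perp[OF that] sym[of c e] unfolding e_def by (auto simp: linear_cmul[OF lin_left])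
    have d: "d = sqrt (b (d - p) (d - p)) *\<^sub>R e + p" using npos by (simp add: e_def)
    have p': "p \<in> span (insert e C')" using p span_mono[of C' "insert e C'"] by blast
    have "orthonormal (insert e C')"
      using C'(2) ee ec unfolding orthonormal_def by fastforce
    moreover have "d \<in> span (insert e C')"
      by (subst d, rule span_add[OF span_scale[OF span_base] p']) simp
    moreover have "D \<subseteq> span (insert e C')"
      using C'(4) span_mono[of C' "insert e C'"] by blast
    ultimately show ?thesis using C' by (intro exI[of _ "insert e C'"]) auto
  qed
qed

lemma orthonormal_basis_extension:
  assumes "finite C" "orthonormal C"
  obtains C' where "finite C'" "orthonormal C'" "C \<subseteq> C'" "card C' = DIM('a)" "span C' = UNIV"
proof -
  obtain C' where C': "finite C'" "orthonormal C'" "C \<subseteq> C'" "Basis \<subseteq> span C'"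
    using gram_schmidt[OF finite_Basis assms] by blast
  have "span C' = UNIV" using span_mono[OF C'(4)] by (simp add: span_span top.extremum_unique)
  moreover from this have "card C' = DIM('a)"
    using dim_eq_card_independent[OF orthonormal_independent[OF C'(1,2)]] dim_span[of C'] by simp
  ultimately show ?thesis using C' that by blast
qed

text \<open>Orthonormality gives independence and the cardinality gives spanning. The family is
  indexed because its vectors will be labelled by the indices of a matrix or by the basis vectors of
  a target space.\<close>

lemma orthonormal_expansion:
  assumes I: "finite I" "card I = DIM('a)" and e: "\<And>i j. i \<in> I \<Longrightarrow> j \<in> I \<Longrightarrow> b (e i) (e j) = (if i = j then 1 else 0)"
  shows "(\<Sum>i\<in>I. b u (e i) *\<^sub>R e i) = u"
proof -
  have inj: "inj_on e I" using e by (intro inj_onI) (metis zero_neq_one)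
  have on: "orthonormal (e ` I)" unfolding orthonormal_def using e inj by (auto simp: inj_on_eq_iff)
  have "UNIV \<subseteq> span (e ` I)"
    by (rule card_ge_dim_independent[OF subset_UNIV orthonormal_independent[OF _ on]])
      (use I card_image[OF inj] in auto)
  then have "u \<in> span (e ` I)" by blast
  then obtain r where "u = (\<Sum>v\<in>e ` I. r v *\<^sub>R v)" using I(1) by (auto simp: span_finite)
  then have u: "u = (\<Sum>i\<in>I. r (e i) *\<^sub>R e i)" using inj by (simp add: sum.reindex)
  have "b u (e i) = r (e i)" if "i \<in> I" for i
  proof -
    have "b u (e i) = (\<Sum>j\<in>I. r (e j) * b (e j) (e i))" by (subst u) (simp add: left_simps)
    also have "\<dots> = (\<Sum>j\<in>I. if j = i then r (e j) else 0)" using e that by (intro sum.cong) auto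
    finally show ?thesis using that I by simp
  qed
  then show ?thesis using u by simp
qed

end

text \<open>Polarisation in \<open>u\<close>, with the pair symmetry, gives
  \<open>T u v v z = 0\<close>; polarisation in \<open>v\<close> then makes \<open>T\<close> skew in
  its two middle arguments. Being alternating in its first three arguments, it has three equal terms
  in the Bianchi identity.\<close>

lemma curvature_like_eq_0:
  fixes T :: "'a::real_vector \<Rightarrow> 'a \<Rightarrow> 'a \<Rightarrow> 'a \<Rightarrow> real"
  assumes add1: "\<And>u u' v w z. T (u + u') v w z = T u v w z + T u' v w z"
    and add2: "\<And>u v v' w z. T u (v + v') w z = T u v w z + T u v' w z"
    and add3: "\<And>u v w w' z. T u v (w + w') z = T u v w z + T u v w' z"
    and add4: "\<And>u v w z z'. T u v w (z + z') = T u v w z + T u v w z'"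
    and skew1: "\<And>u v w z. T u v w z = - T v u w z"
    and skew2: "\<And>u v w z. T u v w z = - T u v z w"
    and bianchi: "\<And>u v w z. T u v w z + T v w u z + T w u v z = 0"
    and sect: "\<And>u v. T u v v u = 0"
  shows "T u v w z = 0"
proof -
  \<comment> \<open>The pair symmetry is a combination of the Bianchi identities of the four cyclic
    shifts, in which the skew symmetries cancel the other terms.\<close>
  have pair: "T u v w z = T w z u v" for u v w z
    using bianchi[of u v w z] bianchi[of v w z u] bianchi[of w z u v] bianchi[of z u v w]
      skew1[of u v w z] skew1[of v w u z] skew1[of w u v z] skew1[of v w z u] skew1[of w z v u] skew1[of z v w u]
      skew1[of w z u v] skew1[of z u w v] skew1[of u w z v] skew1[of z u v w] skew1[of u v z w] skew1[of v z u w]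
      skew2[of u v w z] skew2[of v w u z] skew2[of w u v z] skew2[of w z u v] skew2[of z u w v]
      skew2[of v z u w] skew2[of z v w u] skew2[of u w z v] skew2[of u v z w]
    by linarith
  have a: "T u v v z = 0" for u v z
    using sect[of "u + z" v] sect[of u v] sect[of z v] pair[of z v v u]
      skew1[of v u z v] skew2[of u v z v]
    by (simp add: add1 add4)
  have b: "T u v w z = - T u w v z" for u v w z
    using a[of u "v + w" z] a[of u v z] a[of u w z] by (simp add: add2 add3)
  show ?thesis
    using bianchi[of u v w z] b[of u v w z] skew1[of u w v z] b[of v w u z] skew1[of v u w z] by linarith
qed

section \<open>Levi-Civita connection and curvature in coordinates\<close>

locale local_metric =
  fixes S :: "(real^'n) set" and g :: "real^'n \<Rightarrow> real^'n \<Rightarrow> real^'n \<Rightarrow> real"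
  assumes open_S: "open S"
    and inner: "x \<in> S \<Longrightarrow> inner_form (g x)"
    and smooth: "smooth_on S (\<lambda>x. g x u v)"
begin

lemmas gl = inner_form.lin_left[OF inner]
lemmas gr = inner_form.lin_right[OF inner]
lemmas g_sym = inner_form.sym[OF inner]
lemmas g_nondegenerate = inner_form.nondegenerate[OF inner]
lemmas g_left = inner_form.left_simps[OF inner]
lemmas g_right = inner_form.right_simps[OF inner]

definition gram :: "real^'n \<Rightarrow> real^'n^'n"
  where "gram x = (\<chi> i j. g x (axis j 1) (axis i 1))"

lemma gram_mult:
  assumes "x \<in> S"
  shows "gram x *v z = (\<chi> i. g x z (axis i 1))"
proof -
  have "g x z w = (\<Sum>j\<in>UNIV. g x (axis j 1) w * z $ j)" for w
    using linear_family_expansion[OF gl[OF assms], of z w]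
    by (simp add: Basis_vec_def sum.UNION_disjoint axis_eq_axis inner_axis
        UNION_singleton_eq_range sum.reindex inj_on_def mult.commute)
  then show ?thesis by (simp add: gram_def matrix_vector_mult_def)
qed

lemma det_gram:
  assumes "x \<in> S"
  shows "det (gram x) \<noteq> 0"
proof -
  have "z = 0" if "gram x *v z = 0" for z
  proof (rule g_nondegenerate[OF assms])
    fix w
    have "g x z (axis i 1) = 0" for i
      using that unfolding gram_mult[OF assms] by (simp add: vec_eq_iff)
    then have "g x z w = 0"
      using linear_family_expansion[OF gr[OF assms], of z w] by (simp add: Basis_vec_def UNION_singleton_eq_range sum.reindex inj_on_def axis_eq_axis)
    then show "g x z w = g x 0 w" by (simp add: g_left[OF assms])
  qed
  then show ?thesis
    using matrix_left_invertible_ker[of "gram x"] invertible_left_inverse[of "gram x"] invertible_det_nz by blast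
qed

text \<open>Cramer's rule presents the vector dual to a covector as a quotient of determinants. This
  settles existence and uniqueness, and the same formula shows how the vector depends on the
  point.\<close>

lemma musical_iff:
  assumes "x \<in> S" "linear k"
  shows "(\<forall>w. g x z w = k w) \<longleftrightarrow>
    z = (\<chi> l. det (\<chi> i j. if j = l then k (axis i 1) else gram x $ i $ j) / det (gram x))"
proof -
  have "(\<forall>w. g x z w = k w) \<longleftrightarrow> (\<forall>i. g x z (axis i 1) = k (axis i 1))"
  proof safe
    fix w assume *: "\<forall>i. g x z (axis i 1) = k (axis i 1)"
    show "g x z w = k w"
      using linear_family_expansion[OF gr[OF assms(1)], of z w] linear_family_expansion[OF assms(2), of w] *
      by (simp add: Basis_vec_def UNION_singleton_eq_range sum.reindex inj_on_def axis_eq_axis)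
  qed blast
  also have "\<dots> \<longleftrightarrow> gram x *v z = (\<chi> i. k (axis i 1))"
    unfolding gram_mult[OF assms(1)] by (simp add: vec_eq_iff)
  finally show ?thesis
    using cramer[OF det_gram[OF assms(1)], of z "\<chi> i. k (axis i 1)"] by (simp cong: if_cong)
qed

text \<open>The numerators of Cramer's quotient are polynomials in smooth functions and its
  denominator has no zero. With Koszul's right-hand side for \<open>k\<close> this makes the
  Christoffel symbols smooth.\<close>

lemma musical_smooth:
  assumes z: "\<And>x w. x \<in> S \<Longrightarrow> g x (z x) w = k x w" and k: "\<And>w. smooth_on S (\<lambda>x. k x w)"
  shows "smooth_on S z"
proof -
  have vec: "smooth_on S (\<lambda>x. \<chi> l. f l x)" if "\<And>l. smooth_on S (f l)" for f :: "'n \<Rightarrow> real^'n \<Rightarrow> real"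
  proof -
    have "smooth_on S (\<lambda>x. \<Sum>l\<in>UNIV. f l x *\<^sub>R axis l (1::real))"
      by (intro smooth_on_intros open_S that)
    moreover have "(\<Sum>l\<in>UNIV. f l x *\<^sub>R axis l (1::real)) = (\<chi> l. f l x)" for x
      by (simp add: vec_eq_iff axis_def if_distrib cong: if_cong)
    ultimately show ?thesis by simp
  qed
  have det: "smooth_on S (\<lambda>x. det (\<chi> i j. f i j x))" if "\<And>i j. smooth_on S (f i j)"
    for f :: "'n \<Rightarrow> 'n \<Rightarrow> real^'n \<Rightarrow> real"
    unfolding det_def by (simp, intro smooth_on_intros open_S that)
  have "smooth_on S (\<lambda>x. \<chi> l. det (\<chi> i j. if j = l then k x (axis i 1) else gram x $ i $ j) / det (gram x))"
  proof (intro vec smooth_on_divide det open_S)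
    show "smooth_on S (\<lambda>x. det (gram x))" unfolding gram_def by (intro det smooth)
    show "smooth_on S (\<lambda>x. if j = l then k x (axis i 1) else gram x $ i $ j)" for i j l
      by (cases "j = l") (simp_all add: k smooth gram_def)
  qed (rule det_gram)
  then show ?thesis
  proof (rule smooth_on_cong[OF open_S, rotated])
    fix x assume x: "x \<in> S"
    have "k x = g x (z x)" using z[OF x] by auto
    then have "linear (k x)" using gr[OF x] by simp
    from musical_iff[OF x this, of "z x"] z[OF x]
    show "(\<chi> l. det (\<chi> i j. if j = l then k x (axis i 1) else gram x $ i $ j) / det (gram x)) = z x"
      by simp
  qed
qed

abbreviation dg :: "real^'n \<Rightarrow> real^'n \<Rightarrow> real^'n \<Rightarrow> real^'n \<Rightarrow> real"
  where "dg x a u v \<equiv> dirderiv (\<lambda>y. g y u v) x a"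

abbreviation \<Gamma> :: "real^'n \<Rightarrow> real^'n \<Rightarrow> real^'n \<Rightarrow> real^'n"
  where "\<Gamma> \<equiv> levi_civita g"

lemma has_derivative_g: "x \<in> S \<Longrightarrow> ((\<lambda>y. g y u v) has_derivative (\<lambda>a. dg x a u v)) (at x)"
  by (rule smooth_on_has_derivative[OF smooth])

lemma dg_lin1: "x \<in> S \<Longrightarrow> linear (\<lambda>a. dg x a u v)"
  using has_derivative_linear[OF has_derivative_g] .

lemma dg_sym: "x \<in> S \<Longrightarrow> dg x a u v = dg x a v u"
  using has_derivative_eq_dirderiv[OF open_S, of x "\<lambda>y. g y u v" "\<lambda>y. g y v u"] g_sym has_derivative_g
  by metis

lemma dg_lin2: "x \<in> S \<Longrightarrow> linear (\<lambda>u. dg x a u v)"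
  by (rule has_derivative_linear_family(1)[OF open_S, where q = "\<lambda>x. 0" and q' = "\<lambda>x. 0"])
    (use gl smooth_on_differentiable[OF smooth] in auto)

lemma dg_lin3: "x \<in> S \<Longrightarrow> linear (\<lambda>v. dg x a u v)"
proof -
  assume x: "x \<in> S"
  have "(\<lambda>v. dg x a u v) = (\<lambda>v. dg x a v u)" using dg_sym[OF x] by blast
  with dg_lin2[OF x] show ?thesis by simp
qed

text \<open>The right-hand side is linear in \<open>w\<close>, so the definite description in
  \<open>levi_civita\<close> denotes its unique dual vector.\<close>

lemma koszul:
  assumes "x \<in> S"
  shows "2 * g x (\<Gamma> x u v) w = dg x u v w + dg x v u w - dg x w u v"
proof -
  define k where "k w = (dg x u v w + dg x v u w - dg x w u v) / 2" for w
  have "linear k"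
    unfolding k_def
    by (intro linearI) (simp_all add: linear_add[OF dg_lin1[OF assms]] linear_add[OF dg_lin3[OF assms]]
      linear_cmul[OF dg_lin1[OF assms]] linear_cmul[OF dg_lin3[OF assms]] field_simps)
  note musical_iff[OF assms this]
  then have "\<exists>!z. \<forall>w. g x z w = k w" by auto
  then have "\<exists>!z. \<forall>w. 2 * g x z w = dg x u v w + dg x v u w - dg x w u v"
    by (simp add: k_def field_simps)
  from theI'[OF this] show ?thesis by (simp add: levi_civita_def)
qed

lemma \<Gamma>_sym: "x \<in> S \<Longrightarrow> \<Gamma> x u v = \<Gamma> x v u"
proof (rule g_nondegenerate, assumption)
  fix w assume "x \<in> S"
  then show "g x (\<Gamma> x u v) w = g x (\<Gamma> x v u) w"
    using koszul[of x u v w] koszul[of x v u w] dg_sym[of x u v w] by simp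
qed

lemma \<Gamma>_lin2:
  assumes "x \<in> S"
  shows "linear (\<Gamma> x u)"
proof (rule linearI; rule g_nondegenerate[OF assms])
  fix v v' w
  show "g x (\<Gamma> x u (v + v')) w = g x (\<Gamma> x u v + \<Gamma> x u v') w"
    using koszul[OF assms, of u "v + v'" w] koszul[OF assms, of u v w] koszul[OF assms, of u v' w]
    by (simp add: g_left[OF assms] linear_add[OF dg_lin1[OF assms]] linear_add[OF dg_lin2[OF assms]]
        linear_add[OF dg_lin3[OF assms]])
next
  fix r v w
  have "2 * g x (\<Gamma> x u (r *\<^sub>R v)) w = r * (2 * g x (\<Gamma> x u v) w)"
    unfolding koszul[OF assms]
    by (simp add: linear_cmul[OF dg_lin1[OF assms]] linear_cmul[OF dg_lin2[OF assms]]
        linear_cmul[OF dg_lin3[OF assms]] algebra_simps)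
  then show "g x (\<Gamma> x u (r *\<^sub>R v)) w = g x (r *\<^sub>R \<Gamma> x u v) w" by (simp add: g_left[OF assms])
qed

lemma \<Gamma>_lin1: "x \<in> S \<Longrightarrow> linear (\<lambda>u. \<Gamma> x u v)"
proof -
  assume x: "x \<in> S"
  have "(\<lambda>u. \<Gamma> x u v) = \<Gamma> x v" using \<Gamma>_sym[OF x] by blast
  with \<Gamma>_lin2[OF x] show ?thesis by simp
qed

lemma \<Gamma>_smooth: "smooth_on S (\<lambda>x. \<Gamma> x u v)"
proof (rule musical_smooth)
  show "g x (\<Gamma> x u v) w = (dg x u v w + dg x v u w - dg x w u v) * (1 / 2)" if "x \<in> S" for x w
    using koszul[OF that, of u v w] by simp
qed (intro smooth_on_intros open_S smooth_on_dirderiv smooth)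

lemma metric_compatible: "x \<in> S \<Longrightarrow> dg x a u v = g x (\<Gamma> x a u) v + g x u (\<Gamma> x a v)"
  using koszul[of x a u v] koszul[of x a v u] dg_sym[of x u v a] dg_sym[of x a v u] dg_sym[of x a u v]
    g_sym[of x u "\<Gamma> x a v"] by simp

abbreviation d\<Gamma> :: "real^'n \<Rightarrow> real^'n \<Rightarrow> real^'n \<Rightarrow> real^'n \<Rightarrow> real^'n"
  where "d\<Gamma> x a u v \<equiv> dirderiv (\<lambda>y. \<Gamma> y u v) x a"

lemma has_derivative_\<Gamma>: "x \<in> S \<Longrightarrow> ((\<lambda>y. \<Gamma> y u v) has_derivative (\<lambda>a. d\<Gamma> x a u v)) (at x)"
  by (rule smooth_on_has_derivative[OF \<Gamma>_smooth])

lemma d\<Gamma>_sym: "x \<in> S \<Longrightarrow> d\<Gamma> x a u v = d\<Gamma> x a v u"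
  using has_derivative_eq_dirderiv[OF open_S, of x "\<lambda>y. \<Gamma> y u v" "\<lambda>y. \<Gamma> y v u"] \<Gamma>_sym has_derivative_\<Gamma>
  by metis

lemma d\<Gamma>_lin1: "x \<in> S \<Longrightarrow> linear (\<lambda>a. d\<Gamma> x a u v)"
  using has_derivative_linear[OF has_derivative_\<Gamma>] .

lemma d\<Gamma>_lin2: "x \<in> S \<Longrightarrow> linear (\<lambda>u. d\<Gamma> x a u v)"
  by (rule has_derivative_linear_family(1)[OF open_S, where q = "\<lambda>x. 0" and q' = "\<lambda>x. 0"])
    (use \<Gamma>_lin1 smooth_on_differentiable[OF \<Gamma>_smooth] in auto)

lemma d\<Gamma>_lin3: "x \<in> S \<Longrightarrow> linear (\<lambda>v. d\<Gamma> x a u v)"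
proof -
  assume x: "x \<in> S"
  have "(\<lambda>v. d\<Gamma> x a u v) = (\<lambda>v. d\<Gamma> x a v u)" using d\<Gamma>_sym[OF x] by blast
  with d\<Gamma>_lin2[OF x] show ?thesis by simp
qed

lemma has_derivative_\<Gamma>_field:
  assumes "x \<in> S" "(V has_derivative V') (at x)"
  shows "((\<lambda>y. \<Gamma> y u (V y)) has_derivative (\<lambda>h. \<Gamma> x u (V' h) + d\<Gamma> x h u (V x))) (at x)"
  by (rule has_derivative_linear_family(2)[OF open_S assms(1), where L = "\<lambda>y. \<Gamma> y u"])
    (use assms \<Gamma>_lin2 smooth_on_differentiable[OF \<Gamma>_smooth] in auto)

text \<open>Metric compatibility distributes the derivative of \<open>g\<close> over the two fields
  and thereby turns both ordinary derivatives into covariant ones. Later inner products of fields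
  are differentiated in this form.\<close>

lemma has_derivative_g_fields:
  assumes x: "x \<in> S" and V: "(V has_derivative V') (at x)" and W: "(W has_derivative W') (at x)"
  shows "((\<lambda>y. g y (V y) (W y)) has_derivative
    (\<lambda>h. g x (V' h + \<Gamma> x h (V x)) (W x) + g x (V x) (W' h + \<Gamma> x h (W x)))) (at x)"
proof -
  have 1: "((\<lambda>y. g y (V y) w) has_derivative (\<lambda>h. g x (V' h) w + dg x h (V x) w)) (at x)" for w
    by (rule has_derivative_linear_family(2)[OF open_S x, where L = "\<lambda>y u. g y u w"])
      (use V x gl smooth_on_differentiable[OF smooth] in auto)
  have "((\<lambda>y. g y (V y) (W y)) has_derivative
      (\<lambda>h. g x (V x) (W' h) + dirderiv (\<lambda>y. g y (V y) (W x)) x h)) (at x)"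
    by (rule has_derivative_linear_family(2)[OF open_S x, where L = "\<lambda>y. g y (V y)"])
      (use W x gr 1 in \<open>auto intro: differentiableI\<close>)
  then show ?thesis
    by (rule has_derivative_eq_rhs)
      (simp add: dirderiv_eqI[OF 1] metric_compatible[OF x] g_left[OF x] g_right[OF x] add_ac)
qed

abbreviation R :: "real^'n \<Rightarrow> real^'n \<Rightarrow> real^'n \<Rightarrow> real^'n \<Rightarrow> real^'n"
  where "R \<equiv> curvature g"

lemma R_add:
  assumes "x \<in> S"
  shows "R x (u + u') v w = R x u v w + R x u' v w"
    and "R x u (v + v') w = R x u v w + R x u v' w"
    and "R x u v (w + w') = R x u v w + R x u v w'"
  unfolding curvature_def
  by (simp_all add: linear_add[OF d\<Gamma>_lin1] linear_add[OF d\<Gamma>_lin2] linear_add[OF d\<Gamma>_lin3]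
      linear_add[OF \<Gamma>_lin1] linear_add[OF \<Gamma>_lin2] assms)

lemma R_scale:
  assumes "x \<in> S"
  shows "R x (r *\<^sub>R u) v w = r *\<^sub>R R x u v w"
  unfolding curvature_def
  by (simp add: linear_cmul[OF d\<Gamma>_lin1] linear_cmul[OF d\<Gamma>_lin2] linear_cmul[OF d\<Gamma>_lin3]
      linear_cmul[OF \<Gamma>_lin1] linear_cmul[OF \<Gamma>_lin2] assms algebra_simps)

lemma R_skew: "R x u v w = - R x v u w"
  by (simp add: curvature_def)

lemma R_bianchi: "x \<in> S \<Longrightarrow> R x u v w + R x v w u + R x w u v = 0"
  using d\<Gamma>_sym[of x v w u] d\<Gamma>_sym[of x w u v] d\<Gamma>_sym[of x u v w]
    \<Gamma>_sym[of x v w] \<Gamma>_sym[of x w u] \<Gamma>_sym[of x u v]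
  by (simp add: curvature_def)

text \<open>The second derivatives of \<open>g y w z\<close> commute for constant \<open>w\<close>
  and \<open>z\<close>. Written out by metric compatibility, the mixed products of first covariant
  derivatives are symmetric in \<open>u\<close> and \<open>v\<close>, and only the curvature terms
  remain.\<close>

lemma R_skew_metric:
  assumes "x \<in> S"
  shows "g x (R x u v w) z = - g x w (R x u v z)"
proof -
  have "dirderiv (\<lambda>y. dg y v w z) x u =
      g x (d\<Gamma> x u v w + \<Gamma> x u (\<Gamma> x v w)) z + g x (\<Gamma> x v w) (\<Gamma> x u z) +
      (g x (\<Gamma> x u w) (\<Gamma> x v z) + g x w (d\<Gamma> x u v z + \<Gamma> x u (\<Gamma> x v z)))" for u v
  proof -
    have "((\<lambda>y. g y (\<Gamma> y v w) z + g y w (\<Gamma> y v z)) has_derivative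
      (\<lambda>u. g x (d\<Gamma> x u v w + \<Gamma> x u (\<Gamma> x v w)) z + g x (\<Gamma> x v w) (0 + \<Gamma> x u z) +
        (g x (0 + \<Gamma> x u w) (\<Gamma> x v z) + g x w (d\<Gamma> x u v z + \<Gamma> x u (\<Gamma> x v z))))) (at x)"
      by (intro has_derivative_add has_derivative_g_fields assms has_derivative_\<Gamma> has_derivative_const)
    from has_derivative_eq_dirderiv[OF open_S assms metric_compatible this]
    show ?thesis by simp
  qed
  note this[of u v] this[of v u]
  moreover have "dirderiv (\<lambda>y. dg y v w z) x u = dirderiv (\<lambda>y. dg y u w z) x v"
    by (rule dirderiv_commute[OF open_S smooth assms])
  ultimately show ?thesis
    by (simp add: curvature_def g_left[OF assms] g_right[OF assms])
qed

definition has_curvature :: "real \<Rightarrow> bool"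
  where "has_curvature \<kappa> \<longleftrightarrow>
    (\<forall>x\<in>S. \<forall>u v. u \<noteq> v \<and> independent {u, v} \<longrightarrow> sectional_curvature g x u v = \<kappa>)"

text \<open>For dependent vectors both sides vanish, so the product form of the curvature condition
  holds without exception. Polarisation needs it for all pairs.\<close>

lemma sectional:
  assumes "has_curvature \<kappa>" "x \<in> S"
  shows "g x (R x u v v) u = \<kappa> * (g x u u * g x v v - (g x u v)\<^sup>2)"
proof (cases "u \<noteq> v \<and> independent {u, v}")
  case True
  have "g x u u * g x v v - (g x u v)\<^sup>2 \<noteq> 0"
    using inner_form.gram_det_nonzero[OF inner[OF assms(2)]] True by blast
  then show ?thesis
    using True assms by (auto simp: has_curvature_def sectional_curvature_def divide_eq_eq)
next
  case False
  then have "(\<exists>c. u = c *\<^sub>R v) \<or> v = 0"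
    using scaleR_one[of v, symmetric]
    by (cases "u = v") (blast, auto simp: independent_insert span_singleton)
  moreover have "R x v v w = 0" for w by (simp add: curvature_def)
  moreover have "R x u 0 0 = 0" using R_add(3)[OF assms(2), of u 0 0 0] by simp
  ultimately show ?thesis
    by (auto simp: R_scale g_left[OF assms(2)] g_right[OF assms(2)] assms(2) power2_eq_square)
qed

text \<open>The difference from the model tensor has the symmetries of a curvature tensor and zero
  sectional values, hence vanishes.\<close>

lemma curvature_tensor:
  assumes \<kappa>: "has_curvature \<kappa>" and x: "x \<in> S"
  shows "R x u v w = \<kappa> *\<^sub>R (g x v w *\<^sub>R u - g x u w *\<^sub>R v)"
proof (rule g_nondegenerate[OF x])
  fix z
  have "g x (R x u v w) z - \<kappa> * (g x v w * g x u z - g x u w * g x v z) = 0"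
  proof (rule curvature_like_eq_0[where
        T = "\<lambda>u v w z. g x (R x u v w) z - \<kappa> * (g x v w * g x u z - g x u w * g x v z)"])
    fix u v w z
    show "g x (R x u v w) z - \<kappa> * (g x v w * g x u z - g x u w * g x v z) =
      - (g x (R x v u w) z - \<kappa> * (g x u w * g x v z - g x v w * g x u z))"
      by (subst R_skew) (simp add: g_left[OF x] algebra_simps)
    show "g x (R x u v w) z - \<kappa> * (g x v w * g x u z - g x u w * g x v z) =
      - (g x (R x u v z) w - \<kappa> * (g x v z * g x u w - g x u z * g x v w))"
      using R_skew_metric[OF x, of u v w z] g_sym[OF x, of w "R x u v z"] by (simp add: algebra_simps)
    have "g x (R x u v w) z + g x (R x v w u) z + g x (R x w u v) z = 0"
      using R_bianchi[OF x, of u v w] linear_0[OF gl[OF x], of z] by (simp flip: g_left(1)[OF x])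
    then show "g x (R x u v w) z - \<kappa> * (g x v w * g x u z - g x u w * g x v z) +
      (g x (R x v w u) z - \<kappa> * (g x w u * g x v z - g x v u * g x w z)) +
      (g x (R x w u v) z - \<kappa> * (g x u v * g x w z - g x w v * g x u z)) = 0"
      using g_sym[OF x, of w u] g_sym[OF x, of v u] g_sym[OF x, of w v] by (simp add: algebra_simps)
    show "g x (R x u v v) u - \<kappa> * (g x v v * g x u u - g x u v * g x v u) = 0"
      using sectional[OF \<kappa> x, of u v] g_sym[OF x, of v u] by (simp add: power2_eq_square algebra_simps)
  qed (auto simp: R_add[OF x] g_left[OF x] g_right[OF x] algebra_simps)
  then show "g x (R x u v w) z = g x (\<kappa> *\<^sub>R (g x v w *\<^sub>R u - g x u w *\<^sub>R v)) z"
    by (simp add: g_left[OF x])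
qed

end

lemma dirderiv_commute_vector:
  fixes f :: "'a::euclidean_space \<Rightarrow> 'b::euclidean_space"
  assumes "open S" "smooth_on S f" "x \<in> S"
  shows "dirderiv (\<lambda>y. dirderiv f y u) x v = dirderiv (\<lambda>y. dirderiv f y v) x u"
proof (rule euclidean_eqI)
  fix b :: 'b
  have inner: "dirderiv (\<lambda>y. h y \<bullet> b) y w = dirderiv h y w \<bullet> b" if "smooth_on S h" "y \<in> S" for h :: "'a \<Rightarrow> 'b" and y w
    using dirderiv_eqI[OF has_derivative_inner_left[OF smooth_on_has_derivative[OF that]]] by simp
  have fb: "smooth_on S (\<lambda>y. f y \<bullet> b)" by (intro smooth_on_intros assms)
  have "dirderiv (\<lambda>y. dirderiv f y u) x v \<bullet> b = dirderiv (\<lambda>y. dirderiv (\<lambda>y. f y \<bullet> b) y u) x v" for u v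
  proof -
    have "((\<lambda>y. dirderiv f y u \<bullet> b) has_derivative (\<lambda>v. dirderiv (\<lambda>y. dirderiv f y u) x v \<bullet> b)) (at x)"
      by (rule has_derivative_inner_left[OF smooth_on_has_derivative[OF smooth_on_dirderiv[OF assms(2)] assms(3)]])
    from has_derivative_eq_dirderiv[OF assms(1,3) _ this, of "\<lambda>y. dirderiv (\<lambda>y. f y \<bullet> b) y u"]
    show ?thesis by (simp add: inner assms)
  qed
  then show "dirderiv (\<lambda>y. dirderiv f y u) x v \<bullet> b = dirderiv (\<lambda>y. dirderiv f y v) x u \<bullet> b"
    using dirderiv_commute[OF assms(1) fb assms(3)] by simp
qed

section \<open>Unit Killing fields\<close>

text \<open>A skew matrix with a single zero row, bordered there by \<open>s\<close> respectively \<open>- s\<close>: one border is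
  the negative transpose of the other, and they differ by the sign of one row.\<close>

lemma det_bordered_skew:
  fixes a :: "'n::finite \<Rightarrow> 'n \<Rightarrow> real"
  assumes skew: "\<And>i j. a i j = - a j i" and row: "\<And>j. a k j = 0"
    and det: "det (\<chi> i j. a i j + (if i = k \<and> j = k then s else 0)) \<noteq> 0"
  shows "odd CARD('n)"
proof -
  define B where "B s = (\<chi> i j. a i j + (if i = k \<and> j = k then s else 0))" for s
  have col: "a j k = 0" for j using skew[of j k] row[of j] by simp
  have "B (- s) = (\<chi> i. if i = k then (-1) *s (B s $ i) else B s $ i)"
    by (auto simp: B_def vec_eq_iff row)
  then have "det (B (- s)) = (-1) * det (\<chi> i. if i = k then B s $ i else B s $ i)"
    by (simp only: det_row_mul)
  then have 1: "det (B (- s)) = - det (B s)" by simp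
  have "transpose (B s) = (\<chi> i. (-1) *s (B (- s) $ i))"
  proof (simp add: vec_eq_iff transpose_def, intro allI)
    fix i j
    show "B s $ j $ i = - (B (- s) $ i $ j)" using skew[of j i] row[of k] by (auto simp: B_def)
  qed
  then have "det (B s) = det (\<chi> i. (-1) *s (B (- s) $ i))" by (metis det_transpose)
  also have "\<dots> = (-1) ^ CARD('n) * det (B (- s))"
    using det_rows_mul[of "\<lambda>i. -1" "\<lambda>i. B (- s) $ i"] by simp
  finally have "det (B s) = - ((-1) ^ CARD('n) * det (B s))" using 1 by simp
  then show ?thesis using det by (cases "even CARD('n)") (auto simp: B_def)
qed

text \<open>By \<open>norm\<close> the kernel of \<open>A\<close> is spanned by \<open>p\<close>. In
  an orthonormal basis containing \<open>p\<close> the matrix of \<open>A\<close> becomes invertible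
  once the entry 1 is put at the diagonal place of \<open>p\<close>, and the bordered determinant
  decides the parity. The type \<open>'n\<close> supplies matrix indices in the right
  number.\<close>

lemma (in inner_form) skew_rank_odd:
  fixes A :: "'a \<Rightarrow> 'a"
  assumes type: "CARD('n::finite) = DIM('a)"
    and A: "linear A" "\<And>u v. b (A u) v = - b u (A v)" "A p = 0" and p: "b p p = 1"
    and norm: "\<And>u. b (A u) (A u) = \<kappa> * (b u u - (b u p)\<^sup>2)" and "\<kappa> > 0"
  shows "odd CARD('n)"
proof -
  have on: "orthonormal {p}" using p by (simp add: orthonormal_def)
  obtain C where C: "finite C" "orthonormal C" "{p} \<subseteq> C" "card C = DIM('a)" "span C = UNIV"
    using orthonormal_basis_extension[OF _ on] by blast
  obtain e :: "'n \<Rightarrow> 'a" where e: "bij_betw e UNIV C"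
    using finite_same_card_bij[of "UNIV :: 'n set" C] C type by auto
  then obtain k where k: "e k = p" using C(3) by (metis UNIV_I bij_betw_imp_surj_on image_iff insert_subset)
  have ee: "b (e i) (e j) = (if i = j then 1 else 0)" for i j
    using C(2) e bij_betw_apply[OF e] by (auto simp: orthonormal_def bij_betw_def inj_on_eq_iff)
  have coord: "b (\<Sum>j\<in>UNIV. x j *\<^sub>R e j) (e i) = x i" for x i
    by (simp add: left_simps ee if_distrib cong: if_cong)
  have expand: "(\<Sum>i\<in>UNIV. b u (e i) *\<^sub>R e i) = u" for u
    by (rule orthonormal_expansion) (use type ee in auto)
  have zero: "u = 0" if "\<And>i. b u (e i) = 0" for u using expand[of u] that by simp
  define a where "a i j = b (A (e j)) (e i)" for i j
  let ?B = "(\<chi> i j. a i j + (if i = k \<and> j = k then 1 else 0)) :: real^'n^'n"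
  have "x = 0" if Bx: "?B *v x = 0" for x
  proof -
    define u where "u = (\<Sum>j\<in>UNIV. x $ j *\<^sub>R e j)"
    have "b (A u + (x $ k) *\<^sub>R p) (e i) = 0" for i
    proof -
      have "b (A u) (e i) = (\<Sum>j\<in>UNIV. a i j * x $ j)"
        unfolding u_def by (simp add: linear_sum[OF A(1)] linear_cmul[OF A(1)] left_simps a_def mult.commute)
      moreover have "b p (e i) = (if i = k then 1 else 0)" using ee[of k i] k by simp
      moreover have "(\<Sum>j\<in>UNIV. (a i j + (if i = k \<and> j = k then 1 else 0)) * x $ j) = 0"
        using Bx by (simp add: vec_eq_iff matrix_vector_mult_def)
      moreover have "(\<Sum>j\<in>UNIV. (if i = k \<and> j = k then 1 else 0) * x $ j) = (if i = k then x $ k else 0)"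
        by (simp add: if_distrib[of "\<lambda>c. c * _"] cong: if_cong)
      ultimately show ?thesis by (auto simp: left_simps distrib_right sum.distrib)
    qed
    \<comment> \<open>The image of \<open>A\<close> is orthogonal to \<open>p\<close>, so the two
      summands vanish separately: first the coefficient \<open>x $ k\<close>, then
      \<open>A u\<close>.\<close>
    then have *: "A u + (x $ k) *\<^sub>R p = 0" by (rule zero)
    have "b (A u + (x $ k) *\<^sub>R p) p = x $ k" using A(2)[of u p] A(3) p by (simp add: left_simps right_simps)
    then have xk: "x $ k = 0" using * by (simp add: left_simps)
    then have "A u = 0" using * by simp
    moreover have "b u p = 0" using coord[of "\<lambda>j. x $ j" k] k xk by (simp add: u_def)
    ultimately have "b u u = 0" using norm[of u] \<open>\<kappa> > 0\<close> by (simp add: left_simps)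
    then have "u = 0" by (simp add: eq_0_iff)
    then show ?thesis
      using coord[of "\<lambda>j. x $ j"] by (simp add: u_def vec_eq_iff left_simps)
  qed
  then have "det ?B \<noteq> 0"
    using matrix_left_invertible_ker[of ?B] invertible_left_inverse[of ?B] invertible_det_nz by blast
  moreover have "a i j = - a j i" for i j
    using A(2)[of "e j" "e i"] sym[of "e j"] by (simp add: a_def)
  moreover have "a k j = 0" for j
    using A(2)[of "e j" p] A(3) by (simp add: a_def k right_simps)
  ultimately show ?thesis by (rule det_bordered_skew[rotated 2])
qed

context local_metric
begin

section \<open>The covariant derivative of a unit Killing field\<close>

definition cov :: "(real^'n \<Rightarrow> real^'n) \<Rightarrow> real^'n \<Rightarrow> real^'n \<Rightarrow> real^'n"
  where "cov w x u = dirderiv w x u + \<Gamma> x u (w x)"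

context
  fixes w
  assumes w: "smooth_on S w"
    and killing: "\<And>x u v. x \<in> S \<Longrightarrow> lie_derivative_metric w g x u v = 0"
    and unit: "\<And>x. x \<in> S \<Longrightarrow> g x (w x) (w x) = 1"
begin

lemma field_has_derivative: "x \<in> S \<Longrightarrow> (w has_derivative dirderiv w x) (at x)"
  by (rule smooth_on_has_derivative[OF w])

lemma cov_linear: "x \<in> S \<Longrightarrow> linear (cov w x)"
  unfolding cov_def[abs_def]
  by (intro linear_compose_add has_derivative_linear[OF field_has_derivative] \<Gamma>_lin1)

text \<open>Metric compatibility replaces the derivative of \<open>g\<close> along the field in
  Killing's equation, and the symmetry of \<open>\<Gamma>\<close> combines its terms into covariant
  derivatives of the field.\<close>

lemma cov_skew: "x \<in> S \<Longrightarrow> g x (cov w x u) v = - g x u (cov w x v)"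
  using killing[of x u v] metric_compatible[of x u v "w x"] \<Gamma>_sym[of x "w x" u] \<Gamma>_sym[of x "w x" v]
  by (simp add: lie_derivative_metric_def cov_def g_left g_right)

lemma cov_unit:
  assumes x: "x \<in> S"
  shows "g x (cov w x u) (w x) = 0"
proof -
  have "((\<lambda>y. g y (w y) (w y)) has_derivative
    (\<lambda>h. g x (cov w x h) (w x) + g x (w x) (cov w x h))) (at x)"
    unfolding cov_def by (rule has_derivative_g_fields[OF x field_has_derivative[OF x] field_has_derivative[OF x]])
  moreover have "((\<lambda>y. g y (w y) (w y)) has_derivative (\<lambda>h. 0)) (at x)"
    by (rule has_derivative_transform_within_open[OF has_derivative_const open_S x, of 1]) (simp add: unit)
  ultimately have "g x (cov w x u) (w x) + g x (w x) (cov w x u) = 0"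
    by (rule fun_cong[OF has_derivative_unique])
  then show ?thesis using g_sym[OF x, of "w x" "cov w x u"] by simp
qed

text \<open>Skewness moves the operator onto the test vector, where the constant length applies.
  Geometrically, the integral curves of the field are geodesics.\<close>

lemma cov_geodesic:
  assumes x: "x \<in> S"
  shows "cov w x (w x) = 0"
proof (rule g_nondegenerate[OF x])
  fix u
  show "g x (cov w x (w x)) u = g x 0 u"
    using cov_skew[OF x, of u "w x"] cov_unit[OF x, of u] g_sym[OF x, of u "cov w x (w x)"]
    by (simp add: g_left[OF x])
qed

lemma smooth_on_cov: "smooth_on S (\<lambda>x. cov w x u)"
proof -
  have "smooth_on S (\<lambda>x. \<Gamma> x u (w x))"
    by (rule smooth_on_linear_family[where L = "\<lambda>x. \<Gamma> x u" and q = w])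
      (auto intro: open_S \<Gamma>_lin2 \<Gamma>_smooth w)
  then show ?thesis
    unfolding cov_def by (rule smooth_on_add[OF open_S smooth_on_dirderiv[OF w]])
qed

text \<open>Differentiate \<open>cov_geodesic\<close> in direction \<open>u\<close> and \<open>cov_skew\<close> in direction \<open>w\<close>.\<close>

lemma curvature_unit_killing:
  assumes x: "x \<in> S"
  shows "g x (R x u (w x) (w x)) u = g x (cov w x u) (cov w x u)"
proof -
  define p where "p = w x"
  \<comment> \<open>\<open>dA u v\<close> is the covariant derivative, in direction
    \<open>u\<close>, of the operator \<open>cov w\<close>, applied to \<open>v\<close>.\<close>
  define dA where "dA u v = dirderiv (\<lambda>y. cov w y v) x u + \<Gamma> x u (cov w x v) - cov w x (\<Gamma> x u v)" for u v
  have cov_deriv: "((\<lambda>y. cov w y v) has_derivative dirderiv (\<lambda>y. cov w y v) x) (at x)" for v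
    by (rule smooth_on_has_derivative[OF smooth_on_cov x])
  have dcov: "dirderiv (\<lambda>y. cov w y v) x u =
      dirderiv (\<lambda>y. dirderiv w y v) x u + (\<Gamma> x v (dirderiv w x u) + d\<Gamma> x u v p)" for u v
    unfolding cov_def p_def
    by (intro dirderiv_eqI[THEN fun_cong] has_derivative_add has_derivative_\<Gamma>_field[OF x field_has_derivative[OF x]]
        smooth_on_has_derivative[OF smooth_on_dirderiv[OF w] x])
  \<comment> \<open>The Ricci identity: in the skew part of the second covariant derivative the
    ordinary second derivatives cancel and the curvature is left.\<close>
  have curv: "R x u v p = dA u v - dA v u" for v
    using dirderiv_commute_vector[OF open_S w x, of u v] \<Gamma>_sym[OF x, of u v]
    by (simp add: dA_def dcov curvature_def cov_def[of w x] p_def[symmetric] linear_add[OF \<Gamma>_lin2[OF x]])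
  have dAp: "dA u p = - cov w x (cov w x u)"
  proof -
    have "((\<lambda>y. cov w y (w y)) has_derivative
        (\<lambda>h. cov w x (dirderiv w x h) + dirderiv (\<lambda>y. cov w y p) x h)) (at x)"
      unfolding p_def
      by (rule has_derivative_linear_family(2)[OF open_S x, where L = "cov w"])
        (use cov_linear field_has_derivative[OF x] cov_deriv in \<open>auto intro: differentiableI\<close>)
    moreover have "((\<lambda>y. cov w y (w y)) has_derivative (\<lambda>h. 0)) (at x)"
      by (rule has_derivative_transform_within_open[OF has_derivative_const open_S x, of 0])
        (simp add: cov_geodesic)
    ultimately have "cov w x (dirderiv w x u) + dirderiv (\<lambda>y. cov w y p) x u = 0"
      by (rule fun_cong[OF has_derivative_unique])
    moreover have "cov w x p = 0" using cov_geodesic[OF x] by (simp add: p_def)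
    moreover have "cov w x (cov w x u) = cov w x (dirderiv w x u) + cov w x (\<Gamma> x u p)"
      by (simp add: cov_def[of w x u] p_def linear_add[OF cov_linear[OF x]])
    ultimately show ?thesis
      by (simp add: dA_def linear_0[OF \<Gamma>_lin2[OF x]] eq_neg_iff_add_eq_0 algebra_simps)
  qed
  have skew: "g x (dA p u) u = 0"
  proof -
    have 0: "g y (cov w y u) u = 0" if "y \<in> S" for y
      using cov_skew[OF that, of u u] g_sym[OF that, of u "cov w y u"] by simp
    have "((\<lambda>y. g y (cov w y u) u) has_derivative
        (\<lambda>h. g x (dirderiv (\<lambda>y. cov w y u) x h + \<Gamma> x h (cov w x u)) u +
          g x (cov w x u) (0 + \<Gamma> x h u))) (at x)"
      by (rule has_derivative_g_fields[OF x cov_deriv has_derivative_const])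
    moreover have "((\<lambda>y. g y (cov w y u) u) has_derivative (\<lambda>h. 0)) (at x)"
      by (rule has_derivative_transform_within_open[OF has_derivative_const open_S x, of 0]) (simp add: 0)
    ultimately have "g x (dirderiv (\<lambda>y. cov w y u) x p + \<Gamma> x p (cov w x u)) u +
          g x (cov w x u) (0 + \<Gamma> x p u) = 0"
      by (rule fun_cong[OF has_derivative_unique])
    moreover have "g x (cov w x u) (\<Gamma> x p u) = - g x (cov w x (\<Gamma> x p u)) u"
      using cov_skew[OF x, of u "\<Gamma> x p u"] g_sym[OF x, of u "cov w x (\<Gamma> x p u)"] by simp
    ultimately show ?thesis by (simp add: dA_def g_left[OF x])
  qed
  have "g x (R x u p p) u = - g x (cov w x (cov w x u)) u"
    unfolding curv using skew by (simp add: g_left[OF x] dAp)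
  also have "\<dots> = g x (cov w x u) (cov w x u)" using cov_skew[OF x, of "cov w x u" u] by simp
  finally show ?thesis by (simp add: p_def)
qed

lemma unit_killing_curvature:
  assumes \<kappa>: "has_curvature \<kappa>" and "x \<in> S" and "CARD('n) \<ge> 2"
  shows "\<kappa> = 0 \<or> \<kappa> > 0 \<and> odd CARD('n)"
proof -
  note x = \<open>x \<in> S\<close>
  interpret inner_form "g x" by (rule inner[OF x])
  have norm: "g x (cov w x u) (cov w x u) = \<kappa> * (g x u u - (g x u (w x))\<^sup>2)" for u
    using curvature_unit_killing[OF x, of u] unit[OF x] sym[of "w x" u]
    by (simp add: curvature_tensor[OF \<kappa> x] left_simps power2_eq_square)
  have on: "orthonormal {w x}" using unit[OF x] by (simp add: orthonormal_def)
  obtain C where C: "finite C" "orthonormal C" "{w x} \<subseteq> C" "card C = DIM(real^'n)"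
    by (rule orthonormal_basis_extension[OF _ on]) auto
  \<comment> \<open>Dimension at least 2 leaves room for a unit vector orthogonal to the field; for
    it the norm identity presents \<open>\<kappa>\<close> as the square of a length.\<close>
  have "\<not> C \<subseteq> {w x}" using card_mono[of "{w x}" C] C(4) assms(3) by auto
  then obtain v where "v \<in> C" "v \<noteq> w x" by blast
  then have v: "g x v v = 1" "g x v (w x) = 0" using C by (auto simp: orthonormal_def)
  have "g x (cov w x v) (cov w x v) \<ge> 0"
    using pos[of "cov w x v"] eq_0_iff[of "cov w x v"] by (cases "cov w x v = 0") auto
  then have "\<kappa> \<ge> 0" using norm[of v] v by simp
  moreover have "odd CARD('n)" if "\<kappa> > 0"
    by (rule skew_rank_odd[where A = "cov w x" and p = "w x" and \<kappa> = \<kappa>])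
      (use cov_linear[OF x] cov_skew[OF x] cov_geodesic[OF x] unit[OF x] norm that in auto)
  ultimately show ?thesis by linarith
qed

end

end

section \<open>Developing maps of spaces of constant curvature\<close>

context local_metric
begin

text \<open>For \<open>y = (V, f)\<close> the system states \<open>\<nabla>V = - \<kappa> f id\<close> and \<open>df = g(V, \<cdot>)\<close>, so that the Hessian of \<open>f\<close> is
  \<open>- \<kappa> f g\<close>. On a space of curvature \<open>\<kappa>\<close> the solutions \<open>f\<close> are the ambient coordinates.\<close>

definition ambient_system :: "real \<Rightarrow> real^'n \<Rightarrow> real^'n \<Rightarrow> (real^'n) \<times> real \<Rightarrow> (real^'n) \<times> real"
  where "ambient_system \<kappa> x u y = (- \<Gamma> x u (fst y) - (\<kappa> * snd y) *\<^sub>R u, g x u (fst y))"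

text \<open>In the vector component the condition is exactly the formula for the curvature tensor.
  In the scalar component it is the symmetry of the Hessian of \<open>f\<close>, which follows from
  the symmetry of \<open>g\<close> and \<open>\<Gamma>\<close>.\<close>

lemma ambient_system_integrable:
  assumes \<kappa>: "has_curvature \<kappa>" and x: "x \<in> S"
  shows "dirderiv (\<lambda>z. ambient_system \<kappa> z v y) x u + ambient_system \<kappa> x v (ambient_system \<kappa> x u y) =
    dirderiv (\<lambda>z. ambient_system \<kappa> z u y) x v + ambient_system \<kappa> x u (ambient_system \<kappa> x v y)"
proof -
  have d: "dirderiv (\<lambda>z. ambient_system \<kappa> z v y) x u = (- d\<Gamma> x u v (fst y), dg x u v (fst y))" for u v
  proof -
    have "((\<lambda>z. ambient_system \<kappa> z v y) has_derivative
        (\<lambda>u. (- d\<Gamma> x u v (fst y) - 0, dg x u v (fst y)))) (at x)"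
      unfolding ambient_system_def
      by (intro has_derivative_Pair has_derivative_diff has_derivative_minus has_derivative_\<Gamma>
          has_derivative_g has_derivative_const x)
    from dirderiv_eqI[OF this] show ?thesis by simp
  qed
  have "\<Gamma> x v (\<Gamma> x u V) - d\<Gamma> x u v V + \<kappa> *\<^sub>R (g x v V *\<^sub>R u) =
      \<Gamma> x u (\<Gamma> x v V) - d\<Gamma> x v u V + \<kappa> *\<^sub>R (g x u V *\<^sub>R v)" for V
    using curvature_tensor[OF \<kappa> x, of u v V] by (simp add: curvature_def algebra_simps)
  from this[of "fst y"] show ?thesis
    unfolding d using \<Gamma>_sym[OF x, of u v] g_sym[OF x, of v u]
      g_sym[OF x, of v "\<Gamma> x u (fst y)"] g_sym[OF x, of u "\<Gamma> x v (fst y)"]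
    by (simp add: ambient_system_def linear_diff[OF \<Gamma>_lin2[OF x]] linear_neg[OF \<Gamma>_lin2[OF x]]
        linear_cmul[OF \<Gamma>_lin2[OF x]] metric_compatible[OF x] g_right[OF x] algebra_simps)
qed

lemma smooth_on_ambient_system:
  assumes "open B" "B \<subseteq> S"
  shows "smooth_on (B \<times> UNIV) (\<lambda>p. ambient_system \<kappa> (fst p) v (snd p))"
proof -
  have op: "open (B \<times> (UNIV :: ((real^'n) \<times> real) set))" using assms by (simp add: open_Times)
  have sub: "fst ` (B \<times> (UNIV :: ((real^'n) \<times> real) set)) \<subseteq> S" using assms by auto
  have fst: "smooth_on (B \<times> UNIV) (\<lambda>p :: (real^'n) \<times> (real^'n) \<times> real. fst p)"
    by (intro smooth_on_intros op)
  have 1: "smooth_on (B \<times> UNIV) (\<lambda>p :: (real^'n) \<times> (real^'n) \<times> real. \<Gamma> (fst p) v (fst (snd p)))"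
    by (rule smooth_on_linear_family[OF op, where L = "\<lambda>p. \<Gamma> (fst p) v" and q = "\<lambda>p. fst (snd p)"])
      (use sub \<Gamma>_lin2 in \<open>auto intro!: smooth_on_intros op smooth_on_compose[OF op sub \<Gamma>_smooth fst]\<close>)
  have 2: "smooth_on (B \<times> UNIV) (\<lambda>p :: (real^'n) \<times> (real^'n) \<times> real. g (fst p) v (fst (snd p)))"
    by (rule smooth_on_linear_family[OF op, where L = "\<lambda>p. g (fst p) v" and q = "\<lambda>p. fst (snd p)"])
      (use sub gr in \<open>auto intro!: smooth_on_intros op smooth_on_compose[OF op sub smooth fst]\<close>)
  show ?thesis
    unfolding ambient_system_def by (intro smooth_on_intros op 1 2)
qed

definition ambient_solution :: "real \<Rightarrow> real^'n \<Rightarrow> real \<Rightarrow> (real^'n \<Rightarrow> real^'n) \<Rightarrow> (real^'n \<Rightarrow> real) \<Rightarrow> bool"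
  where "ambient_solution \<kappa> x0 r V f \<longleftrightarrow> (\<forall>x\<in>ball x0 r.
    (V has_derivative (\<lambda>u. - \<Gamma> x u (V x) - (\<kappa> * f x) *\<^sub>R u)) (at x) \<and> (f has_derivative (\<lambda>u. g x u (V x))) (at x))"

lemma ambient_system_solutions:
  assumes \<kappa>: "has_curvature \<kappa>" and x0: "x0 \<in> S"
  obtains r where "r > 0" "ball x0 r \<subseteq> S"
    "\<And>y. \<exists>V f. V x0 = fst y \<and> f x0 = snd y \<and> smooth_on (ball x0 r) V \<and> ambient_solution \<kappa> x0 r V f"
proof (rule frobenius_linear_system[OF open_S x0, of "ambient_system \<kappa>"])
  fix x u v y assume x: "x \<in> S"
  show "linear (\<lambda>v. ambient_system \<kappa> x v y)" unfolding ambient_system_def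
    by (rule linearI) (simp_all add: linear_add[OF \<Gamma>_lin1[OF x]] linear_cmul[OF \<Gamma>_lin1[OF x]] g_left[OF x] algebra_simps)
  show "linear (ambient_system \<kappa> x v)" unfolding ambient_system_def[abs_def]
    by (rule linearI) (simp_all add: linear_add[OF \<Gamma>_lin2[OF x]] linear_cmul[OF \<Gamma>_lin2[OF x]] g_right[OF x] algebra_simps)
  show "dirderiv (\<lambda>z. ambient_system \<kappa> z v y) x u + ambient_system \<kappa> x v (ambient_system \<kappa> x u y) =
    dirderiv (\<lambda>z. ambient_system \<kappa> z u y) x v + ambient_system \<kappa> x u (ambient_system \<kappa> x v y)"
    by (rule ambient_system_integrable[OF \<kappa> x])
next
  fix v y
  show "smooth_on S (\<lambda>x. ambient_system \<kappa> x v y)"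
    unfolding ambient_system_def by (intro smooth_on_intros open_S \<Gamma>_smooth smooth)
next
  fix r assume r: "r > 0" "ball x0 r \<subseteq> S"
    and sol: "\<And>y. \<exists>Y. Y x0 = y \<and> (\<forall>x\<in>ball x0 r. (Y has_derivative (\<lambda>u. ambient_system \<kappa> x u (Y x))) (at x))"
  show thesis
  proof (rule that[OF r])
    fix y
    obtain Y where Y: "Y x0 = y" "\<And>x. x \<in> ball x0 r \<Longrightarrow> (Y has_derivative (\<lambda>u. ambient_system \<kappa> x u (Y x))) (at x)"
      using sol by metis
    \<comment> \<open>The solution is so far merely differentiable. It is bootstrapped with the
      right-hand side regarded as a smooth function of point and value together.\<close>
    have "smooth_on (ball x0 r) Y"
      by (rule smooth_on_total_differential_equation[where T = "ball x0 r \<times> UNIV" and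
            H = "\<lambda>v p. ambient_system \<kappa> (fst p) v (snd p)"])
        (use Y(2) smooth_on_ambient_system[OF open_ball r(2)] in auto)
    then have "smooth_on (ball x0 r) (\<lambda>x. fst (Y x))" by (intro smooth_on_fst open_ball)
    moreover have "((\<lambda>x. fst (Y x)) has_derivative (\<lambda>u. - \<Gamma> x u (fst (Y x)) - (\<kappa> * snd (Y x)) *\<^sub>R u)) (at x)"
      "((\<lambda>x. snd (Y x)) has_derivative (\<lambda>u. g x u (fst (Y x)))) (at x)" if "x \<in> ball x0 r" for x
      using has_derivative_fst[OF Y(2)[OF that]] has_derivative_snd[OF Y(2)[OF that]]
      by (simp_all add: ambient_system_def)
    ultimately show "\<exists>V f. V x0 = fst y \<and> f x0 = snd y \<and> smooth_on (ball x0 r) V \<and> ambient_solution \<kappa> x0 r V f"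
      unfolding ambient_solution_def using Y(1) by (intro exI[of _ "\<lambda>x. fst (Y x)"] exI[of _ "\<lambda>x. snd (Y x)"]) auto
  qed
qed

text \<open>The covariant product rule absorbs \<open>\<Gamma>\<close>, and the remaining terms
  \<open>\<kappa> * f x * g x h (V' x)\<close> and their mirror images cancel. The ball is convex,
  so a vanishing derivative gives a constant.\<close>

lemma ambient_form_constant:
  assumes "ball x0 r \<subseteq> S"
    and sol: "ambient_solution \<kappa> x0 r V f" "ambient_solution \<kappa> x0 r V' f'"
    and x: "x \<in> ball x0 r"
  shows "g x (V x) (V' x) + \<kappa> * f x * f' x = g x0 (V x0) (V' x0) + \<kappa> * f x0 * f' x0"
proof -
  have "((\<lambda>x. g x (V x) (V' x) + \<kappa> * f x * f' x) has_derivative (\<lambda>h. 0)) (at x within ball x0 r)"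
    if x: "x \<in> ball x0 r" for x
  proof -
    have xS: "x \<in> S" using x assms(1) by blast
    note sol[unfolded ambient_solution_def, rule_format, OF x]
    then have "((\<lambda>x. g x (V x) (V' x) + \<kappa> * f x * f' x) has_derivative
      (\<lambda>h. (g x (- \<Gamma> x h (V x) - (\<kappa> * f x) *\<^sub>R h + \<Gamma> x h (V x)) (V' x) +
        g x (V x) (- \<Gamma> x h (V' x) - (\<kappa> * f' x) *\<^sub>R h + \<Gamma> x h (V' x))) +
        (\<kappa> * f x * g x h (V' x) + (\<kappa> * g x h (V x)) * f' x))) (at x)"
      by (intro has_derivative_add has_derivative_g_fields[OF xS] has_derivative_mult
          has_derivative_mult_right) simp_all
    then have "((\<lambda>x. g x (V x) (V' x) + \<kappa> * f x * f' x) has_derivative (\<lambda>h. 0)) (at x)"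
      by (rule has_derivative_eq_rhs) (auto simp: g_left[OF xS] g_right[OF xS] g_sym[OF xS, of "V x"] fun_eq_iff)
    then show ?thesis by (rule has_derivative_at_withinI)
  qed
  then obtain c where "\<And>x. x \<in> ball x0 r \<Longrightarrow> g x (V x) (V' x) + \<kappa> * f x * f' x = c"
    using has_derivative_zero_constant[OF convex_ball, of x0 r "\<lambda>x. g x (V x) (V' x) + \<kappa> * f x * f' x"] by blast
  moreover have "x0 \<in> ball x0 r" using x by (metis centre_in_ball mem_ball zero_le_dist le_less_trans)
  ultimately show ?thesis using x by metis
qed

text \<open>Each basis vector \<open>b\<close> of the target receives the solution with initial
  value \<open>e b\<close>, and its function becomes the component of \<open>\<phi>\<close> along
  \<open>b\<close>. The constant form carries the Gram matrix of the initial values to every point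
  of the ball.\<close>

lemma developing_map:
  fixes e :: "'f::euclidean_space \<Rightarrow> (real^'n) \<times> real"
  assumes \<kappa>: "has_curvature \<kappa>" and x0: "x0 \<in> S"
  obtains r \<phi> V where "r > 0" "ball x0 r \<subseteq> S" "\<And>b. smooth_on (ball x0 r) (V b)"
    "\<And>x. x \<in> ball x0 r \<Longrightarrow> (\<phi> has_derivative (\<lambda>u. \<Sum>b\<in>Basis. g x u (V b x) *\<^sub>R b)) (at x)"
    "\<And>x b b'. x \<in> ball x0 r \<Longrightarrow> b \<in> Basis \<Longrightarrow> b' \<in> Basis \<Longrightarrow>
      g x (V b x) (V b' x) + \<kappa> * (\<phi> x \<bullet> b) * (\<phi> x \<bullet> b') =
      g x0 (fst (e b)) (fst (e b')) + \<kappa> * snd (e b) * snd (e b')"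
proof (rule ambient_system_solutions[OF \<kappa> x0])
  fix r assume r: "r > 0" "ball x0 r \<subseteq> S" and
    sol': "\<And>y. \<exists>V f. V x0 = fst y \<and> f x0 = snd y \<and> smooth_on (ball x0 r) V \<and> ambient_solution \<kappa> x0 r V f"
  define P where "P y p \<longleftrightarrow> fst p x0 = fst y \<and> snd p x0 = snd y \<and> smooth_on (ball x0 r) (fst p) \<and>
      ambient_solution \<kappa> x0 r (fst p) (snd p)"
    for p :: "(real^'n \<Rightarrow> real^'n) \<times> (real^'n \<Rightarrow> real)" and y :: "(real^'n) \<times> real"
  have sol: "\<exists>p. P y p" for y using sol'[of y] by (simp add: P_def)
  define F where "F b = (SOME p. P (e b) p)" for b
  define V f where "V b = fst (F b)" and "f b = snd (F b)" for b
  have "P (e b) (F b)" for b unfolding F_def by (rule someI_ex[OF sol])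
  then have V0: "\<And>b. V b x0 = fst (e b)" and f0: "\<And>b. f b x0 = snd (e b)"
    and sm: "\<And>b. smooth_on (ball x0 r) (V b)" and Vf: "\<And>b. ambient_solution \<kappa> x0 r (V b) (f b)"
    unfolding V_def f_def P_def by blast+
  define \<phi> where "\<phi> x = (\<Sum>b\<in>Basis. f b x *\<^sub>R b)" for x
  have \<phi>: "\<phi> x \<bullet> b = f b x" if "b \<in> Basis" for x b using that by (simp add: \<phi>_def)
  show thesis
  proof (rule that[OF r sm])
    show "(\<phi> has_derivative (\<lambda>u. \<Sum>b\<in>Basis. g x u (V b x) *\<^sub>R b)) (at x)" if "x \<in> ball x0 r" for x
      unfolding \<phi>_def[abs_def] using Vf that
      by (intro has_derivative_sum has_derivative_scaleR_left) (simp add: ambient_solution_def)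
    fix x and b b' :: 'f assume "x \<in> ball x0 r" and b: "b \<in> Basis" "b' \<in> Basis"
    then show "g x (V b x) (V b' x) + \<kappa> * (\<phi> x \<bullet> b) * (\<phi> x \<bullet> b') =
      g x0 (fst (e b)) (fst (e b')) + \<kappa> * snd (e b) * snd (e b')"
      using ambient_form_constant[OF r(2) Vf[of b] Vf[of b'], of x] by (simp add: \<phi> V0 f0)
  qed
qed

text \<open>The vector fields \<open>V b\<close> are dual to the components of the differential of \<open>\<phi>\<close>, so \<open>\<phi>\<close> is isometric.\<close>

definition developing :: "real^'n \<Rightarrow> real \<Rightarrow> (real^'n \<Rightarrow> 'f::euclidean_space) \<Rightarrow> ('f \<Rightarrow> real^'n \<Rightarrow> real^'n) \<Rightarrow> bool"
  where "developing x0 r \<phi> V \<longleftrightarrow> r > 0 \<and> ball x0 r \<subseteq> S \<and> (\<forall>b. smooth_on (ball x0 r) (V b)) \<and>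
    (\<forall>x\<in>ball x0 r. (\<phi> has_derivative (\<lambda>u. \<Sum>b\<in>Basis. g x u (V b x) *\<^sub>R b)) (at x) \<and>
      (\<forall>u. (\<Sum>b\<in>Basis. g x u (V b x) *\<^sub>R V b x) = u))"

lemma orthonormal_frame:
  fixes Q :: "'a::euclidean_space \<Rightarrow> 'a \<Rightarrow> real"
  assumes "inner_form Q"
  shows "\<exists>e :: 'a \<Rightarrow> 'a. \<forall>b\<in>Basis. \<forall>b'\<in>Basis. Q (e b) (e b') = (if b = b' then 1 else 0)"
proof -
  interpret inner_form Q by fact
  obtain C where C: "finite C" "orthonormal C" "card C = DIM('a)"
    by (rule orthonormal_basis_extension[of "{}"]) (auto simp: orthonormal_def)
  then obtain e where e: "bij_betw e (Basis :: 'a set) C"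
    using finite_same_card_bij[OF finite_Basis, of C] by auto
  show ?thesis
    by (rule exI[of _ e]) (use C(2) e bij_betw_apply[OF e] in \<open>auto simp: orthonormal_def bij_betw_def inj_on_eq_iff\<close>)
qed

text \<open>For \<open>\<kappa> = 0\<close> the constant form involves only the vector parts, which
  are parallel fields. An orthonormal frame at \<open>x0\<close> therefore stays orthonormal, and
  the functions may start at 0.\<close>

lemma developing_map_flat:
  assumes \<kappa>: "has_curvature 0" and x0: "x0 \<in> S"
  obtains r and \<phi> :: "real^'n \<Rightarrow> real^'n" and V where "developing x0 r \<phi> V"
proof -
  obtain e :: "real^'n \<Rightarrow> real^'n"
    where e: "\<forall>b\<in>Basis. \<forall>b'\<in>Basis. g x0 (e b) (e b') = (if b = b' then 1 else 0)"
    using orthonormal_frame[OF inner[OF x0]] by blast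
  show thesis
  proof (rule developing_map[OF \<kappa> x0, of "\<lambda>b :: real^'n. (e b, 0)"])
    fix r and \<phi> :: "real^'n \<Rightarrow> real^'n" and V
    assume *: "r > 0" "ball x0 r \<subseteq> S" "\<And>b. smooth_on (ball x0 r) (V b)"
      "\<And>x. x \<in> ball x0 r \<Longrightarrow> (\<phi> has_derivative (\<lambda>u. \<Sum>b\<in>Basis. g x u (V b x) *\<^sub>R b)) (at x)"
      and on: "\<And>x b b'. x \<in> ball x0 r \<Longrightarrow> b \<in> Basis \<Longrightarrow> b' \<in> Basis \<Longrightarrow>
        g x (V b x) (V b' x) + 0 * (\<phi> x \<bullet> b) * (\<phi> x \<bullet> b') =
        g x0 (fst (e b, 0::real)) (fst (e b', 0::real)) + 0 * snd (e b, 0::real) * snd (e b', 0::real)"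
    have "(\<Sum>b\<in>Basis. g x u (V b x) *\<^sub>R V b x) = u" if x: "x \<in> ball x0 r" for x u
    proof -
      have "x \<in> S" using x *(2) by blast
      then interpret inner_form "g x" by (rule inner)
      show ?thesis by (rule orthonormal_expansion) (use on[OF x] e in auto)
    qed
    then have "developing x0 r \<phi> V" using * by (simp add: developing_def)
    then show thesis by (rule that)
  qed
qed

text \<open>For \<open>\<kappa> > 0\<close> the constant form is an inner product on pairs of a
  vector and a number, so one more solution than the dimension is needed and all stay orthonormal.
  Expanding \<open>(u, 0)\<close> yields the duality of the fields, and expanding
  \<open>(0, 1)\<close> places the image on the sphere of radius
  \<open>1 / sqrt \<kappa>\<close>.\<close>

lemma developing_map_sphere:
  assumes \<kappa>: "has_curvature \<kappa>" "\<kappa> > 0" and x0: "x0 \<in> S"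
  obtains r and \<phi> :: "real^'n \<Rightarrow> (real^'n) \<times> real" and V
  where "developing x0 r \<phi> V" "\<And>x. x \<in> ball x0 r \<Longrightarrow> \<kappa> * (norm (\<phi> x))\<^sup>2 = 1"
proof -
  define Q where "Q x y y' = g x (fst y) (fst y') + \<kappa> * snd y * snd y'"
    for x and y y' :: "(real^'n) \<times> real"
  have Q: "inner_form (Q x)" if "x \<in> S" for x
  proof (rule inner_form.intro)
    fix u v :: "(real^'n) \<times> real"
    interpret inner_form "g x" by (rule inner[OF that])
    show "linear (\<lambda>u. Q x u v)"
      unfolding Q_def by (rule linearI) (auto simp: left_simps algebra_simps)
    show "Q x u v = Q x v u" using sym[of "fst u" "fst v"] by (simp add: Q_def)
    assume "u \<noteq> 0"
    have "g x w w \<ge> 0" for w using pos[of w] eq_0_iff[of w] by (cases "w = 0") auto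
    moreover have "g x (fst u) (fst u) > 0 \<or> snd u \<noteq> 0" using pos[of "fst u"] \<open>u \<noteq> 0\<close> by (cases u) (auto simp: zero_prod_def)
    ultimately show "Q x u u > 0"
      using \<kappa>(2) mult_pos_pos[OF \<kappa>(2), of "snd u * snd u"] unfolding Q_def
      by (auto simp: mult.assoc intro: add_pos_nonneg add_nonneg_pos simp flip: not_real_square_gt_zero)
  qed
  obtain e :: "(real^'n) \<times> real \<Rightarrow> (real^'n) \<times> real"
    where e: "\<forall>b\<in>Basis. \<forall>b'\<in>Basis. Q x0 (e b) (e b') = (if b = b' then 1 else 0)"
    using orthonormal_frame[OF Q[OF x0]] by blast
  show thesis
  proof (rule developing_map[OF \<kappa>(1) x0, of e])
    fix r and \<phi> :: "real^'n \<Rightarrow> (real^'n) \<times> real" and V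
    assume *: "r > 0" "ball x0 r \<subseteq> S" "\<And>b. smooth_on (ball x0 r) (V b)"
      "\<And>x. x \<in> ball x0 r \<Longrightarrow> (\<phi> has_derivative (\<lambda>u. \<Sum>b\<in>Basis. g x u (V b x) *\<^sub>R b)) (at x)"
      and on: "\<And>x b b'. x \<in> ball x0 r \<Longrightarrow> b \<in> Basis \<Longrightarrow> b' \<in> Basis \<Longrightarrow>
        g x (V b x) (V b' x) + \<kappa> * (\<phi> x \<bullet> b) * (\<phi> x \<bullet> b') =
        g x0 (fst (e b)) (fst (e b')) + \<kappa> * snd (e b) * snd (e b')"
    have expand: "(\<Sum>b\<in>Basis. Q x y (V b x, \<phi> x \<bullet> b) *\<^sub>R (V b x, \<phi> x \<bullet> b)) = y" if x: "x \<in> ball x0 r" for x y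
    proof -
      have "x \<in> S" using x *(2) by blast
      then interpret inner_form "Q x" by (rule Q)
      show ?thesis
        by (rule orthonormal_expansion) (use on[OF x] e in \<open>auto simp: Q_def\<close>)
    qed
    have "(\<Sum>b\<in>Basis. g x u (V b x) *\<^sub>R V b x) = u" if "x \<in> ball x0 r" for x u
      using arg_cong[OF expand[OF that, of "(u, 0)"], of fst] by (simp add: Q_def fst_sum)
    then have "developing x0 r \<phi> V" using * by (simp add: developing_def)
    then show thesis
    proof (rule that)
      fix x assume x: "x \<in> ball x0 r"
      then have xS: "x \<in> S" using *(2) by blast
      have "(\<Sum>b\<in>Basis. \<kappa> * (\<phi> x \<bullet> b) * (\<phi> x \<bullet> b)) = 1"
        using arg_cong[OF expand[OF x, of "(0, 1)"], of snd] by (simp add: Q_def snd_sum g_left[OF xS])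
      then show "\<kappa> * (norm (\<phi> x))\<^sup>2 = 1"
        by (simp only: power2_norm_eq_inner euclidean_inner[of "\<phi> x" "\<phi> x"] sum_distrib_left mult.assoc)
    qed
  qed
qed

text \<open>The target of \<open>\<phi>\<close> may have larger dimension than its source, so
  \<open>\<phi>\<close> is composed with a chart \<open>\<sigma>\<close> of the model space,
  inverted on the image of \<open>\<phi>\<close> by the parametrisation \<open>s\<close>. This
  treats Euclidean space and the sphere alike.\<close>

lemma local_isometry_chart:
  fixes \<phi> :: "real^'n \<Rightarrow> 'f::euclidean_space" and s :: "real^'n \<Rightarrow> 'f" and \<sigma> :: "'f \<Rightarrow> real^'n"
  assumes dev: "developing x0 r \<phi> V" and T: "open T" "\<phi> x0 \<in> T" and \<sigma>: "smooth_on T \<sigma>" and s: "smooth_on UNIV s"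
    and inverse: "\<And>x. x \<in> ball x0 r \<Longrightarrow> \<phi> x \<in> T \<Longrightarrow> s (\<sigma> (\<phi> x)) = \<phi> x"
  obtains U' V' \<psi> G where "open U'" "x0 \<in> U'" "U' \<subseteq> S" "open V'" "homeomorphism U' V' \<psi> G"
    "smooth_on U' \<psi>" "smooth_on V' G"
    "\<And>x u v. x \<in> U' \<Longrightarrow>
      dirderiv s (\<psi> x) (dirderiv \<psi> x u) \<bullet> dirderiv s (\<psi> x) (dirderiv \<psi> x v) = g x u v"
proof -
  have r: "r > 0" "ball x0 r \<subseteq> S" and V: "\<And>b. smooth_on (ball x0 r) (V b)"
    and \<phi>: "\<And>x. x \<in> ball x0 r \<Longrightarrow> (\<phi> has_derivative (\<lambda>u. \<Sum>b\<in>Basis. g x u (V b x) *\<^sub>R b)) (at x)"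
    and expand: "\<And>x u. x \<in> ball x0 r \<Longrightarrow> (\<Sum>b\<in>Basis. g x u (V b x) *\<^sub>R V b x) = u"
    using dev unfolding developing_def by blast+
  have \<phi>_smooth: "smooth_on (ball x0 r) \<phi>"
  proof (rule smooth_on_has_derivativeI[OF open_ball \<phi>])
    have "smooth_on (ball x0 r) (\<lambda>x. g x u (V b x))" for u b
      by (rule smooth_on_linear_family[OF open_ball, where L = "\<lambda>x. g x u"])
        (use r(2) gr V smooth_on_subset[OF smooth r(2)] in auto)
    then show "smooth_on (ball x0 r) (\<lambda>x. \<Sum>b\<in>Basis. g x u (V b x) *\<^sub>R b)" for u
      by (intro smooth_on_sum smooth_on_scaleR smooth_on_const open_ball)
  qed
  define B where "B = ball x0 r \<inter> \<phi> -` T"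
  have B: "open B" "x0 \<in> B" "B \<subseteq> ball x0 r"
    using continuous_open_preimage[OF smooth_on_imp_continuous_on[OF \<phi>_smooth] open_ball T(1)] T(2) r(1)
    by (auto simp: B_def)
  define \<psi> where "\<psi> = (\<lambda>x. \<sigma> (\<phi> x))"
  have \<psi>: "smooth_on B \<psi>" unfolding \<psi>_def
    by (rule smooth_on_compose[OF B(1) _ \<sigma> smooth_on_subset[OF \<phi>_smooth B(3)]]) (auto simp: B_def)
  have \<psi>_deriv: "(\<psi> has_derivative dirderiv \<psi> x) (at x)" if "x \<in> B" for x
    using smooth_on_has_derivative[OF \<psi> that] .
  have chain: "dirderiv s (\<psi> x) (dirderiv \<psi> x u) = (\<Sum>b\<in>Basis. g x u (V b x) *\<^sub>R b)" if x: "x \<in> B" for x u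
  proof -
    have "((\<lambda>x. s (\<psi> x)) has_derivative (\<lambda>u. dirderiv s (\<psi> x) (dirderiv \<psi> x u))) (at x)"
      by (rule has_derivative_compose[OF \<psi>_deriv[OF x] smooth_on_has_derivative[OF s UNIV_I]])
    moreover have "\<phi> y = s (\<psi> y)" if "y \<in> B" for y using that inverse by (auto simp: \<psi>_def B_def)
    ultimately have "dirderiv \<phi> x = (\<lambda>u. dirderiv s (\<psi> x) (dirderiv \<psi> x u))"
      by (rule has_derivative_eq_dirderiv[OF B(1) x, rotated])
    moreover have "dirderiv \<phi> x = (\<lambda>u. \<Sum>b\<in>Basis. g x u (V b x) *\<^sub>R b)"
      using dirderiv_eqI[OF \<phi>] x B(3) by blast
    ultimately show ?thesis by metis
  qed
  have s0: "dirderiv s y 0 = 0" for y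
    using linear_0[OF has_derivative_linear[OF smooth_on_has_derivative[OF s UNIV_I]]] .
  have coeff: "(\<Sum>b\<in>Basis. c b *\<^sub>R b) \<bullet> b = c b" if "b \<in> Basis" for c and b :: 'f
    using that by simp
  \<comment> \<open>The dual fields reconstruct a tangent vector from its image. This yields
    injectivity of the derivative now and a formula for the derivative of the inverse below.\<close>
  have recover: "(\<Sum>b\<in>Basis. (dirderiv s (\<psi> x) (dirderiv \<psi> x u) \<bullet> b) *\<^sub>R V b x) = u" if "x \<in> B" for x u
    using expand[of x u] that B(3) by (auto simp: chain coeff)
  have inj: "inj (dirderiv \<psi> x)" if x: "x \<in> B" for x
  proof -
    have "u = 0" if "dirderiv \<psi> x u = 0" for u using recover[OF x, of u] that s0 by simp
    then show ?thesis using linear_injective_0[OF has_derivative_linear[OF \<psi>_deriv[OF x]]] by blast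
  qed
  let ?D = "\<lambda>x. Blinfun (dirderiv \<psi> x)"
  have D: "blinfun_apply (?D x) = dirderiv \<psi> x" if "x \<in> B" for x
    using has_derivative_bounded_linear[OF \<psi>_deriv[OF that]] by (rule bounded_linear_Blinfun_apply)
  have contD: "continuous_on B ?D"
  proof (rule continuous_on_blinfun_componentwise)
    fix i :: "real^'n"
    show "continuous_on B (\<lambda>x. blinfun_apply (?D x) i)"
      by (rule continuous_on_eq[OF smooth_on_imp_continuous_on[OF smooth_on_dirderiv[OF \<psi>, of i]]]) (simp add: D)
  qed
  obtain L where L: "linear L" "L \<circ> dirderiv \<psi> x0 = id"
    using linear_injective_left_inverse[OF has_derivative_linear[OF \<psi>_deriv[OF B(2)]] inj[OF B(2)]] by blast
  have linv: "Blinfun L o\<^sub>L ?D x0 = id_blinfun"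
  proof (rule blinfun_eqI)
    fix i
    show "blinfun_apply (Blinfun L o\<^sub>L ?D x0) i = blinfun_apply id_blinfun i"
      using fun_cong[OF L(2), of i] linear_conv_bounded_linear[of L] L(1)
      by (simp add: D[OF B(2)] bounded_linear_Blinfun_apply)
  qed
  have D_deriv: "(\<psi> has_derivative blinfun_apply (?D x)) (at x)" if "x \<in> B" for x
    using \<psi>_deriv D that by simp
  obtain U' V' G G' where UV: "open U'" "U' \<subseteq> B" "x0 \<in> U'" "open V'" "homeomorphism U' V' \<psi> G"
    and G: "\<And>y. y \<in> V' \<Longrightarrow> (G has_derivative (G' y)) (at y)"
      "\<And>y. y \<in> V' \<Longrightarrow> G' y = inv (blinfun_apply (?D (G y)))"
      "\<And>y. y \<in> V' \<Longrightarrow> bij (blinfun_apply (?D (G y)))"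
    by (rule inverse_function_theorem[of B \<psi> ?D x0 "Blinfun L", OF B(1) D_deriv contD B(2) linv], assumption)
      (rule that; assumption)
  have GU: "G y \<in> U'" "\<psi> (G y) = y" if "y \<in> V'" for y
    using UV(5) that by (auto simp: homeomorphism_def)
  \<comment> \<open>Here the derivative of \<open>G\<close> depends smoothly on \<open>y\<close> and
    \<open>G y\<close> alone, which is the form required for bootstrapping.\<close>
  have "(G has_derivative (\<lambda>w. \<Sum>b\<in>Basis. (dirderiv s y w \<bullet> b) *\<^sub>R V b (G y))) (at y)" if y: "y \<in> V'" for y
  proof -
    have GB: "G y \<in> B" using GU[OF y] UV(2) by blast
    have "dirderiv \<psi> (G y) (G' y w) = w" for w
      using G(2,3)[OF y] D[OF GB] by (metis bij_is_surj surj_f_inv_f)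
    then have "G' y = (\<lambda>w. \<Sum>b\<in>Basis. (dirderiv s y w \<bullet> b) *\<^sub>R V b (G y))"
      using recover[OF GB] GU(2)[OF y] by metis
    then show ?thesis using G(1)[OF y] by simp
  qed
  moreover have "smooth_on (V' \<times> U') (\<lambda>p. \<Sum>b\<in>Basis. (dirderiv s (fst p) w \<bullet> b) *\<^sub>R V b (snd p))" for w
  proof -
    have op: "open (V' \<times> U')" using UV by (simp add: open_Times)
    have 1: "smooth_on (V' \<times> U') (\<lambda>p. dirderiv s (fst p) w)"
      by (rule smooth_on_compose[OF op subset_UNIV smooth_on_dirderiv[OF s]]) (intro smooth_on_intros op)
    have 2: "smooth_on (V' \<times> U') (\<lambda>p. V b (snd p))" for b
      by (rule smooth_on_compose[OF op _ V]) (use UV B in \<open>auto intro!: smooth_on_intros op\<close>)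
    show ?thesis by (intro smooth_on_intros op 1 2)
  qed
  ultimately have "smooth_on V' G"
    using GU by (intro smooth_on_total_differential_equation[OF UV(4), of G "V' \<times> U'"
      "\<lambda>w p. \<Sum>b\<in>Basis. (dirderiv s (fst p) w \<bullet> b) *\<^sub>R V b (snd p)"]) auto
  moreover have "dirderiv s (\<psi> x) (dirderiv \<psi> x u) \<bullet> dirderiv s (\<psi> x) (dirderiv \<psi> x v) = g x u v"
    if "x \<in> U'" for x u v
  proof -
    have x: "x \<in> B" "x \<in> ball x0 r" "x \<in> S" using that UV(2) B(3) r(2) by auto
    \<comment> \<open>Parseval's identity: pairing \<open>u\<close> with the dual expansion of
      \<open>v\<close> gives the Euclidean product of the two images.\<close>
    have "g x u v = (\<Sum>b\<in>Basis. g x u (V b x) * g x v (V b x))"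
      using arg_cong[OF expand[OF x(2), of v], of "g x u"]
      by (simp add: g_right[OF x(3)] mult.commute)
    also have "\<dots> = dirderiv s (\<psi> x) (dirderiv \<psi> x u) \<bullet> dirderiv s (\<psi> x) (dirderiv \<psi> x v)"
      by (subst euclidean_inner) (simp add: chain[OF x(1)] coeff)
    finally show ?thesis by simp
  qed
  ultimately show thesis
    using that[of U' V' \<psi> G] UV smooth_on_subset[OF \<psi> UV(2)] B(3) r(2) by blast
qed

end

section \<open>Manifolds in charts\<close>

context
  fixes M :: "('m, 'e::euclidean_space) mfd" and c :: "('m, 'e) chart"
  assumes M: "smooth_manifold M" and c: "c \<in> atlas M"
begin

lemma chart_openin: "openin (top_of M) (chart_dom c)"
  and chart_open_img: "open (chart_img c)"
  and chart_homeomorphic: "homeomorphic_map (subtopology (top_of M) (chart_dom c)) (top_of_set (chart_img c)) (coord c)"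
  using M c unfolding smooth_manifold_def by blast+

lemma chart_dom_subset: "chart_dom c \<subseteq> points M"
  by (rule openin_subset[OF chart_openin])

lemma chart_inj: "inj_on (coord c) (chart_dom c)"
  using homeomorphic_imp_injective_map[OF chart_homeomorphic] chart_dom_subset
  by (simp add: topspace_subtopology inf.absorb2)

lemma param_coord: "p \<in> chart_dom c \<Longrightarrow> param c (coord c p) = p"
  unfolding param_def by (rule inv_into_f_f[OF chart_inj])

lemma coord_param: "x \<in> chart_img c \<Longrightarrow> coord c (param c x) = x"
  unfolding param_def by (rule f_inv_into_f)

lemma param_in_dom: "x \<in> chart_img c \<Longrightarrow> param c x \<in> chart_dom c"
  unfolding param_def by (rule inv_into_into)

lemma open_coord_image:
  assumes "openin (top_of M) U" "U \<subseteq> chart_dom c"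
  shows "open (coord c ` U)"
proof -
  have "openin (subtopology (top_of M) (chart_dom c)) U"
    using assms by (auto simp: openin_subtopology intro!: exI[of _ U])
  then have "openin (top_of_set (chart_img c)) (coord c ` U)"
    using homeomorphic_imp_open_map[OF chart_homeomorphic] by (simp add: open_map_def)
  then show ?thesis using chart_open_img openin_open_trans by blast
qed

lemma param_image:
  assumes "X \<subseteq> chart_img c"
  shows "param c ` X = {p \<in> chart_dom c. coord c p \<in> X}"
  using assms coord_param param_in_dom param_coord by force

lemma openin_param_image:
  assumes "open X" "X \<subseteq> chart_img c"
  shows "openin (top_of M) (param c ` X)"
proof -
  have "continuous_map (subtopology (top_of M) (chart_dom c)) euclidean (coord c)"
    using homeomorphic_imp_continuous_map[OF chart_homeomorphic] continuous_map_in_subtopology by blast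
  then have "openin (subtopology (top_of M) (chart_dom c)) {p \<in> chart_dom c. coord c p \<in> X}"
    using openin_continuous_map_preimage[of "subtopology (top_of M) (chart_dom c)" euclidean "coord c" X]
      assms(1) chart_dom_subset
    by (simp add: topspace_subtopology inf.absorb2)
  then show ?thesis
    unfolding param_image[OF assms(2)] by (rule openin_trans_full[OF _ chart_openin])
qed

lemma continuous_map_param:
  "continuous_map (top_of_set (chart_img c)) (top_of M) (param c)"
proof -
  obtain g where g: "homeomorphic_maps (subtopology (top_of M) (chart_dom c)) (top_of_set (chart_img c)) (coord c) g"
    using chart_homeomorphic homeomorphic_map_maps by blast
  have "g x = param c x" if "x \<in> chart_img c" for x
  proof -
    have "coord c (g x) = x" "g x \<in> chart_dom c"
      using g that unfolding homeomorphic_maps_def continuous_map_def by auto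
    then show ?thesis using param_coord by metis
  qed
  moreover have "continuous_map (top_of_set (chart_img c)) (top_of M) g"
    using g unfolding homeomorphic_maps_def by (meson continuous_map_in_subtopology)
  ultimately show ?thesis by (auto intro: continuous_map_eq)
qed

lemma overlap_image: "openin (top_of M) U \<Longrightarrow> open (coord c ` (chart_dom c \<inter> U))"
  by (rule open_coord_image) (use chart_openin in auto)

lemma transition_coord: "p \<in> chart_dom c \<Longrightarrow> transition c d (coord c p) = coord d p"
  by (simp add: transition_def param_coord)

lemma transition_self:
  assumes "p \<in> chart_dom c"
  shows "dirderiv (transition c c) (coord c p) = (\<lambda>v. v)"
proof (rule has_derivative_eq_dirderiv[OF chart_open_img])
  show "transition c c x = x" if "x \<in> chart_img c" for x
    using that by (simp add: transition_def coord_param)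
qed (use assms in auto)

end

lemma transition_smooth:
  assumes "smooth_manifold M" "c \<in> atlas M" "d \<in> atlas M"
  shows "smooth_on (coord c ` (chart_dom c \<inter> chart_dom d)) (transition c d)"
  using assms unfolding smooth_manifold_def by blast

lemma transition_deriv:
  assumes "smooth_manifold M" "c \<in> atlas M" "d \<in> atlas M" "p \<in> chart_dom c" "p \<in> chart_dom d"
  shows "(transition c d has_derivative dirderiv (transition c d) (coord c p)) (at (coord c p))"
  by (rule smooth_on_has_derivative[OF transition_smooth[OF assms(1-3)]]) (use assms in auto)

text \<open>The chain rule on the triple overlap, which is open. It makes the family built by
  \<open>tangent_of\<close> from a single coordinate vector compatible with all charts.\<close>

lemma transition_cocycle:
  assumes M: "smooth_manifold M" and c: "c \<in> atlas M" "d \<in> atlas M" "e \<in> atlas M"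
    and p: "p \<in> chart_dom c" "p \<in> chart_dom d" "p \<in> chart_dom e"
  shows "dirderiv (transition c e) (coord c p) v =
    dirderiv (transition d e) (coord d p) (dirderiv (transition c d) (coord c p) v)"
proof -
  let ?X = "coord c ` (chart_dom c \<inter> (chart_dom d \<inter> chart_dom e))"
  have "open ?X"
    by (rule overlap_image[OF M c(1) openin_Int]) (use chart_openin[OF M] c in auto)
  have "((\<lambda>x. transition d e (transition c d x)) has_derivative
      (\<lambda>v. dirderiv (transition d e) (coord d p) (dirderiv (transition c d) (coord c p) v))) (at (coord c p))"
    by (rule has_derivative_compose[OF transition_deriv[OF M c(1,2) p(1,2)]])
      (use transition_deriv[OF M c(2,3) p(2,3)] transition_coord[OF M c(1) p(1)] in simp)
  moreover have "transition c e x = transition d e (transition c d x)" if x: "x \<in> ?X" for x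
  proof -
    obtain q where "x = coord c q" "q \<in> chart_dom c" "q \<in> chart_dom d" using x by blast
    then show ?thesis using transition_coord[OF M c(1), of q] transition_coord[OF M c(2), of q] by metis
  qed
  moreover have "coord c p \<in> ?X" using p by blast
  ultimately have "dirderiv (transition c e) (coord c p) =
      (\<lambda>v. dirderiv (transition d e) (coord d p) (dirderiv (transition c d) (coord c p) v))"
    by (intro has_derivative_eq_dirderiv[OF \<open>open ?X\<close>])
  then show ?thesis by metis
qed

section \<open>Tangent vectors in coordinates\<close>

context
  fixes M :: "('m, 'e::euclidean_space) mfd" and c :: "('m, 'e) chart" and p
  assumes M: "smooth_manifold M" and c: "c \<in> atlas M" and p: "p \<in> chart_dom c"
begin

lemma tangent_of_mem: "tangent_of M p c \<xi> \<in> tangent_space M p"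
  unfolding tangent_space_def
proof (intro CollectI conjI allI ballI impI)
  fix d e assume "d \<in> atlas M" "e \<in> atlas M" "p \<in> chart_dom d \<inter> chart_dom e"
  then show "tangent_of M p c \<xi> e = dirderiv (transition d e) (coord d p) (tangent_of M p c \<xi> d)"
    using transition_cocycle[OF M c, of d e p \<xi>] p by (simp add: tangent_of_def)
qed (auto simp: tangent_of_def)

lemma tangent_of_self: "tangent_of M p c \<xi> c = \<xi>"
  using c p transition_self[OF M c p] by (simp add: tangent_of_def)

lemma tangent_of_coord:
  assumes "v \<in> tangent_space M p"
  shows "tangent_of M p c (v c) = v"
proof
  fix d
  show "tangent_of M p c (v c) d = v d"
  proof (cases "d \<in> atlas M \<and> p \<in> chart_dom d")
    case True
    then have "v d = dirderiv (transition c d) (coord c p) (v c)"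
      using assms c p unfolding tangent_space_def by blast
    with True show ?thesis by (simp add: tangent_of_def)
  next
    case False
    then have "v d = 0" using assms unfolding tangent_space_def by blast
    with False show ?thesis by (auto simp: tangent_of_def)
  qed
qed

lemma tangent_of_linear:
  "tangent_of M p c (r *\<^sub>R \<xi> + s *\<^sub>R \<eta>) =
    (\<lambda>d. r *\<^sub>R tangent_of M p c \<xi> d + s *\<^sub>R tangent_of M p c \<eta> d)"
proof
  fix d
  have "linear (dirderiv (transition c d) (coord c p))" if "d \<in> atlas M" "p \<in> chart_dom d"
    using has_derivative_linear[OF transition_deriv[OF M c that(1) p that(2)]] .
  then show "tangent_of M p c (r *\<^sub>R \<xi> + s *\<^sub>R \<eta>) d =
      r *\<^sub>R tangent_of M p c \<xi> d + s *\<^sub>R tangent_of M p c \<eta> d"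
    by (simp add: tangent_of_def linear_add linear_cmul)
qed

lemma tangent_of_0: "tangent_of M p c 0 = (\<lambda>d. 0)"
  using tangent_of_linear[of 0 0 0 0] by simp

lemma tangent_space_linear:
  assumes "u \<in> tangent_space M p" "v \<in> tangent_space M p"
  shows "(\<lambda>d. r *\<^sub>R u d + s *\<^sub>R v d) \<in> tangent_space M p"
  using tangent_of_mem[of "r *\<^sub>R u c + s *\<^sub>R v c"]
  by (simp add: tangent_of_linear tangent_of_coord assms)

lemma metric_rep_coord:
  assumes "u \<in> tangent_space M p" "v \<in> tangent_space M p"
  shows "metric_rep M h c (coord c p) (u c) (v c) = h p u v"
  using assms by (simp add: metric_rep_def param_coord[OF M c p] tangent_of_coord)

end

lemma chart_at:
  assumes "smooth_manifold M" "p \<in> points M"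
  shows "chart_at M p \<in> atlas M" "p \<in> chart_dom (chart_at M p)"
proof -
  have "\<exists>c. c \<in> atlas M \<and> p \<in> chart_dom c" using assms unfolding smooth_manifold_def by blast
  from someI_ex[OF this] show "chart_at M p \<in> atlas M" "p \<in> chart_dom (chart_at M p)"
    by (simp_all add: chart_at_def)
qed

lemma metric_rep_inner_form:
  assumes M: "riemannian_manifold M h" and c: "c \<in> atlas M" and x: "x \<in> chart_img c"
  shows "inner_form (metric_rep M h c x)"
proof (rule inner_form.intro)
  have sm: "smooth_manifold M" using M by (simp add: riemannian_manifold_def)
  let ?p = "param c x"
  note p = param_in_dom[OF sm c x]
  note mem = tangent_of_mem[OF sm c p]
  have "?p \<in> points M" using p chart_dom_subset[OF sm c] by blast
  then have ip: "inner_product_on_tangent_space M ?p (h ?p)" using M by (simp add: riemannian_manifold_def)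
  fix u v
  have comb: "metric_rep M h c x (r *\<^sub>R u + s *\<^sub>R w) v = r * metric_rep M h c x u v + s * metric_rep M h c x w v"
    for r s u w
    using ip mem unfolding metric_rep_def tangent_of_linear[OF sm c p] inner_product_on_tangent_space_def by blast
  show "linear (\<lambda>u. metric_rep M h c x u v)"
    using comb[of 1 _ 1] comb[of _ _ 0 0] by (intro linearI) simp_all
  show "metric_rep M h c x u v = metric_rep M h c x v u"
    using ip mem unfolding metric_rep_def inner_product_on_tangent_space_def by blast
  assume "u \<noteq> 0"
  then have "tangent_of M ?p c u \<noteq> (\<lambda>c. 0)" using tangent_of_self[OF sm c p, of u] by auto
  then show "metric_rep M h c x u u > 0"
    using ip mem unfolding metric_rep_def inner_product_on_tangent_space_def by blast
qed

lemma metric_rep_local_metric: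
  fixes M :: "('m, real^'n) mfd"
  assumes "riemannian_manifold M h" "c \<in> atlas M"
  shows "local_metric (chart_img c) (metric_rep M h c)"
  using assms metric_rep_inner_form[OF assms] chart_open_img[of M c]
  by (intro local_metric.intro) (auto simp: riemannian_manifold_def)

text \<open>\<open>smooth_map_on\<close> quantifies over all pairs of charts, and
  \<open>differential\<close> uses a chart chosen at the point. Inserting transitions before and
  after \<open>\<psi>\<close> reduces both to the one pair \<open>c\<close>,
  \<open>d\<close>.\<close>

lemma smooth_map_from_charts:
  fixes M :: "('m, 'e::euclidean_space) mfd" and N :: "('n, 'f::euclidean_space) mfd"
  assumes M: "smooth_manifold M" "c \<in> atlas M" and N: "smooth_manifold N" "d \<in> atlas N"
    and X: "open X" "X \<subseteq> chart_img c" and \<psi>: "smooth_on X \<psi>" "\<psi> ` X \<subseteq> chart_img d"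
    and f: "\<And>p. p \<in> param c ` X \<Longrightarrow> f p = param d (\<psi> (coord c p))"
  shows "smooth_map_on M N (param c ` X) f"
    and "p \<in> param c ` X \<Longrightarrow> u \<in> tangent_space M p \<Longrightarrow>
      differential M N f p u = tangent_of N (f p) d (dirderiv \<psi> (coord c p) (u c))"
proof -
  let ?U = "param c ` X"
  have U: "p \<in> ?U \<longleftrightarrow> p \<in> chart_dom c \<and> coord c p \<in> X" for p
    using param_image[OF M X(2)] by auto
  have openU: "openin (top_of M) ?U" by (rule openin_param_image[OF M X])
  have fU: "f p \<in> chart_dom d" "coord d (f p) = \<psi> (coord c p)" if "p \<in> ?U" for p
    using f[OF that] that \<psi>(2) U param_in_dom[OF N] coord_param[OF N] by auto
  have cont: "continuous_map (subtopology (top_of M) ?U) (top_of N) f"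
  proof (rule continuous_map_eq)
    have "continuous_map (subtopology (top_of M) (chart_dom c)) euclidean (coord c)"
      using homeomorphic_imp_continuous_map[OF chart_homeomorphic[OF M]] continuous_map_in_subtopology by blast
    then have "continuous_map (subtopology (top_of M) ?U) euclidean (coord c)"
      by (rule continuous_map_from_subtopology_mono) (use U in auto)
    then have 1: "continuous_map (subtopology (top_of M) ?U) (top_of_set X) (coord c)"
      by (simp add: continuous_map_in_subtopology) (use U in auto)
    have 2: "continuous_map (top_of_set X) (top_of_set (chart_img d)) \<psi>"
      using smooth_on_imp_continuous_on[OF \<psi>(1)] \<psi>(2) by (auto simp: continuous_map_in_subtopology)
    show "continuous_map (subtopology (top_of M) ?U) (top_of N) (param d \<circ> (\<psi> \<circ> coord c))"
      by (intro continuous_map_compose[OF continuous_map_compose[OF 1 2] continuous_map_param[OF N]])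
    show "(param d \<circ> (\<psi> \<circ> coord c)) p = f p" if "p \<in> topspace (subtopology (top_of M) ?U)" for p
      using f that by (auto simp: topspace_subtopology)
  qed
  have pre: "openin (top_of M) {p \<in> ?U. f p \<in> chart_dom d'}" if "d' \<in> atlas N" for d'
  proof -
    have "openin (subtopology (top_of M) ?U) {p \<in> topspace (subtopology (top_of M) ?U). f p \<in> chart_dom d'}"
      by (rule openin_continuous_map_preimage[OF cont chart_openin[OF N(1) that]])
    moreover have "topspace (subtopology (top_of M) ?U) = ?U"
      using openin_subset[OF openU] by (simp add: topspace_subtopology inf.absorb2)
    ultimately show ?thesis using openin_trans_full openU by metis
  qed
  let ?Z = "\<lambda>c' d'. coord c' ` (chart_dom c' \<inter> ?U \<inter> f -` chart_dom d')"
  have Zopen: "open (?Z c' d')" if "c' \<in> atlas M" "d' \<in> atlas N" for c' d'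
  proof -
    have "chart_dom c' \<inter> ?U \<inter> f -` chart_dom d' = chart_dom c' \<inter> {p \<in> ?U. f p \<in> chart_dom d'}" by auto
    then show ?thesis using overlap_image[OF M(1) that(1) pre[OF that(2)]] by simp
  qed
  have formula: "(coord d' \<circ> f \<circ> param c') x = transition d d' (\<psi> (transition c' c x))"
    if c': "c' \<in> atlas M" and "d' \<in> atlas N" and x: "x \<in> ?Z c' d'" for c' d' x
  proof -
    obtain p where p: "x = coord c' p" "p \<in> chart_dom c'" "p \<in> ?U" "f p \<in> chart_dom d'" using x by blast
    then show ?thesis
      using param_coord[OF M(1) c' p(2)] transition_coord[OF M(1) c' p(2)] f[OF p(3)]
      by (simp add: transition_def)
  qed
  show "smooth_map_on M N ?U f"
    unfolding smooth_map_on_def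
  proof (intro conjI ballI cont)
    fix c' d' assume c': "c' \<in> atlas M" and d': "d' \<in> atlas N"
    note Z = Zopen[OF c' d']
    have 1: "smooth_on (?Z c' d') (transition c' c)"
      by (rule smooth_on_subset[OF transition_smooth[OF M(1) c' M(2)]]) (use U in auto)
    have tc: "transition c' c (coord c' p) = coord c p" if "p \<in> chart_dom c'" for p
      by (rule transition_coord[OF M(1) c' that])
    have im: "transition c' c ` ?Z c' d' \<subseteq> X"
    proof (rule image_subsetI)
      fix x assume "x \<in> ?Z c' d'"
      then obtain p where "x = coord c' p" "p \<in> chart_dom c'" "p \<in> ?U" by blast
      then show "transition c' c x \<in> X" using U[of p] tc[of p] by simp
    qed
    have 2: "smooth_on (?Z c' d') (\<lambda>x. \<psi> (transition c' c x))"
      by (rule smooth_on_compose[OF Z im \<psi>(1) 1])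
    have im2: "(\<lambda>x. \<psi> (transition c' c x)) ` ?Z c' d' \<subseteq> coord d ` (chart_dom d \<inter> chart_dom d')"
    proof (rule image_subsetI)
      fix x assume "x \<in> ?Z c' d'"
      then obtain p where p: "x = coord c' p" "p \<in> chart_dom c'" "p \<in> ?U" "f p \<in> chart_dom d'" by blast
      then have "\<psi> (transition c' c x) = coord d (f p)" using tc[of p] fU(2)[of p] by simp
      then show "\<psi> (transition c' c x) \<in> coord d ` (chart_dom d \<inter> chart_dom d')"
        using p fU(1)[of p] by blast
    qed
    have "smooth_on (?Z c' d') (\<lambda>x. transition d d' (\<psi> (transition c' c x)))"
      by (rule smooth_on_compose[OF Z im2 transition_smooth[OF N d'] 2])
    then show "smooth_on (?Z c' d') (coord d' \<circ> f \<circ> param c')"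
      by (rule smooth_on_cong[OF Z, rotated]) (use formula[OF c' d'] in simp)
  qed
  show "differential M N f p u = tangent_of N (f p) d (dirderiv \<psi> (coord c p) (u c))"
    if p: "p \<in> ?U" and u: "u \<in> tangent_space M p"
  proof
    fix d'
    define c' where "c' = chart_at M p"
    have pM: "p \<in> points M" using p openin_subset[OF openU] by blast
    have c': "c' \<in> atlas M" "p \<in> chart_dom c'" using chart_at[OF M(1) pM] by (simp_all add: c'_def)
    have pc: "p \<in> chart_dom c" "coord c p \<in> X" using p U by auto
    show "differential M N f p u d' = tangent_of N (f p) d (dirderiv \<psi> (coord c p) (u c)) d'"
    proof (cases "d' \<in> atlas N \<and> f p \<in> chart_dom d'")
      case True
      have t1: "(transition c' c has_derivative dirderiv (transition c' c) (coord c' p)) (at (coord c' p))"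
        by (rule transition_deriv[OF M(1) c'(1) M(2) c'(2) pc(1)])
      have t2: "(\<psi> has_derivative dirderiv \<psi> (coord c p)) (at (transition c' c (coord c' p)))"
        using smooth_on_has_derivative[OF \<psi>(1) pc(2)] transition_coord[OF M(1) c', of c] by simp
      have t3: "(transition d d' has_derivative dirderiv (transition d d') (coord d (f p)))
          (at (\<psi> (transition c' c (coord c' p))))"
        using transition_deriv[OF N, of d' "f p"] True fU[OF p] transition_coord[OF M(1) c', of c] by simp
      have "((\<lambda>x. transition d d' (\<psi> (transition c' c x))) has_derivative
          (\<lambda>v. dirderiv (transition d d') (coord d (f p)) (dirderiv \<psi> (coord c p)
            (dirderiv (transition c' c) (coord c' p) v)))) (at (coord c' p))"
        by (rule has_derivative_compose[OF has_derivative_compose[OF t1 t2] t3])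
      moreover have d': "d' \<in> atlas N" using True by blast
      moreover have "(coord d' \<circ> f \<circ> param c') x = transition d d' (\<psi> (transition c' c x))"
        if "x \<in> ?Z c' d'" for x using c'(1) d' that by (rule formula)
      moreover have "coord c' p \<in> ?Z c' d'" using True c'(2) p by blast
      ultimately have "dirderiv (coord d' \<circ> f \<circ> param c') (coord c' p) =
          (\<lambda>v. dirderiv (transition d d') (coord d (f p)) (dirderiv \<psi> (coord c p)
            (dirderiv (transition c' c) (coord c' p) v)))"
        by (intro has_derivative_eq_dirderiv[OF Zopen[OF c'(1) d']])
      \<comment> \<open>The compatibility of the components of \<open>u\<close> removes the
        transition from the chosen chart \<open>c'\<close> to \<open>c\<close>.\<close>
      moreover have "u c = dirderiv (transition c' c) (coord c' p) (u c')"
        using u c' M(2) pc(1) unfolding tangent_space_def by blast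
      ultimately show ?thesis
        using True by (simp add: differential_def tangent_of_def c'_def[symmetric] Let_def)
    qed (auto simp: differential_def tangent_of_def)
  qed
qed

definition chart_isometry ::
  "('m, 'e::euclidean_space) mfd \<Rightarrow> ('m, 'e) metric \<Rightarrow> ('m, 'e) chart \<Rightarrow> 'e set \<Rightarrow>
   ('n, 'f::euclidean_space) mfd \<Rightarrow> ('n, 'f) metric \<Rightarrow> ('n, 'f) chart \<Rightarrow> 'f set \<Rightarrow> ('e \<Rightarrow> 'f) \<Rightarrow> ('f \<Rightarrow> 'e) \<Rightarrow> bool"
  where "chart_isometry M h c X N k d Y \<psi> G \<longleftrightarrow> open X \<and> X \<subseteq> chart_img c \<and> open Y \<and> Y \<subseteq> chart_img d \<and>
    homeomorphism X Y \<psi> G \<and> smooth_on X \<psi> \<and> smooth_on Y G \<and>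
    (\<forall>x\<in>X. \<forall>u v. metric_rep N k d (\<psi> x) (dirderiv \<psi> x u) (dirderiv \<psi> x v) = metric_rep M h c x u v)"

lemma isometry_from_charts:
  fixes M :: "('m, 'e::euclidean_space) mfd" and N :: "('n, 'f::euclidean_space) mfd"
  assumes M: "smooth_manifold M" "c \<in> atlas M" and N: "smooth_manifold N" "d \<in> atlas N"
    and iso: "chart_isometry M h c X N k d Y \<psi> G"
  shows "\<exists>f. isometry_between M h (param c ` X) N k (param d ` Y) f"
proof -
  have X: "open X" "X \<subseteq> chart_img c" and Y: "open Y" "Y \<subseteq> chart_img d" and hom: "homeomorphism X Y \<psi> G"
    and \<psi>: "smooth_on X \<psi>" and G: "smooth_on Y G" and metric: "\<And>x u v. x \<in> X \<Longrightarrow>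
      metric_rep N k d (\<psi> x) (dirderiv \<psi> x u) (dirderiv \<psi> x v) = metric_rep M h c x u v"
    using iso unfolding chart_isometry_def by blast+
  define f where "f p = param d (\<psi> (coord c p))" for p
  have \<psi>G: "\<psi> ` X = Y" "G ` Y = X" "\<And>x. x \<in> X \<Longrightarrow> G (\<psi> x) = x" "\<And>y. y \<in> Y \<Longrightarrow> \<psi> (G y) = y"
    using hom unfolding homeomorphism_def by auto
  have U: "p \<in> param c ` X \<longleftrightarrow> p \<in> chart_dom c \<and> coord c p \<in> X" for p
    using param_image[OF M X(2)] by auto
  have V: "q \<in> param d ` Y \<longleftrightarrow> q \<in> chart_dom d \<and> coord d q \<in> Y" for q
    using param_image[OF N Y(2)] by auto
  have fU: "f p \<in> chart_dom d" "coord d (f p) = \<psi> (coord c p)" if "p \<in> param c ` X" for p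
    using that \<psi>G(1) Y(2) U param_in_dom[OF N] coord_param[OF N] unfolding f_def by blast+
  have gV: "param c (G (coord d q)) \<in> param c ` X" "f (param c (G (coord d q))) = q" if "q \<in> param d ` Y" for q
  proof -
    have q: "q \<in> chart_dom d" "coord d q \<in> Y" using that V by auto
    then have "G (coord d q) \<in> X" using \<psi>G by blast
    then show "param c (G (coord d q)) \<in> param c ` X" "f (param c (G (coord d q))) = q"
      using q X(2) \<psi>G(4) coord_param[OF M] param_coord[OF N] by (auto simp: f_def subset_iff)
  qed
  have gf: "param c (G (coord d (f p))) = p" if "p \<in> param c ` X" for p
    using that U fU[OF that] \<psi>G(3) param_coord[OF M] by auto
  have inj: "inj_on f (param c ` X)" using gf by (rule inj_on_inverseI)
  have bij: "bij_betw f (param c ` X) (param d ` Y)"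
    unfolding bij_betw_def
  proof (intro conjI inj subset_antisym subsetI)
    fix q assume "q \<in> f ` param c ` X"
    then obtain p where p: "p \<in> param c ` X" "q = f p" by blast
    then have "\<psi> (coord c p) \<in> Y" using U[of p] \<psi>G(1) by blast
    then show "q \<in> param d ` Y" using V[of q] fU[OF p(1)] p(2) by simp
  next
    fix q assume "q \<in> param d ` Y"
    then show "q \<in> f ` param c ` X" using gV[of q] by (metis image_eqI)
  qed
  have inv: "inv_into (param c ` X) f q = param c (G (coord d q))" if "q \<in> param d ` Y" for q
    using inv_into_f_eq[OF inj] gV[OF that] by blast
  have sub: "\<psi> ` X \<subseteq> chart_img d" "G ` Y \<subseteq> chart_img c" using \<psi>G X Y by auto
  have "k (f p) (differential M N f p u) (differential M N f p v) = h p u v"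
    if p: "p \<in> param c ` X" and uv: "u \<in> tangent_space M p" "v \<in> tangent_space M p" for p u v
  proof -
    have pc: "p \<in> chart_dom c" "coord c p \<in> X" using p U by auto
    have "k (f p) (differential M N f p u) (differential M N f p v) =
      metric_rep N k d (\<psi> (coord c p)) (dirderiv \<psi> (coord c p) (u c)) (dirderiv \<psi> (coord c p) (v c))"
      using smooth_map_from_charts(2)[where f = f, OF M N X \<psi> sub(1) f_def p] uv
      by (simp add: metric_rep_def f_def)
    also have "\<dots> = h p u v"
      using metric[OF pc(2)] metric_rep_coord[OF M pc(1) uv] by simp
    finally show ?thesis .
  qed
  then have "isometry_between M h (param c ` X) N k (param d ` Y) f"
    unfolding isometry_between_def
    using bij smooth_map_from_charts(1)[where f = f, OF M N X \<psi> sub(1) f_def]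
      smooth_map_from_charts(1)[where f = "inv_into (param c ` X) f", OF N M Y G sub(2) inv] by blast
  then show ?thesis by (rule exI[of _ f])
qed

lemma locally_isometricI:
  fixes M :: "('m, 'e::euclidean_space) mfd" and N :: "('n, 'f::euclidean_space) mfd"
  assumes M: "smooth_manifold M" and N: "smooth_manifold N"
    and ex: "\<And>c p. c \<in> atlas M \<Longrightarrow> p \<in> chart_dom c \<Longrightarrow>
      \<exists>d X Y \<psi> G. d \<in> atlas N \<and> coord c p \<in> X \<and> chart_isometry M h c X N k d Y \<psi> G"
  shows "locally_isometric M h N k"
  unfolding locally_isometric_def
proof
  fix p assume "p \<in> points M"
  note c = chart_at[OF M this]
  let ?c = "chart_at M p"
  obtain d X Y \<psi> G where d: "d \<in> atlas N" and p: "coord ?c p \<in> X" and iso: "chart_isometry M h ?c X N k d Y \<psi> G"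
    using ex[OF c] by blast
  then have X: "open X" "X \<subseteq> chart_img ?c" and Y: "open Y" "Y \<subseteq> chart_img d"
    by (simp_all add: chart_isometry_def)
  obtain f where "isometry_between M h (param ?c ` X) N k (param d ` Y) f"
    using isometry_from_charts[OF M c(1) N d iso] by blast
  moreover have "p \<in> param ?c ` X" using param_coord[OF M c] p by (metis image_eqI)
  ultimately show "\<exists>U V f. openin (top_of M) U \<and> p \<in> U \<and> openin (top_of N) V \<and> isometry_between M h U N k V f"
    using openin_param_image[OF M c(1) X] openin_param_image[OF N d Y] by blast
qed

section \<open>Euclidean spaces and spheres\<close>

lemma second_countable_top_of_set: "second_countable (top_of_set (S :: 'a::second_countable_topology set))"
proof -
  obtain B :: "'a set set" where B: "countable B" "topological_basis B" using ex_countable_basis by blast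
  have "second_countable (euclidean :: 'a topology)"
    unfolding second_countable_def
  proof (intro exI[of _ B] conjI ballI allI impI B(1))
    show "openin euclidean V" if "V \<in> B" for V using topological_basis_open[OF B(2) that] by simp
    fix U and x :: 'a assume "openin euclidean U \<and> x \<in> U"
    then show "\<exists>V\<in>B. x \<in> V \<and> V \<subseteq> U" using topological_basisE[OF B(2), of U x] by (metis open_openin)
  qed
  then show ?thesis by (rule second_countable_subtopology)
qed

section \<open>Euclidean space as a Riemannian manifold\<close>

lemma param_id [simp]: "param (UNIV, id) = id"
  by (simp add: param_def inv_into_def fun_eq_iff)

lemma Euclid_simps [simp]: "top_of Euclid = euclidean" "atlas Euclid = {(UNIV, id)}"
  by (simp_all add: Euclid_def)

lemma smooth_manifold_Euclid: "smooth_manifold (Euclid :: ('e::euclidean_space, 'e) mfd)"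
proof -
  have "smooth_on UNIV (id :: 'e \<Rightarrow> 'e)" using smooth_on_ident[OF open_UNIV] by (simp add: id_def)
  then show ?thesis
    unfolding smooth_manifold_def
    using second_countable_top_of_set[of "UNIV :: 'e set"] by (simp add: transition_def)
qed

lemma metric_rep_Euclid: "metric_rep Euclid Euclid_metric (UNIV, id) = (\<lambda>x :: 'e::euclidean_space. \<lambda>u v. u \<bullet> v)"
proof (intro ext)
  fix x u v :: 'e
  show "metric_rep Euclid Euclid_metric (UNIV, id) x u v = u \<bullet> v"
    using tangent_of_self[OF smooth_manifold_Euclid, of "(UNIV, id)" x]
    by (simp add: metric_rep_def Euclid_metric_def)
qed

lemma riemannian_Euclid: "riemannian_manifold (Euclid :: ('e::euclidean_space, 'e) mfd) Euclid_metric"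
proof -
  have "u (UNIV, id) \<noteq> 0" if "u \<in> tangent_space Euclid p" "u \<noteq> (\<lambda>c. 0)" for p :: 'e and u
    using tangent_of_coord[OF smooth_manifold_Euclid, of "(UNIV, id)" p u]
      tangent_of_0[OF smooth_manifold_Euclid, of "(UNIV, id)" p] that by auto
  then show ?thesis
    unfolding riemannian_manifold_def inner_product_on_tangent_space_def
    using smooth_manifold_Euclid
    by (auto simp: metric_rep_Euclid smooth_on_const Euclid_metric_def inner_add_left inner_add_right inner_commute)
qed

lemma constant_curvature_Euclid: "constant_curvature (Euclid :: ('e::euclidean_space, 'e) mfd) Euclid_metric 0"
proof -
  \<comment> \<open>A constant metric has zero right-hand side in Koszul's formula; pairing a
    solution with itself shows that only 0 qualifies.\<close>
  have "levi_civita (\<lambda>x. (\<bullet>)) x u v = 0" for x u v :: 'e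
    unfolding levi_civita_def by (rule the_equality) (auto dest: spec[of _ "_ :: 'e"] simp: inner_eq_zero_iff)
  then show ?thesis
    by (simp add: constant_curvature_def metric_rep_Euclid sectional_curvature_def curvature_def)
qed

lemma unit_killing_Euclid:
  fixes b :: "'e::euclidean_space"
  assumes "norm b = 1"
  shows "\<exists>W. killing_field (Euclid :: ('e, 'e) mfd) Euclid_metric W \<and> unit_length (Euclid :: ('e, 'e) mfd) Euclid_metric W"
proof -
  let ?c = "(UNIV, id) :: ('e, 'e) chart"
  define W where "W p = tangent_of Euclid p ?c b" for p :: 'e
  have W: "W p \<in> tangent_space Euclid p" "W p ?c = b" for p
    using tangent_of_mem[OF smooth_manifold_Euclid, of ?c p b] tangent_of_self[OF smooth_manifold_Euclid, of ?c p b]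
    by (simp_all add: W_def)
  then have "field_rep W ?c = (\<lambda>x. b)" by (simp add: field_rep_def fun_eq_iff)
  then have "killing_field Euclid Euclid_metric W" "unit_length Euclid Euclid_metric W"
    using W assms by (simp_all add: killing_field_def smooth_vector_field_def smooth_on_const metric_rep_Euclid
      lie_derivative_metric_def unit_length_def Euclid_metric_def dot_square_norm)
  then show ?thesis by blast
qed

text \<open>The parameter \<open>\<epsilon> = \<plusminus>1\<close> selects the pole \<open>(0, \<epsilon>)\<close> of the projection.\<close>

definition stereo :: "real \<Rightarrow> 'e::euclidean_space \<times> real \<Rightarrow> 'e"
  where "stereo \<epsilon> z = fst z /\<^sub>R (1 - \<epsilon> * snd z)"

text \<open>The last coordinate is the familiar
  \<open>\<epsilon> * (y \<bullet> y - 1) / (1 + y \<bullet> y)\<close>, rewritten so that both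
  components contain the same fraction and only that one has to be differentiated.\<close>

definition stereo_inv :: "real \<Rightarrow> 'e::euclidean_space \<Rightarrow> 'e \<times> real"
  where "stereo_inv \<epsilon> y = ((2 / (1 + y \<bullet> y)) *\<^sub>R y, \<epsilon> * (1 - 2 / (1 + y \<bullet> y)))"

definition stereo_chart :: "real \<Rightarrow> ('e::euclidean_space \<times> real, 'e) chart"
  where "stereo_chart \<epsilon> = (sphere 0 1 - {(0, \<epsilon>)}, stereo \<epsilon>)"

text \<open>The Euclidean metric pulled back along \<open>stereo_inv\<close>. The formula is the
  same for both poles.\<close>

definition round_metric :: "'e::euclidean_space \<Rightarrow> 'e \<Rightarrow> 'e \<Rightarrow> real"
  where "round_metric y u v = 4 / ((1 + y \<bullet> y) * (1 + y \<bullet> y)) * (u \<bullet> v)"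

lemma one_plus_inner_pos: "1 + y \<bullet> y > 0" for y :: "'e::real_inner"
  by (simp add: add_pos_nonneg)

lemma one_plus_inner_nonzero [simp]: "1 + y \<bullet> y \<noteq> 0" for y :: "'e::real_inner"
  using one_plus_inner_pos[of y] by linarith

section \<open>Stereographic projection from either pole\<close>

context
  fixes \<epsilon> :: real
  assumes \<epsilon>: "\<epsilon> = 1 \<or> \<epsilon> = - 1"
begin

lemma \<epsilon>_mult: "\<epsilon> * (\<epsilon> * a) = a" "\<epsilon> * \<epsilon> = 1"
  using \<epsilon> by auto

text \<open>Replaces removal of the pole by a condition that is open in the ambient space and is
  exactly what the denominator of \<open>stereo\<close> needs.\<close>

lemma sphere_pole_iff:
  fixes z :: "'e::euclidean_space \<times> real"
  assumes "z \<in> sphere 0 1"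
  shows "z = (0, \<epsilon>) \<longleftrightarrow> \<epsilon> * snd z = 1"
proof
  assume *: "\<epsilon> * snd z = 1"
  then have t: "snd z = \<epsilon>" using \<epsilon>_mult by (metis mult.right_neutral)
  have "(norm z)\<^sup>2 = 1" using assms by simp
  then have "(norm (fst z))\<^sup>2 + (snd z)\<^sup>2 = 1" by (cases z) (simp add: norm_Pair)
  then have "fst z = 0" using t \<epsilon> by auto
  then show "z = (0, \<epsilon>)" using t by (simp add: prod_eq_iff)
qed (use \<epsilon>_mult in simp)

lemma stereo_stereo_inv [simp]: "stereo \<epsilon> (stereo_inv \<epsilon> y) = y"
proof -
  have c: "1 - \<epsilon> * snd (stereo_inv \<epsilon> y) = 2 / (1 + y \<bullet> y)" by (simp add: stereo_inv_def \<epsilon>_mult)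
  have "(c *\<^sub>R y) /\<^sub>R c = y" if "c \<noteq> 0" for c :: real using that by simp
  note this[of "2 / (1 + y \<bullet> y)"]
  moreover have "2 / (1 + y \<bullet> y) \<noteq> 0" by simp
  ultimately show ?thesis unfolding stereo_def c unfolding stereo_inv_def fst_conv by blast
qed

lemma stereo_inv_mem: "stereo_inv \<epsilon> y \<in> chart_dom (stereo_chart \<epsilon>)"
proof -
  \<comment> \<open>Naming the reciprocal and retaining only its defining equation makes the claim a
    polynomial identity. Later calculations with the round metric use the same device.\<close>
  let ?r = "1 / (1 + y \<bullet> y)"
  have r: "?r * (1 + y \<bullet> y) = 1" by simp
  have "(norm (stereo_inv \<epsilon> y))\<^sup>2 = stereo_inv \<epsilon> y \<bullet> stereo_inv \<epsilon> y" by (rule power2_norm_eq_inner)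
  also have "\<dots> = (2 * ?r) * (2 * ?r) * (y \<bullet> y) + (\<epsilon> * \<epsilon>) * ((1 - 2 * ?r) * (1 - 2 * ?r))"
    by (simp add: stereo_inv_def inner_prod_def)
  also have "\<dots> = 1" unfolding \<epsilon>_mult using r by algebra
  finally have "norm (stereo_inv \<epsilon> y) = 1" by (simp add: power2_eq_1_iff) (metis norm_ge_zero not_one_le_zero neg_0_le_iff_le order_trans one_neq_neg_one)
  then have "stereo_inv \<epsilon> y \<in> sphere 0 1" by simp
  moreover have "\<epsilon> * snd (stereo_inv \<epsilon> y) \<noteq> 1" by (simp add: stereo_inv_def \<epsilon>_mult)
  ultimately show ?thesis using sphere_pole_iff[of "stereo_inv \<epsilon> y"] by (simp add: stereo_chart_def)
qed

lemma stereo_inv_stereo: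
  assumes "z \<in> sphere 0 1" "\<epsilon> * snd z \<noteq> 1"
  shows "stereo_inv \<epsilon> (stereo \<epsilon> z) = z"
proof -
  obtain x t where z: "z = (x, t)" by fastforce
  define d where "d = 1 / (1 - \<epsilon> * t)"
  have d: "d * (1 - \<epsilon> * t) = 1" "d \<noteq> 0" using assms(2) by (auto simp: d_def z)
  have "(norm z)\<^sup>2 = 1" using assms by simp
  then have xx: "x \<bullet> x + t * t = 1" by (simp add: z power2_norm_eq_inner)
  have y: "stereo \<epsilon> z = d *\<^sub>R x" by (simp add: stereo_def z d_def divide_inverse)
  have q: "1 + (d *\<^sub>R x) \<bullet> (d *\<^sub>R x) = 2 * d"
    using d(1) xx \<epsilon>_mult(2) unfolding inner_scaleR_left inner_scaleR_right by algebra
  have "2 / (2 * d) = 1 - \<epsilon> * t" using d by (simp add: field_simps)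
  then show ?thesis
    unfolding y stereo_inv_def q using d(1) by (simp add: z \<epsilon>_mult mult.commute)
qed

lemma smooth_on_stereo_inv: "smooth_on UNIV (stereo_inv \<epsilon>)"
  unfolding stereo_inv_def[abs_def] by (intro smooth_on_intros open_UNIV) simp_all

lemma open_stereo_domain: "open {z :: 'e::euclidean_space \<times> real. \<epsilon> * snd z \<noteq> 1}"
  by (intro open_Collect_neq continuous_intros)

lemma smooth_on_stereo: "smooth_on {z :: 'e::euclidean_space \<times> real. \<epsilon> * snd z \<noteq> 1} (stereo \<epsilon>)"
  unfolding stereo_def[abs_def] by (intro smooth_on_intros open_stereo_domain) auto

lemma stereo_chart_img: "chart_img (stereo_chart \<epsilon>) = UNIV"
proof -
  have "y \<in> chart_img (stereo_chart \<epsilon>)" for y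
    using imageI[OF stereo_inv_mem[of y], of "coord (stereo_chart \<epsilon>)"] by (simp add: stereo_chart_def)
  then show ?thesis by blast
qed

lemma param_stereo_chart: "param (stereo_chart \<epsilon>) = (stereo_inv \<epsilon> :: 'e::euclidean_space \<Rightarrow> 'e \<times> real)"
proof
  fix y :: 'e
  have inj: "inj_on (stereo \<epsilon>) (sphere 0 1 - {(0, \<epsilon>)} :: ('e \<times> real) set)"
    by (rule inj_on_inverseI[of _ "stereo_inv \<epsilon>"]) (use stereo_inv_stereo sphere_pole_iff in blast)
  show "param (stereo_chart \<epsilon>) y = stereo_inv \<epsilon> y"
    using inv_into_f_eq[OF inj _ stereo_stereo_inv, of y] stereo_inv_mem[of y]
    by (simp add: param_def stereo_chart_def)
qed

lemma stereo_chart_homeomorphic: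
  "homeomorphic_map (subtopology (top_of_set (sphere 0 1)) (chart_dom (stereo_chart \<epsilon>)))
    (top_of_set (chart_img (stereo_chart \<epsilon>))) (coord (stereo_chart \<epsilon> :: ('e::euclidean_space \<times> real, 'e) chart))"
proof -
  let ?D = "sphere 0 1 - {(0, \<epsilon>)} :: ('e \<times> real) set"
  have sub: "?D \<subseteq> {z. \<epsilon> * snd z \<noteq> 1}" using sphere_pole_iff by blast
  have top: "subtopology (top_of_set (sphere 0 1)) ?D = top_of_set ?D"
    by (simp add: subtopology_subtopology Int_absorb1 Diff_subset)
  have inv: "stereo_inv \<epsilon> (stereo \<epsilon> z) = z" if "z \<in> ?D" for z
    using that sub by (intro stereo_inv_stereo) auto
  have mem: "stereo_inv \<epsilon> y \<in> ?D" for y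
    using stereo_inv_mem[of y] by (simp add: stereo_chart_def)
  have "homeomorphic_maps (top_of_set ?D) euclidean (stereo \<epsilon>) (stereo_inv \<epsilon>)"
    unfolding homeomorphic_maps_def
    using mem inv continuous_on_subset[OF smooth_on_imp_continuous_on[OF smooth_on_stereo] sub]
      smooth_on_imp_continuous_on[OF smooth_on_stereo_inv]
    by (simp add: continuous_map_in_subtopology image_subset_iff)
  then show ?thesis
    unfolding stereo_chart_img using top homeomorphic_map_maps by (auto simp: stereo_chart_def)
qed

lemma stereo_inv_deriv:
  "(stereo_inv \<epsilon> has_derivative (\<lambda>u. ((2 / (1 + y \<bullet> y)) *\<^sub>R u - (4 * (y \<bullet> u) / ((1 + y \<bullet> y) * (1 + y \<bullet> y))) *\<^sub>R y,
    \<epsilon> * (4 * (y \<bullet> u) / ((1 + y \<bullet> y) * (1 + y \<bullet> y)))))) (at y)"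
proof -
  have d: "((\<lambda>y. 2 / (1 + y \<bullet> y)) has_derivative (\<lambda>u. - (4 * (y \<bullet> u) / ((1 + y \<bullet> y) * (1 + y \<bullet> y))))) (at y)"
    by (auto intro!: derivative_eq_intros simp: fun_eq_iff inner_commute algebra_simps)
  have "((\<lambda>y. ((2 / (1 + y \<bullet> y)) *\<^sub>R y, \<epsilon> * (1 - 2 / (1 + y \<bullet> y)))) has_derivative
    (\<lambda>u. ((2 / (1 + y \<bullet> y)) *\<^sub>R u + (- (4 * (y \<bullet> u) / ((1 + y \<bullet> y) * (1 + y \<bullet> y)))) *\<^sub>R y,
      \<epsilon> * (0 - - (4 * (y \<bullet> u) / ((1 + y \<bullet> y) * (1 + y \<bullet> y))))))) (at y)"
    by (intro has_derivative_Pair has_derivative_scaleR d has_derivative_ident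
        has_derivative_mult_right has_derivative_diff has_derivative_const)
  then show ?thesis by (simp add: stereo_inv_def[abs_def])
qed

lemma stereo_inv_conformal:
  "dirderiv (stereo_inv \<epsilon>) y u \<bullet> dirderiv (stereo_inv \<epsilon>) y v = round_metric y u v"
proof -
  let ?r = "1 / (1 + y \<bullet> y)"
  have r: "?r * (1 + y \<bullet> y) = 1" by simp
  have "dirderiv (stereo_inv \<epsilon>) y u =
      ((2 * ?r) *\<^sub>R u - (4 * (y \<bullet> u) * ?r * ?r) *\<^sub>R y, \<epsilon> * (4 * (y \<bullet> u) * ?r * ?r))" for u
    using dirderiv_eqI[OF stereo_inv_deriv[of y]] by simp
  then have "dirderiv (stereo_inv \<epsilon>) y u \<bullet> dirderiv (stereo_inv \<epsilon>) y v =
      (2 * ?r) * (2 * ?r) * (u \<bullet> v) - (2 * ?r) * (4 * (y \<bullet> v) * ?r * ?r) * (y \<bullet> u)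
      - (4 * (y \<bullet> u) * ?r * ?r) * (2 * ?r) * (y \<bullet> v) + (4 * (y \<bullet> u) * ?r * ?r) * (4 * (y \<bullet> v) * ?r * ?r) * (y \<bullet> y)
      + (\<epsilon> * \<epsilon>) * ((4 * (y \<bullet> u) * ?r * ?r) * (4 * (y \<bullet> v) * ?r * ?r))"
    by (simp only: inner_Pair inner_diff_left inner_diff_right inner_scaleR_left inner_scaleR_right
        inner_commute[of u y] inner_real_def) (simp add: algebra_simps)
  also have "\<dots> = 4 * ?r * ?r * (u \<bullet> v)" unfolding \<epsilon>_mult using r by algebra
  finally show ?thesis by (simp add: round_metric_def)
qed

end

section \<open>The sphere as a Riemannian manifold\<close>

lemma Sphere_simps:
  "top_of Sphere = top_of_set (sphere 0 1)" "atlas Sphere = {stereo_chart 1, stereo_chart (- 1)}"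
  by (auto simp: Sphere_def stereo_chart_def stereo_def fun_eq_iff)

lemma Sphere_atlas_iff: "c \<in> atlas Sphere \<longleftrightarrow> (\<exists>\<epsilon>. (\<epsilon> = 1 \<or> \<epsilon> = - 1) \<and> c = stereo_chart \<epsilon>)"
  by (auto simp: Sphere_simps)

lemma smooth_manifold_Sphere: "smooth_manifold (Sphere :: ('e::euclidean_space \<times> real, 'e) mfd)"
  unfolding smooth_manifold_def
proof (intro conjI ballI)
  show "Hausdorff_space (top_of (Sphere :: ('e \<times> real, 'e) mfd))"
    by (simp add: Sphere_simps Hausdorff_space_subtopology)
  show "second_countable (top_of (Sphere :: ('e \<times> real, 'e) mfd))"
    by (simp add: Sphere_simps second_countable_top_of_set)
  show "(\<Union>c\<in>atlas Sphere. chart_dom c) = points (Sphere :: ('e \<times> real, 'e) mfd)"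
    by (auto simp: Sphere_simps stereo_chart_def)
next
  fix c :: "('e \<times> real, 'e) chart" assume "c \<in> atlas Sphere"
  then obtain \<epsilon> where \<epsilon>: "\<epsilon> = 1 \<or> \<epsilon> = - 1" and c: "c = stereo_chart \<epsilon>" by (auto simp: Sphere_atlas_iff)
  show "openin (top_of Sphere) (chart_dom c)"
    unfolding c Sphere_simps by (auto simp: stereo_chart_def openin_open intro!: exI[of _ "- {(0, \<epsilon>)}"])
  show "open (chart_img c)" unfolding c stereo_chart_img[OF \<epsilon>] by simp
  show "homeomorphic_map (subtopology (top_of Sphere) (chart_dom c)) (top_of_set (chart_img c)) (coord c)"
    unfolding c Sphere_simps by (rule stereo_chart_homeomorphic[OF \<epsilon>])
  fix d :: "('e \<times> real, 'e) chart" assume "d \<in> atlas Sphere"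
  then obtain \<delta> where \<delta>: "\<delta> = 1 \<or> \<delta> = - 1" and d: "d = stereo_chart \<delta>" by (auto simp: Sphere_atlas_iff)
  \<comment> \<open>An open set on which the composition is visibly smooth; the overlap only has to
    lie inside it and need not be computed.\<close>
  let ?O = "{y :: 'e. \<delta> * snd (stereo_inv \<epsilon> y) \<noteq> 1}"
  have op: "open ?O"
    by (intro open_Collect_neq continuous_intros smooth_on_imp_continuous_on[OF smooth_on_stereo_inv[OF \<epsilon>]])
  have "smooth_on ?O (\<lambda>y. stereo \<delta> (stereo_inv \<epsilon> y))"
    by (rule smooth_on_compose[OF op _ smooth_on_stereo[OF \<delta>] smooth_on_subset[OF smooth_on_stereo_inv[OF \<epsilon>]]]) auto
  moreover have "coord c ` (chart_dom c \<inter> chart_dom d) \<subseteq> ?O"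
  proof (rule image_subsetI)
    fix z assume z: "z \<in> chart_dom c \<inter> chart_dom d"
    then have "z \<in> sphere 0 1" "z \<noteq> (0, \<epsilon>)" "z \<noteq> (0, \<delta>)" by (simp_all add: c d stereo_chart_def)
    then show "coord c z \<in> ?O"
      using stereo_inv_stereo[OF \<epsilon>, of z] sphere_pole_iff[OF \<epsilon>, of z] sphere_pole_iff[OF \<delta>, of z]
      by (simp add: c stereo_chart_def)
  qed
  ultimately show "smooth_on (coord c ` (chart_dom c \<inter> chart_dom d)) (transition c d)"
    unfolding transition_def c d param_stereo_chart[OF \<epsilon>] o_def
    by (auto simp: stereo_chart_def intro: smooth_on_subset)
qed

text \<open>The differential of the inclusion is taken in the chart picked by
  \<open>chart_at\<close>, possibly the other projection. The chain rule along the transition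
  carries it to the given chart, where the conformality of \<open>stereo_inv\<close>
  applies.\<close>

lemma Sphere_metric_coord:
  fixes p :: "'e::euclidean_space \<times> real"
  assumes \<epsilon>: "\<epsilon> = 1 \<or> \<epsilon> = - 1" and p: "p \<in> chart_dom (stereo_chart \<epsilon>)"
    and uv: "u \<in> tangent_space Sphere p" "v \<in> tangent_space Sphere p"
  shows "Sphere_metric p u v = round_metric (stereo \<epsilon> p) (u (stereo_chart \<epsilon>)) (v (stereo_chart \<epsilon>))"
proof -
  let ?c = "stereo_chart \<epsilon> :: ('e \<times> real, 'e) chart"
  have c: "?c \<in> atlas Sphere" using \<epsilon> by (auto simp: Sphere_atlas_iff)
  define c' where "c' = chart_at (Sphere :: ('e \<times> real, 'e) mfd) p"
  have "p \<in> points Sphere" using p by (simp add: Sphere_simps stereo_chart_def)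
  then have c': "c' \<in> atlas Sphere" "p \<in> chart_dom c'"
    unfolding c'_def by (rule chart_at[OF smooth_manifold_Sphere])+
  obtain \<delta> where \<delta>: "\<delta> = 1 \<or> \<delta> = - 1" and d: "c' = stereo_chart \<delta>" using c'(1) by (auto simp: Sphere_atlas_iff)
  have "differential Sphere Euclid id p w (UNIV, id) = dirderiv (stereo_inv \<epsilon>) (stereo \<epsilon> p) (w ?c)"
    if w: "w \<in> tangent_space Sphere p" for w
  proof -
    let ?X = "coord ?c ` (chart_dom ?c \<inter> chart_dom c')"
    have op: "open ?X"
      by (rule overlap_image[OF smooth_manifold_Sphere c chart_openin[OF smooth_manifold_Sphere c'(1)]])
    have mem: "coord ?c p \<in> ?X" using p c' by blast
    have t: "(transition ?c c' has_derivative dirderiv (transition ?c c') (coord ?c p)) (at (coord ?c p))"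
      by (rule transition_deriv[OF smooth_manifold_Sphere c c'(1) p c'(2)])
    have "((\<lambda>y. stereo_inv \<delta> (transition ?c c' y)) has_derivative
        (\<lambda>u. dirderiv (stereo_inv \<delta>) (coord c' p) (dirderiv (transition ?c c') (coord ?c p) u))) (at (coord ?c p))"
      by (rule has_derivative_compose[OF t])
        (use smooth_on_has_derivative[OF smooth_on_stereo_inv[OF \<delta>]]
          transition_coord[OF smooth_manifold_Sphere c p, of c'] in simp)
    moreover have "stereo_inv \<epsilon> y = stereo_inv \<delta> (transition ?c c' y)" if y: "y \<in> ?X" for y
    proof -
      obtain q where q: "y = coord ?c q" "q \<in> chart_dom ?c" "q \<in> chart_dom c'" using y by blast
      then show ?thesis
        using transition_coord[OF smooth_manifold_Sphere c q(2), of c']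
          param_coord[OF smooth_manifold_Sphere c q(2)] param_coord[OF smooth_manifold_Sphere c'(1) q(3)]
        by (simp add: d param_stereo_chart[OF \<epsilon>] param_stereo_chart[OF \<delta>])
    qed
    ultimately have "dirderiv (stereo_inv \<epsilon>) (coord ?c p) =
        (\<lambda>u. dirderiv (stereo_inv \<delta>) (coord c' p) (dirderiv (transition ?c c') (coord ?c p) u))"
      by (intro has_derivative_eq_dirderiv[OF op mem])
    moreover have "w c' = dirderiv (transition ?c c') (coord ?c p) (w ?c)"
      using w c c' p unfolding tangent_space_def by blast
    ultimately show ?thesis
      by (simp add: differential_def c'_def[symmetric] Let_def d param_stereo_chart[OF \<delta>]) (simp add: stereo_chart_def)
  qed
  with uv show ?thesis
    by (simp add: Sphere_metric_def Euclid_metric_def stereo_inv_conformal[OF \<epsilon>])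
qed

lemma metric_rep_Sphere:
  assumes \<epsilon>: "\<epsilon> = 1 \<or> \<epsilon> = - 1"
  shows "metric_rep Sphere Sphere_metric (stereo_chart \<epsilon>) = (round_metric :: 'e::euclidean_space \<Rightarrow> _)"
proof (intro ext)
  fix y u v :: 'e
  have c: "stereo_chart \<epsilon> \<in> atlas (Sphere :: ('e \<times> real, 'e) mfd)" using \<epsilon> by (auto simp: Sphere_atlas_iff)
  have p: "stereo_inv \<epsilon> y \<in> chart_dom (stereo_chart \<epsilon>)" by (rule stereo_inv_mem[OF \<epsilon>])
  show "metric_rep Sphere Sphere_metric (stereo_chart \<epsilon>) y u v = round_metric y u v"
    unfolding metric_rep_def param_stereo_chart[OF \<epsilon>]
    using Sphere_metric_coord[OF \<epsilon> p tangent_of_mem[OF smooth_manifold_Sphere c p] tangent_of_mem[OF smooth_manifold_Sphere c p]]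
    by (simp add: tangent_of_self[OF smooth_manifold_Sphere c p] stereo_stereo_inv[OF \<epsilon>])
qed

lemma inner_form_round_metric: "inner_form (round_metric (y :: 'e::euclidean_space))"
proof (rule inner_form.intro)
  fix u v :: 'e
  show "linear (\<lambda>u. round_metric y u v)"
    unfolding round_metric_def by (rule linearI) (simp_all add: inner_add_left algebra_simps add_divide_distrib)
  show "round_metric y u v = round_metric y v u" by (simp add: round_metric_def inner_commute)
  show "u \<noteq> 0 \<Longrightarrow> round_metric y u u > 0"
    using one_plus_inner_pos[of y] by (simp add: round_metric_def)
qed

lemma smooth_on_round_metric: "smooth_on UNIV (\<lambda>y. round_metric y u v)"
  unfolding round_metric_def by (intro smooth_on_intros open_UNIV) simp

lemma riemannian_Sphere: "riemannian_manifold (Sphere :: ('e::euclidean_space \<times> real, 'e) mfd) Sphere_metric"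
  unfolding riemannian_manifold_def
proof (intro conjI ballI allI smooth_manifold_Sphere)
  fix c :: "('e \<times> real, 'e) chart" and u v assume "c \<in> atlas Sphere"
  then obtain \<epsilon> where \<epsilon>: "\<epsilon> = 1 \<or> \<epsilon> = - 1" and c: "c = stereo_chart \<epsilon>" by (auto simp: Sphere_atlas_iff)
  show "smooth_on (chart_img c) (\<lambda>x. metric_rep Sphere Sphere_metric c x u v)"
    unfolding c metric_rep_Sphere[OF \<epsilon>] by (rule smooth_on_subset[OF smooth_on_round_metric]) simp
next
  fix p :: "'e \<times> real" assume "p \<in> points Sphere"
  note chart_at[OF smooth_manifold_Sphere this]
  then obtain \<epsilon> where \<epsilon>: "\<epsilon> = 1 \<or> \<epsilon> = - 1" and c: "stereo_chart \<epsilon> \<in> atlas (Sphere :: ('e \<times> real, 'e) mfd)"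
    and p: "p \<in> chart_dom (stereo_chart \<epsilon>)"
    unfolding Sphere_atlas_iff by metis
  interpret inner_form "round_metric (stereo \<epsilon> p)" by (rule inner_form_round_metric)
  note coord = Sphere_metric_coord[OF \<epsilon> p]
  show "inner_product_on_tangent_space Sphere p (Sphere_metric p)"
    unfolding inner_product_on_tangent_space_def
  proof (intro conjI ballI allI impI)
    fix u v w r s
    assume uvw: "u \<in> tangent_space Sphere p" "v \<in> tangent_space Sphere p" "w \<in> tangent_space Sphere p"
    show "Sphere_metric p (\<lambda>c. r *\<^sub>R u c + s *\<^sub>R v c) w = r * Sphere_metric p u w + s * Sphere_metric p v w"
      using uvw tangent_space_linear[OF smooth_manifold_Sphere c p uvw(1,2)] by (simp add: coord left_simps)
  next
    fix u v assume "u \<in> tangent_space Sphere p" "v \<in> tangent_space Sphere p"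
    then show "Sphere_metric p u v = Sphere_metric p v u" using coord sym by metis
  next
    fix u assume u: "u \<in> tangent_space Sphere p" "u \<noteq> (\<lambda>c. 0)"
    then have "u (stereo_chart \<epsilon>) \<noteq> 0"
      using tangent_of_coord[OF smooth_manifold_Sphere c p u(1)] tangent_of_0[OF smooth_manifold_Sphere c p] by metis
    then show "Sphere_metric p u u > 0" using pos by (simp add: coord u)
  qed
qed

section \<open>Curvature and unit Killing fields of the sphere\<close>

abbreviation \<rho> :: "'e::euclidean_space \<Rightarrow> real"
  where "\<rho> x \<equiv> 1 / (1 + x \<bullet> x)"

lemma has_derivative_inverse_one_plus_inner:
  "((\<lambda>y :: 'e::euclidean_space. \<rho> y) has_derivative
    (\<lambda>a. - 2 * (x \<bullet> a) * \<rho> x * \<rho> x)) (at x)"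
  by (auto intro!: derivative_eq_intros simp: fun_eq_iff inner_commute)

lemma round_metric_eq: "round_metric y u v = 4 * \<rho> y * \<rho> y * (u \<bullet> v)"
  by (simp add: round_metric_def)

lemma dirderiv_round_metric:
  "dirderiv (\<lambda>y. round_metric y u v) x a =
    - 16 * (x \<bullet> a) * \<rho> x * \<rho> x * \<rho> x * (u \<bullet> v)"
proof -
  have "((\<lambda>y. 4 * \<rho> y * \<rho> y * (u \<bullet> v)) has_derivative
      (\<lambda>a. (4 * \<rho> x * (- 2 * (x \<bullet> a) * \<rho> x * \<rho> x) + 4 * (- 2 * (x \<bullet> a) * \<rho> x * \<rho> x) * \<rho> x) * (u \<bullet> v))) (at x)"
    by (intro has_derivative_mult_left has_derivative_mult has_derivative_mult_right
        has_derivative_inverse_one_plus_inner)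
  then have "((\<lambda>y. round_metric y u v) has_derivative
      (\<lambda>a. - 16 * (x \<bullet> a) * \<rho> x * \<rho> x * \<rho> x * (u \<bullet> v))) (at x)"
    unfolding round_metric_eq by (rule has_derivative_eq_rhs) (simp add: fun_eq_iff algebra_simps)
  from dirderiv_eqI[OF this] show ?thesis by simp
qed

lemma local_metric_round: "local_metric UNIV (round_metric :: real^'n \<Rightarrow> _)"
  by (intro local_metric.intro inner_form_round_metric smooth_on_round_metric open_UNIV)

text \<open>The standard formula for a conformally flat metric: the logarithm of the conformal
  factor \<open>2 * \<rho> x\<close> has the derivative
  \<open>- 2 * \<rho> x * (x \<bullet> u)\<close> in direction \<open>u\<close>.\<close>

lemma levi_civita_round:
  fixes x :: "real^'n"
  shows "levi_civita round_metric x u v =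
    (2 * \<rho> x) *\<^sub>R ((u \<bullet> v) *\<^sub>R x - (x \<bullet> u) *\<^sub>R v - (x \<bullet> v) *\<^sub>R u)"
proof -
  interpret local_metric UNIV "round_metric :: real^'n \<Rightarrow> _" by (rule local_metric_round)
  define r where "r = \<rho> x"
  have eq: "round_metric x u v = 4 * r * r * (u \<bullet> v)" for u v by (simp add: round_metric_eq r_def)
  show ?thesis
  proof (rule g_nondegenerate[OF UNIV_I])
    fix w
    show "round_metric x (levi_civita round_metric x u v) w = round_metric x
        ((2 * \<rho> x) *\<^sub>R ((u \<bullet> v) *\<^sub>R x - (x \<bullet> u) *\<^sub>R v - (x \<bullet> v) *\<^sub>R u)) w"
      using koszul[OF UNIV_I, of x u v w]
      unfolding dirderiv_round_metric r_def[symmetric] eq inner_diff_left inner_scaleR_left by algebra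
  qed
qed

lemma dirderiv_levi_civita_round:
  fixes x :: "real^'n"
  shows "dirderiv (\<lambda>y. levi_civita round_metric y u v) x a =
    (2 * \<rho> x) *\<^sub>R ((u \<bullet> v) *\<^sub>R a - (a \<bullet> u) *\<^sub>R v - (a \<bullet> v) *\<^sub>R u)
    + (2 * (- 2 * (x \<bullet> a) * \<rho> x * \<rho> x)) *\<^sub>R
      ((u \<bullet> v) *\<^sub>R x - (x \<bullet> u) *\<^sub>R v - (x \<bullet> v) *\<^sub>R u)"
proof -
  have "((\<lambda>y. levi_civita round_metric y u v) has_derivative (\<lambda>a.
    (2 * \<rho> x) *\<^sub>R ((u \<bullet> v) *\<^sub>R a - (a \<bullet> u) *\<^sub>R v - (a \<bullet> v) *\<^sub>R u)
    + (2 * (- 2 * (x \<bullet> a) * \<rho> x * \<rho> x)) *\<^sub>R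
      ((u \<bullet> v) *\<^sub>R x - (x \<bullet> u) *\<^sub>R v - (x \<bullet> v) *\<^sub>R u))) (at x)"
    unfolding levi_civita_round
    by (intro has_derivative_scaleR has_derivative_mult_right has_derivative_inverse_one_plus_inner
        has_derivative_diff has_derivative_scaleR_right has_derivative_scaleR_left
        has_derivative_inner_left has_derivative_ident)
  from dirderiv_eqI[OF this] show ?thesis by simp
qed

text \<open>Pairing with the Euclidean product accounts for one factor
  \<open>4 * \<rho> x * \<rho> x\<close>; a second one comes from the metric itself, and together
  they turn the Euclidean Gram determinant into the round one, so the curvature is 1.\<close>

lemma curvature_round:
  fixes x :: "real^'n"
  shows "curvature round_metric x u v v \<bullet> u =
    4 * \<rho> x * \<rho> x * ((u \<bullet> u) * (v \<bullet> v) - (u \<bullet> v) * (u \<bullet> v))"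
proof -
  define r where "r = \<rho> x"
  have r: "r * (1 + x \<bullet> x) = 1" by (simp add: r_def)
  have sym: "v \<bullet> u = u \<bullet> v" "u \<bullet> x = x \<bullet> u" "v \<bullet> x = x \<bullet> v" by (simp_all add: inner_commute)
  show ?thesis
    unfolding curvature_def
    unfolding dirderiv_levi_civita_round
    unfolding levi_civita_round r_def[symmetric]
    unfolding inner_diff_left inner_diff_right inner_add_left inner_add_right inner_scaleR_left inner_scaleR_right sym
    using r by algebra
qed

lemma constant_curvature_Sphere:
  "constant_curvature (Sphere :: ((real^'n) \<times> real, real^'n) mfd) Sphere_metric 1"
  unfolding constant_curvature_def
proof (intro ballI allI impI)
  fix c :: "((real^'n) \<times> real, real^'n) chart" and x u v :: "real^'n"
  assume c: "c \<in> atlas Sphere" and uv: "u \<noteq> v \<and> independent {u, v}"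
  interpret inner_form "round_metric x" by (rule inner_form_round_metric)
  define r where "r = \<rho> x"
  have eq: "round_metric x u v = 4 * r * r * (u \<bullet> v)" for u v by (simp add: round_metric_eq r_def)
  have "round_metric x (curvature round_metric x u v v) u = round_metric x u u * round_metric x v v - (round_metric x u v)\<^sup>2"
    unfolding eq curvature_round r_def[symmetric] by (simp add: power2_eq_square algebra_simps)
  then show "sectional_curvature (metric_rep Sphere Sphere_metric c) x u v = 1"
    using c uv gram_det_nonzero[of u v]
    by (auto simp: Sphere_atlas_iff metric_rep_Sphere sectional_curvature_def)
qed

text \<open>The stereographic coordinates of the field \<open>(x, t) \<mapsto> (A x + t b, - b \<bullet> x)\<close> on the sphere. If \<open>A\<close> is a complex
  structure on the complement of the unit vector \<open>b\<close>, it is the Hopf field.\<close>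

definition hopf_field :: "('e \<Rightarrow> 'e) \<Rightarrow> 'e \<Rightarrow> real \<Rightarrow> 'e::euclidean_space \<Rightarrow> 'e"
  where "hopf_field A b \<epsilon> y = A y + \<epsilon> *\<^sub>R (((y \<bullet> y - 1) / 2) *\<^sub>R b - (b \<bullet> y) *\<^sub>R y)"

context
  fixes A :: "'e::euclidean_space \<Rightarrow> 'e" and b
  assumes A: "linear A" "\<And>y z. A y \<bullet> z = - (y \<bullet> A z)" "A b = 0"
    and b: "b \<bullet> b = 1" and norm: "\<And>y. A y \<bullet> A y = y \<bullet> y - (b \<bullet> y) * (b \<bullet> y)"
begin

section \<open>Hopf fields in stereographic coordinates\<close>

lemma skew_perp: "A y \<bullet> y = 0" "y \<bullet> A y = 0" "A y \<bullet> b = 0" "b \<bullet> A y = 0"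
  using A(2)[of y y] A(2)[of y b] A(3) inner_commute[of y "A y"] inner_commute[of b "A y"] by simp_all

text \<open>The conformal factor of the round metric is a function of \<open>y \<bullet> y\<close>,
  so its change along the field involves only this radial component.\<close>

lemma inner_hopf_field: "2 * (y \<bullet> hopf_field A b \<epsilon> y) = - \<epsilon> * (1 + y \<bullet> y) * (b \<bullet> y)"
  by (simp add: hopf_field_def inner_add_right inner_diff_right skew_perp inner_commute[of y b] algebra_simps diff_divide_distrib)

lemma smooth_on_hopf_field: "smooth_on UNIV (hopf_field A b \<epsilon>)"
  unfolding hopf_field_def[abs_def] using A(1)
  by (intro smooth_on_intros open_UNIV smooth_on_linear) (simp_all add: linear_conv_bounded_linear)

lemma hopf_field_deriv:
  "(hopf_field A b \<epsilon> has_derivative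
    (\<lambda>u. A u + \<epsilon> *\<^sub>R ((y \<bullet> u) *\<^sub>R b - ((b \<bullet> y) *\<^sub>R u + (b \<bullet> u) *\<^sub>R y)))) (at y)"
proof -
  have "((\<lambda>y. (y \<bullet> y - 1) / 2) has_derivative (\<lambda>u. y \<bullet> u)) (at y)"
    by (auto intro!: derivative_eq_intros simp: fun_eq_iff inner_commute)
  moreover have "(A has_derivative A) (at y)"
    using A(1) by (simp add: linear_conv_bounded_linear bounded_linear_imp_has_derivative)
  ultimately show ?thesis
    unfolding hopf_field_def[abs_def]
    by (intro has_derivative_add has_derivative_scaleR_right has_derivative_diff has_derivative_scaleR_left
        has_derivative_scaleR has_derivative_inner_right has_derivative_ident)
qed

text \<open>The symmetric part of the derivative of the field is
  \<open>- \<epsilon> * (b \<bullet> y)\<close> times the identity, everything else being skew. This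
  just offsets the change of the conformal factor.\<close>

lemma hopf_field_killing:
  assumes "\<epsilon> * \<epsilon> = 1"
  shows "lie_derivative_metric (hopf_field A b \<epsilon>) round_metric y u v = 0"
proof -
  define r where "r = \<rho> y"
  have r: "r * (1 + y \<bullet> y) = 1" by (simp add: r_def)
  have uv: "A u \<bullet> v + u \<bullet> A v = 0" using A(2)[of u v] by simp
  have sym: "u \<bullet> b = b \<bullet> u" "v \<bullet> b = b \<bullet> v" "u \<bullet> y = y \<bullet> u" "v \<bullet> y = y \<bullet> v" "v \<bullet> u = u \<bullet> v"
    by (simp_all add: inner_commute)
  have "dirderiv (\<lambda>y. round_metric y u v) y (hopf_field A b \<epsilon> y) = 8 * r * r * \<epsilon> * (b \<bullet> y) * (u \<bullet> v)"
    unfolding dirderiv_round_metric r_def[symmetric] using r inner_hopf_field[of y \<epsilon>] by algebra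
  moreover have "round_metric y (dirderiv (hopf_field A b \<epsilon>) y u) v + round_metric y u (dirderiv (hopf_field A b \<epsilon>) y v) =
      - 8 * r * r * \<epsilon> * (b \<bullet> y) * (u \<bullet> v)"
    unfolding dirderiv_eqI[OF hopf_field_deriv] round_metric_eq r_def[symmetric]
      inner_diff_left inner_diff_right inner_add_left inner_add_right inner_scaleR_left inner_scaleR_right sym
    using uv by algebra
  ultimately show ?thesis by (simp add: lie_derivative_metric_def)
qed

text \<open>The terms in \<open>b \<bullet> y\<close> cancel. With \<open>q = y \<bullet> y\<close>
  the Euclidean square of the field is
  \<open>q + ((q - 1) / 2)\<^sup>2 = ((1 + q) / 2)\<^sup>2\<close>, the reciprocal of the conformal
  factor.\<close>

lemma hopf_field_unit:
  assumes "\<epsilon> * \<epsilon> = 1"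
  shows "round_metric y (hopf_field A b \<epsilon> y) (hopf_field A b \<epsilon> y) = 1"
proof -
  define r where "r = \<rho> y"
  have r: "r * (1 + y \<bullet> y) = 1" by (simp add: r_def)
  define h where "h = (y \<bullet> y - 1) / 2"
  have h: "2 * h = y \<bullet> y - 1" by (simp add: h_def)
  show ?thesis
    unfolding round_metric_eq r_def[symmetric] hopf_field_def h_def[symmetric]
      inner_diff_left inner_diff_right inner_add_left inner_add_right inner_scaleR_left inner_scaleR_right
      skew_perp norm b inner_commute[of y b]
    using r h assms by algebra
qed

text \<open>The transition between the two projections is inversion in the unit sphere. Its
  derivative exchanges the signs of \<open>\<epsilon>\<close>, so the two coordinate formulas
  describe one global field.\<close>

lemma hopf_field_transition:
  assumes "\<epsilon> * \<epsilon> = 1" "y \<noteq> 0"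
  shows "dirderiv (\<lambda>y. y /\<^sub>R (y \<bullet> y)) y (hopf_field A b \<epsilon> y) = hopf_field A b (- \<epsilon>) (y /\<^sub>R (y \<bullet> y))"
proof -
  define k where "k = inverse (y \<bullet> y)"
  have k: "k * (y \<bullet> y) = 1" using assms(2) by (simp add: k_def)
  have "((\<lambda>y. inverse (y \<bullet> y)) has_derivative (\<lambda>u. - 2 * k * k * (y \<bullet> u))) (at y)"
    using assms(2) by (auto intro!: derivative_eq_intros simp: fun_eq_iff inner_commute k_def)
  then have "((\<lambda>y. y /\<^sub>R (y \<bullet> y)) has_derivative (\<lambda>u. k *\<^sub>R u + (- 2 * k * k * (y \<bullet> u)) *\<^sub>R y)) (at y)"
    unfolding k_def by (intro has_derivative_scaleR has_derivative_ident)
  then have "dirderiv (\<lambda>y. y /\<^sub>R (y \<bullet> y)) y (hopf_field A b \<epsilon> y) =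
      k *\<^sub>R hopf_field A b \<epsilon> y + (- 2 * k * k * (y \<bullet> hopf_field A b \<epsilon> y)) *\<^sub>R y"
    by (simp add: dirderiv_eqI)
  also have "\<dots> = k *\<^sub>R A y + (\<epsilon> * k * ((y \<bullet> y - 1) / 2)) *\<^sub>R b + (\<epsilon> * k * k * (b \<bullet> y)) *\<^sub>R y"
  proof -
    have "- 2 * k * k * (y \<bullet> hopf_field A b \<epsilon> y) - k * \<epsilon> * (b \<bullet> y) = \<epsilon> * k * k * (b \<bullet> y)"
      using k inner_hopf_field[of y \<epsilon>] by algebra
    then have "(- 2 * k * k * (y \<bullet> hopf_field A b \<epsilon> y)) *\<^sub>R y = (\<epsilon> * k * k * (b \<bullet> y) + k * \<epsilon> * (b \<bullet> y)) *\<^sub>R y"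
      by (simp add: algebra_simps)
    then show ?thesis by (simp add: hopf_field_def algebra_simps)
  qed
  also have "\<dots> = hopf_field A b (- \<epsilon>) (k *\<^sub>R y)"
  proof -
    define h where "h = ((k *\<^sub>R y) \<bullet> (k *\<^sub>R y) - 1) / 2"
    have "(k *\<^sub>R y) \<bullet> (k *\<^sub>R y) = k" using k by (simp add: mult.assoc)
    then have "2 * h = k - 1" by (simp add: h_def)
    then have "- \<epsilon> * h = \<epsilon> * k * ((y \<bullet> y - 1) / 2)" using k by algebra
    moreover have "hopf_field A b (- \<epsilon>) (k *\<^sub>R y) = k *\<^sub>R A y + (- \<epsilon> * h) *\<^sub>R b + (\<epsilon> * k * k * (b \<bullet> y)) *\<^sub>R y"
      unfolding hopf_field_def h_def[symmetric] by (simp add: linear_cmul[OF A(1)] algebra_simps)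
    ultimately show ?thesis by (simp only:)
  qed
  finally show ?thesis by (simp add: k_def)
qed

lemma unit_killing_Sphere:
  "\<exists>W. killing_field (Sphere :: ('e \<times> real, 'e) mfd) Sphere_metric W \<and>
    unit_length (Sphere :: ('e \<times> real, 'e) mfd) Sphere_metric W"
proof -
  let ?S = "Sphere :: ('e \<times> real, 'e) mfd"
  note sm = smooth_manifold_Sphere[where ?'e = 'e]
  define sign :: "('e \<times> real, 'e) chart \<Rightarrow> real" where "sign c = (if c = stereo_chart 1 then 1 else - 1)" for c
  define W where "W p = tangent_of ?S p (chart_at ?S p)
    (hopf_field A b (sign (chart_at ?S p)) (coord (chart_at ?S p) p))" for p
  \<comment> \<open>\<open>sign\<close> reads the pole off the chart, which is meaningful only if
    the two charts are different; their domains omit different points.\<close>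
  have ne: "stereo_chart 1 \<noteq> (stereo_chart (- 1) :: ('e \<times> real, 'e) chart)"
  proof
    assume "stereo_chart 1 = (stereo_chart (- 1) :: ('e \<times> real, 'e) chart)"
    then have "chart_dom (stereo_chart 1) = (chart_dom (stereo_chart (- 1)) :: ('e \<times> real) set)" by simp
    then have "(0, 1) \<in> (chart_dom (stereo_chart 1) :: ('e \<times> real) set)" by (auto simp: stereo_chart_def norm_Pair)
    then show False by (simp add: stereo_chart_def)
  qed
  have sign: "sign (stereo_chart \<epsilon>) = \<epsilon>" if "\<epsilon> = 1 \<or> \<epsilon> = - 1" for \<epsilon> using that ne by (auto simp: sign_def)
  have W: "W p \<in> tangent_space ?S p" "W p (stereo_chart \<epsilon>) = hopf_field A b \<epsilon> (stereo \<epsilon> p)"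
    if p: "p \<in> chart_dom (stereo_chart \<epsilon>)" and \<epsilon>: "\<epsilon> = 1 \<or> \<epsilon> = - 1" for p \<epsilon>
  proof -
    have c: "stereo_chart \<epsilon> \<in> atlas ?S" using \<epsilon> by (auto simp: Sphere_atlas_iff)
    have "p \<in> points ?S" using p by (simp add: Sphere_simps stereo_chart_def)
    note chart_at[OF sm this]
    then obtain \<delta> where \<delta>: "\<delta> = 1 \<or> \<delta> = - 1" and d: "chart_at ?S p = stereo_chart \<delta>"
      and dA: "stereo_chart \<delta> \<in> atlas ?S" and pd: "p \<in> chart_dom (stereo_chart \<delta>)"
      unfolding Sphere_atlas_iff by metis
    have Wp: "W p = tangent_of ?S p (stereo_chart \<delta>) (hopf_field A b \<delta> (stereo \<delta> p))"
      by (simp add: W_def d sign[OF \<delta>]) (simp add: stereo_chart_def)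
    then show "W p \<in> tangent_space ?S p" using tangent_of_mem[OF sm dA pd] by simp
    show "W p (stereo_chart \<epsilon>) = hopf_field A b \<epsilon> (stereo \<epsilon> p)"
    proof (cases "\<delta> = \<epsilon>")
      case True
      then show ?thesis using tangent_of_self[OF sm dA pd] by (simp add: Wp)
    next
      case False
      then have \<epsilon>\<delta>: "\<epsilon> = - \<delta>" "\<delta> * \<delta> = 1" using \<epsilon> \<delta> by auto
      have z: "p \<in> sphere 0 1" "p \<noteq> (0, \<epsilon>)" "p \<noteq> (0, \<delta>)" using p pd by (auto simp: stereo_chart_def)
      then have inv: "stereo_inv \<delta> (stereo \<delta> p) = p"
        using stereo_inv_stereo[OF \<delta>, of p] sphere_pole_iff[OF \<delta>, of p] by blast
      \<comment> \<open>The origin of one chart is the pole omitted by the other, so inversion is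
        defined on the overlap.\<close>
      have "stereo \<delta> p \<noteq> 0"
      proof
        assume "stereo \<delta> p = 0"
        then have "p = stereo_inv \<delta> 0" using inv by simp
        then show False using z(2) \<epsilon>\<delta> by (simp add: stereo_inv_def)
      qed
      have trans: "stereo \<epsilon> (stereo_inv \<delta> y) = y /\<^sub>R (y \<bullet> y)" for y :: 'e
      proof -
        have "1 - \<epsilon> * (\<delta> * (1 - 2 / (1 + y \<bullet> y))) = 2 * (y \<bullet> y) / (1 + y \<bullet> y)"
          using \<epsilon>\<delta> by (simp add: mult.assoc[symmetric] field_simps)
        moreover have "inverse (2 * q / e) * (2 / e) = inverse q" if "e \<noteq> 0" for q e :: real
          using that by (simp add: field_simps)
        note this[of "1 + y \<bullet> y" "y \<bullet> y"]
        ultimately show ?thesis by (simp only: stereo_def stereo_inv_def fst_conv snd_conv scaleR_scaleR) simp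
      qed
      have "transition (stereo_chart \<delta>) (stereo_chart \<epsilon>) = (\<lambda>y :: 'e. y /\<^sub>R (y \<bullet> y))"
        unfolding transition_def param_stereo_chart[OF \<delta>] by (simp add: stereo_chart_def o_def trans)
      then have "W p (stereo_chart \<epsilon>) = hopf_field A b (- \<delta>) (stereo \<delta> p /\<^sub>R (stereo \<delta> p \<bullet> stereo \<delta> p))"
        using hopf_field_transition[OF \<epsilon>\<delta>(2) \<open>stereo \<delta> p \<noteq> 0\<close>] c p
        by (simp add: Wp tangent_of_def) (simp add: stereo_chart_def)
      also have "stereo \<delta> p /\<^sub>R (stereo \<delta> p \<bullet> stereo \<delta> p) = stereo \<epsilon> p"
        using trans[of "stereo \<delta> p"] inv by simp
      finally show ?thesis using \<epsilon>\<delta> by simp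
    qed
  qed
  have rep: "field_rep W (stereo_chart \<epsilon>) = hopf_field A b \<epsilon>" if \<epsilon>: "\<epsilon> = 1 \<or> \<epsilon> = - 1" for \<epsilon>
    using W(2)[OF stereo_inv_mem[OF \<epsilon>] \<epsilon>]
    by (simp add: field_rep_def param_stereo_chart[OF \<epsilon>] stereo_stereo_inv[OF \<epsilon>] fun_eq_iff)
  have cover: "\<exists>\<epsilon>. (\<epsilon> = 1 \<or> \<epsilon> = - 1) \<and> p \<in> chart_dom (stereo_chart \<epsilon>)" if "p \<in> points ?S" for p
    using chart_at[OF sm that] unfolding Sphere_atlas_iff by metis
  have "killing_field ?S Sphere_metric W"
    unfolding killing_field_def smooth_vector_field_def
  proof (intro conjI ballI allI)
    show "W p \<in> tangent_space ?S p" if "p \<in> points ?S" for p using cover[OF that] W(1) by blast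
    fix c :: "('e \<times> real, 'e) chart" assume "c \<in> atlas ?S"
    then obtain \<epsilon> where \<epsilon>: "\<epsilon> = 1 \<or> \<epsilon> = - 1" and c: "c = stereo_chart \<epsilon>" by (auto simp: Sphere_atlas_iff)
    show "smooth_on (chart_img c) (field_rep W c)"
      unfolding c rep[OF \<epsilon>] by (rule smooth_on_subset[OF smooth_on_hopf_field]) simp
    show "lie_derivative_metric (field_rep W c) (metric_rep ?S Sphere_metric c) x u v = 0" for x u v
      unfolding c rep[OF \<epsilon>] metric_rep_Sphere[OF \<epsilon>] using \<epsilon> by (intro hopf_field_killing) auto
  qed
  moreover have "unit_length ?S Sphere_metric W"
    unfolding unit_length_def
  proof
    fix p assume "p \<in> points ?S"
    then obtain \<epsilon> where \<epsilon>: "\<epsilon> = 1 \<or> \<epsilon> = - 1" and p: "p \<in> chart_dom (stereo_chart \<epsilon>)" using cover by blast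
    show "Sphere_metric p (W p) (W p) = 1"
      unfolding Sphere_metric_coord[OF \<epsilon> p W(1)[OF p \<epsilon>] W(1)[OF p \<epsilon>]] W(2)[OF p \<epsilon>]
      using \<epsilon> by (intro hopf_field_unit) auto
  qed
  ultimately show ?thesis by blast
qed

end

text \<open>One coordinate \<open>k\<close> is set aside as the axis \<open>b\<close>, and the
  remaining even number is split into pairs. In the plane of each pair \<open>A\<close> is a quarter
  turn, encoded by an involution \<open>\<pi>\<close> exchanging the partners and a sign
  \<open>\<sigma>\<close> that differs between them and vanishes at \<open>k\<close>.\<close>

lemma complex_structure_exists:
  assumes "odd CARD('n::finite)"
  obtains A :: "real^'n \<Rightarrow> real^'n" and b where "linear A" "\<And>y z. A y \<bullet> z = - (y \<bullet> A z)" "A b = 0" "b \<bullet> b = 1"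
    "\<And>y. A y \<bullet> A y = y \<bullet> y - (b \<bullet> y) * (b \<bullet> y)"
proof -
  fix k :: 'n
  obtain j where j: "CARD('n) = 2 * j + 1" using assms oddE by blast
  then have card: "card (UNIV - {k}) = 2 * j" by (simp add: card_Diff_subset)
  then obtain P where P: "P \<subseteq> UNIV - {k}" "card P = j" using obtain_subset_with_card_n[of j "UNIV - {k}"] by auto
  define Q where "Q = UNIV - {k} - P"
  have "card Q = j" using card P by (simp add: Q_def card_Diff_subset)
  then obtain f where f: "bij_betw f P Q" using finite_same_card_bij[of P Q] P(2) by auto
  define \<pi> where "\<pi> i = (if i \<in> P then f i else if i \<in> Q then inv_into P f i else i)" for i
  define \<sigma> :: "'n \<Rightarrow> real" where "\<sigma> i = (if i \<in> P then 1 else if i \<in> Q then - 1 else 0)" for i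
  have PQ: "P \<inter> Q = {}" "k \<notin> P" "k \<notin> Q" "\<And>i. i \<noteq> k \<Longrightarrow> i \<in> P \<or> i \<in> Q" using P by (auto simp: Q_def)
  have fP: "f i \<in> Q" "inv_into P f (f i) = i" if "i \<in> P" for i
    using f that by (auto simp: bij_betw_def)
  have fQ: "inv_into P f i \<in> P" "f (inv_into P f i) = i" if "i \<in> Q" for i
    using f that by (auto simp: bij_betw_def inv_into_into f_inv_into_f)
  have \<pi>: "\<pi> (\<pi> i) = i" for i
    using fP fQ PQ(1) by (auto simp: \<pi>_def)
  have \<sigma>\<pi>: "\<sigma> (\<pi> i) = - \<sigma> i" for i
    using fP fQ PQ(1) by (auto simp: \<pi>_def \<sigma>_def)
  have \<sigma>2: "\<sigma> i * \<sigma> i = (if i = k then 0 else 1)" for i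
    using PQ by (auto simp: \<sigma>_def)
  have bij: "bij \<pi>" using \<pi> by (intro o_bij[of \<pi> \<pi>]) (auto simp: fun_eq_iff)
  have reindex: "(\<Sum>i\<in>UNIV. h (\<pi> i)) = (\<Sum>i\<in>UNIV. h i)" for h :: "'n \<Rightarrow> real"
    by (rule sum.reindex_bij_betw[OF bij])
  define A where "A y = (\<chi> i. \<sigma> i * y $ \<pi> i)" for y :: "real^'n"
  define b :: "real^'n" where "b = axis k 1"
  have b_inner: "b \<bullet> y = y $ k" for y by (simp add: b_def inner_axis')
  show ?thesis
  proof (rule that[of A b])
    show "linear A" unfolding A_def by (rule linearI) (auto simp: vec_eq_iff algebra_simps)
    show "A y \<bullet> z = - (y \<bullet> A z)" for y z
    proof -
      have "A y \<bullet> z = (\<Sum>i\<in>UNIV. \<sigma> i * y $ \<pi> i * z $ i)" by (simp add: A_def inner_vec_def)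
      \<comment> \<open>Summing over partners flips the sign and returns the index of
        \<open>y\<close> to its place.\<close>
      also have "\<dots> = (\<Sum>i\<in>UNIV. \<sigma> (\<pi> i) * y $ \<pi> (\<pi> i) * z $ \<pi> i)"
        by (rule reindex[of "\<lambda>i. \<sigma> i * y $ \<pi> i * z $ i", symmetric])
      also have "\<dots> = - (y \<bullet> A z)" by (simp add: \<pi> \<sigma>\<pi> A_def inner_vec_def sum_negf mult_ac)
      finally show ?thesis .
    qed
    have "\<pi> i = k \<longleftrightarrow> i = k" for i using \<pi>[of i] PQ by (auto simp: \<pi>_def)
    then show "A b = 0" using PQ by (auto simp: A_def b_def vec_eq_iff axis_def \<sigma>_def)
    show "b \<bullet> b = 1" unfolding b_inner by (simp add: b_def)
    show "A y \<bullet> A y = y \<bullet> y - (b \<bullet> y) * (b \<bullet> y)" for y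
    proof -
      have "A y \<bullet> A y = (\<Sum>i\<in>UNIV. \<sigma> i * \<sigma> i * (y $ \<pi> i * y $ \<pi> i))"
        by (simp add: A_def inner_vec_def mult_ac)
      also have "\<dots> = (\<Sum>i\<in>UNIV. \<sigma> (\<pi> i) * \<sigma> (\<pi> i) * (y $ \<pi> (\<pi> i) * y $ \<pi> (\<pi> i)))"
        by (rule reindex[of "\<lambda>i. \<sigma> i * \<sigma> i * (y $ \<pi> i * y $ \<pi> i)", symmetric])
      also have "\<dots> = (\<Sum>i\<in>UNIV. y $ i * y $ i - (if i = k then y $ i * y $ i else 0))"
        by (intro sum.cong) (auto simp: \<pi> \<sigma>\<pi> \<sigma>2)
      also have "\<dots> = y \<bullet> y - (b \<bullet> y) * (b \<bullet> y)"
        unfolding b_inner by (simp add: sum_subtractf inner_vec_def)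
      finally show ?thesis .
    qed
  qed
qed

section \<open>Classification\<close>

lemma constant_curvature_has_curvature:
  fixes M :: "('m, real^'n) mfd"
  assumes "riemannian_manifold M h" "constant_curvature M h \<kappa>" "c \<in> atlas M"
  shows "local_metric.has_curvature (chart_img c) (metric_rep M h c) \<kappa>"
  using assms local_metric.has_curvature_def[OF metric_rep_local_metric[OF assms(1,3)]]
  by (simp add: constant_curvature_def)

lemma flat_locally_isometric:
  fixes M :: "('m, real^'n) mfd"
  assumes M: "riemannian_manifold M h" and "constant_curvature M h 0"
  shows "locally_isometric M h (Euclid :: (real^'n, real^'n) mfd) Euclid_metric"
proof (rule locally_isometricI[OF _ smooth_manifold_Euclid])
  show sm: "smooth_manifold M" using M by (simp add: riemannian_manifold_def)
  fix c p assume c: "c \<in> atlas M" and p: "p \<in> chart_dom c"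
  interpret local_metric "chart_img c" "metric_rep M h c" by (rule metric_rep_local_metric[OF M c])
  have x0: "coord c p \<in> chart_img c" using p by blast
  obtain r and \<phi> :: "real^'n \<Rightarrow> real^'n" and V where \<phi>: "developing (coord c p) r \<phi> V"
    by (rule developing_map_flat[OF constant_curvature_has_curvature[OF assms c] x0])
  obtain X Y \<psi> G where X: "open X" "coord c p \<in> X" "X \<subseteq> chart_img c" "open Y" "homeomorphism X Y \<psi> G"
    "smooth_on X \<psi>" "smooth_on Y G"
    and metric: "\<And>x u v. x \<in> X \<Longrightarrow>
      dirderiv (\<lambda>y :: real^'n. y) (\<psi> x) (dirderiv \<psi> x u) \<bullet> dirderiv (\<lambda>y :: real^'n. y) (\<psi> x) (dirderiv \<psi> x v)
        = metric_rep M h c x u v"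
    by (rule local_isometry_chart[OF \<phi>, of UNIV "\<lambda>y. y" "\<lambda>y. y"])
      (auto intro: smooth_on_ident)
  then have "chart_isometry M h c X (Euclid :: (real^'n, real^'n) mfd) Euclid_metric (UNIV, id) Y \<psi> G"
    by (simp add: chart_isometry_def metric_rep_Euclid)
  then show "\<exists>d X Y \<psi> G. d \<in> atlas (Euclid :: (real^'n, real^'n) mfd) \<and> coord c p \<in> X \<and>
      chart_isometry M h c X Euclid Euclid_metric d Y \<psi> G"
    using X(2) by auto
qed

lemma positive_curvature_locally_isometric:
  fixes M :: "('m, real^'n) mfd"
  assumes M: "riemannian_manifold M h" and \<kappa>: "constant_curvature M h \<kappa>" "\<kappa> > 0"
  shows "locally_isometric M h (Sphere :: ((real^'n) \<times> real, real^'n) mfd) (scale_metric (1 / \<kappa>) Sphere_metric)"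
proof (rule locally_isometricI[OF _ smooth_manifold_Sphere])
  show sm: "smooth_manifold M" using M by (simp add: riemannian_manifold_def)
  fix c p assume c: "c \<in> atlas M" and p: "p \<in> chart_dom c"
  interpret local_metric "chart_img c" "metric_rep M h c" by (rule metric_rep_local_metric[OF M c])
  have x0: "coord c p \<in> chart_img c" using p by blast
  obtain r \<phi> V where \<phi>: "developing (coord c p) r \<phi> V"
    and norm: "\<And>x. x \<in> ball (coord c p) r \<Longrightarrow> \<kappa> * (norm (\<phi> x :: (real^'n) \<times> real))\<^sup>2 = 1"
    by (rule developing_map_sphere[OF constant_curvature_has_curvature[OF M \<kappa>(1) c] \<kappa>(2) x0]) (rule that; assumption)
  \<comment> \<open>The developing map takes values on the sphere of radius \<open>1 / a\<close>, so
    multiplication by \<open>a\<close> leads to the unit sphere, where stereographic projection is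
    available.\<close>
  define a where "a = sqrt \<kappa>"
  have a: "a > 0" "a * a = \<kappa>" using \<kappa>(2) by (simp_all add: a_def)
  \<comment> \<open>The projection starts from whichever pole is not the image of the base point, so
    that this image lies in the domain of \<open>?\<sigma>\<close>.\<close>
  define \<epsilon> :: real where "\<epsilon> = (if a * snd (\<phi> (coord c p)) = 1 then - 1 else 1)"
  have \<epsilon>: "\<epsilon> = 1 \<or> \<epsilon> = - 1" by (simp add: \<epsilon>_def)
  let ?s = "\<lambda>y :: real^'n. (1 / a) *\<^sub>R stereo_inv \<epsilon> y" and ?\<sigma> = "\<lambda>z :: (real^'n) \<times> real. stereo \<epsilon> (a *\<^sub>R z)"
  let ?T = "{z :: (real^'n) \<times> real. \<epsilon> * (a * snd z) \<noteq> 1}"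
  have T: "open ?T" by (intro open_Collect_neq continuous_intros)
  have T0: "\<phi> (coord c p) \<in> ?T" by (auto simp: \<epsilon>_def)
  have \<sigma>: "smooth_on ?T ?\<sigma>"
    by (rule smooth_on_compose[OF T _ smooth_on_stereo[OF \<epsilon>]]) (auto intro!: smooth_on_intros T)
  have s: "smooth_on UNIV ?s" by (intro smooth_on_intros open_UNIV smooth_on_stereo_inv[OF \<epsilon>])
  have inverse: "?s (?\<sigma> (\<phi> x)) = \<phi> x" if x: "x \<in> ball (coord c p) r" and "\<phi> x \<in> ?T" for x
  proof -
    have "(norm (a *\<^sub>R \<phi> x))\<^sup>2 = (a * a) * (norm (\<phi> x))\<^sup>2"
      by (simp add: power_mult_distrib power2_eq_square)
    then have "(norm (a *\<^sub>R \<phi> x))\<^sup>2 = 1" using norm[OF x] a(2) by simp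
    then have "norm (a *\<^sub>R \<phi> x) = 1" using norm_ge_zero[of "a *\<^sub>R \<phi> x"] by (simp add: power2_eq_1_iff del: norm_scaleR norm_ge_zero)
    then have "stereo_inv \<epsilon> (stereo \<epsilon> (a *\<^sub>R \<phi> x)) = a *\<^sub>R \<phi> x"
      using that(2) by (intro stereo_inv_stereo[OF \<epsilon>]) auto
    then show ?thesis using a by simp
  qed
  obtain X Y \<psi> G where X: "open X" "coord c p \<in> X" "X \<subseteq> chart_img c" "open Y" "homeomorphism X Y \<psi> G"
    "smooth_on X \<psi>" "smooth_on Y G"
    and metric: "\<And>x u v. x \<in> X \<Longrightarrow>
      dirderiv ?s (\<psi> x) (dirderiv \<psi> x u) \<bullet> dirderiv ?s (\<psi> x) (dirderiv \<psi> x v) = metric_rep M h c x u v"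
    by (rule local_isometry_chart[OF \<phi> T T0 \<sigma> s inverse]) blast+
  have ds: "dirderiv ?s y u = (1 / a) *\<^sub>R dirderiv (stereo_inv \<epsilon>) y u" for y u
    by (rule fun_cong[OF dirderiv_eqI[OF has_derivative_scaleR_right
          [OF smooth_on_has_derivative[OF smooth_on_stereo_inv[OF \<epsilon>] UNIV_I]]]])
  have "metric_rep Sphere (scale_metric (1 / \<kappa>) Sphere_metric) (stereo_chart \<epsilon>) (\<psi> x) (dirderiv \<psi> x u) (dirderiv \<psi> x v) =
      metric_rep M h c x u v" if "x \<in> X" for x u v
  proof -
    \<comment> \<open>The factor \<open>1 / \<kappa>\<close> matches the square of the factor
      \<open>1 / a\<close> in \<open>?s\<close>.\<close>
    have "metric_rep Sphere (scale_metric (1 / \<kappa>) Sphere_metric) (stereo_chart \<epsilon>) y u v = 1 / \<kappa> * round_metric y u v"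
      for y u v :: "real^'n"
      using metric_rep_Sphere[OF \<epsilon>] by (metis metric_rep_def scale_metric_def)
    then show ?thesis
      using metric[OF that, of u v] a by (simp add: ds stereo_inv_conformal[OF \<epsilon>] field_simps)
  qed
  then have "chart_isometry M h c X (Sphere :: ((real^'n) \<times> real, real^'n) mfd) (scale_metric (1 / \<kappa>) Sphere_metric)
      (stereo_chart \<epsilon>) Y \<psi> G"
    using X by (simp add: chart_isometry_def stereo_chart_img[OF \<epsilon>])
  moreover have "stereo_chart \<epsilon> \<in> atlas (Sphere :: ((real^'n) \<times> real, real^'n) mfd)" using \<epsilon> by (auto simp: Sphere_atlas_iff)
  ultimately show "\<exists>d X Y \<psi> G. d \<in> atlas (Sphere :: ((real^'n) \<times> real, real^'n) mfd) \<and> coord c p \<in> X \<and>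
      chart_isometry M h c X Sphere (scale_metric (1 / \<kappa>) Sphere_metric) d Y \<psi> G"
    using X(2) by blast
qed

lemma unit_killing_curvature_cases:
  fixes M :: "('m, real^'n) mfd"
  assumes M: "riemannian_manifold M h" and \<kappa>: "constant_curvature M h \<kappa>"
    and W: "killing_field M h W" "unit_length M h W" and "p \<in> points M" and "CARD('n) \<ge> 2"
  shows "\<kappa> = 0 \<or> \<kappa> > 0 \<and> odd CARD('n)"
proof -
  have sm: "smooth_manifold M" using M by (simp add: riemannian_manifold_def)
  define c where "c = chart_at M p"
  have c: "c \<in> atlas M" "p \<in> chart_dom c" unfolding c_def by (rule chart_at[OF sm \<open>p \<in> points M\<close>])+
  interpret local_metric "chart_img c" "metric_rep M h c" by (rule metric_rep_local_metric[OF M c(1)])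
  show ?thesis
  proof (rule unit_killing_curvature)
    show "smooth_on (chart_img c) (field_rep W c)"
      using W(1) c(1) by (simp add: killing_field_def smooth_vector_field_def)
    show "lie_derivative_metric (field_rep W c) (metric_rep M h c) x u v = 0" if "x \<in> chart_img c" for x u v
      using W(1) c(1) that unfolding killing_field_def by blast
    show "metric_rep M h c x (field_rep W c x) (field_rep W c x) = 1" if x: "x \<in> chart_img c" for x
    proof -
      have q: "param c x \<in> chart_dom c" by (rule param_in_dom[OF sm c(1) x])
      then have "param c x \<in> points M" using chart_dom_subset[OF sm c(1)] by blast
      then have "W (param c x) \<in> tangent_space M (param c x)" "h (param c x) (W (param c x)) (W (param c x)) = 1"
        using W by (auto simp: killing_field_def smooth_vector_field_def unit_length_def)
      then show ?thesis
        using metric_rep_coord[OF sm c(1) q, of "W (param c x)" "W (param c x)" h]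
        by (simp add: field_rep_def coord_param[OF sm c(1) x])
    qed
    show "has_curvature \<kappa>" by (rule constant_curvature_has_curvature[OF M \<kappa> c(1)])
    show "coord c p \<in> chart_img c" using c(2) by blast
  qed fact
qed

lemma CC_Kropina_metric_exists:
  assumes "riemannian_manifold M h" "constant_curvature M h \<kappa>" "killing_field M h W" "unit_length M h W"
  shows "\<exists>A F. CC_Kropina_metric M h W A F"
  using assms
  by (intro exI[of _ "{(p, y). p \<in> points M \<and> y \<in> tangent_space M p \<and> h p y (W p) > 0}"]
      exI[of _ "\<lambda>(p, y). h p y y / (2 * h p y (W p))"]) (auto simp: CC_Kropina_metric_def)

theorem theorem6p3:
  assumes dim: "CARD('n::finite) \<ge> 2"
  shows
    "(\<exists>W. killing_field (Euclid :: (real^'n, real^'n) mfd) Euclid_metric W \<and>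
          unit_length (Euclid :: (real^'n, real^'n) mfd) Euclid_metric W \<and>
          (\<exists>A F. CC_Kropina_metric (Euclid :: (real^'n, real^'n) mfd) Euclid_metric W A F)) \<and>
     (\<forall>m\<ge>2. CARD('n) = 2 * m - 1 \<longrightarrow>
        (\<exists>W. killing_field (Sphere :: ((real^'n) \<times> real, real^'n) mfd) Sphere_metric W \<and>
             unit_length (Sphere :: ((real^'n) \<times> real, real^'n) mfd) Sphere_metric W \<and>
             (\<exists>A F. CC_Kropina_metric (Sphere :: ((real^'n) \<times> real, real^'n) mfd)
                      Sphere_metric W A F))) \<and>
     (\<forall>(M :: ('m, real^'n) mfd) h W.
        riemannian_manifold M h \<and> (\<exists>\<kappa>. constant_curvature M h \<kappa>) \<and>
        killing_field M h W \<and> unit_length M h W \<longrightarrow>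
        locally_isometric M h (Euclid :: (real^'n, real^'n) mfd) Euclid_metric \<or>
        (\<exists>m\<ge>2. CARD('n) = 2 * m - 1 \<and>
           (\<exists>r>0. locally_isometric M h (Sphere :: ((real^'n) \<times> real, real^'n) mfd)
                    (scale_metric r Sphere_metric))))"
proof (intro conjI allI impI)
  fix k :: 'n
  obtain W where "killing_field (Euclid :: (real^'n, real^'n) mfd) Euclid_metric W"
    "unit_length (Euclid :: (real^'n, real^'n) mfd) Euclid_metric W"
    using unit_killing_Euclid[of "axis k 1 :: real^'n"] by auto
  with CC_Kropina_metric_exists[OF riemannian_Euclid constant_curvature_Euclid]
  show "\<exists>W. killing_field (Euclid :: (real^'n, real^'n) mfd) Euclid_metric W \<and>
      unit_length (Euclid :: (real^'n, real^'n) mfd) Euclid_metric W \<and>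
      (\<exists>A F. CC_Kropina_metric (Euclid :: (real^'n, real^'n) mfd) Euclid_metric W A F)"
    by blast
next
  fix m :: nat assume "2 \<le> m" "CARD('n) = 2 * m - 1"
  then have "odd CARD('n)" by (cases m) auto
  then obtain A :: "real^'n \<Rightarrow> real^'n" and b where "linear A" "\<And>y z. A y \<bullet> z = - (y \<bullet> A z)" "A b = 0" "b \<bullet> b = 1"
    "\<And>y. A y \<bullet> A y = y \<bullet> y - (b \<bullet> y) * (b \<bullet> y)" by (rule complex_structure_exists) blast
  from unit_killing_Sphere[OF this]
  show "\<exists>W. killing_field (Sphere :: ((real^'n) \<times> real, real^'n) mfd) Sphere_metric W \<and>
      unit_length (Sphere :: ((real^'n) \<times> real, real^'n) mfd) Sphere_metric W \<and>
      (\<exists>A F. CC_Kropina_metric (Sphere :: ((real^'n) \<times> real, real^'n) mfd) Sphere_metric W A F)"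
    using CC_Kropina_metric_exists[OF riemannian_Sphere constant_curvature_Sphere] by blast
next
  fix M :: "('m, real^'n) mfd" and h W
  assume *: "riemannian_manifold M h \<and> (\<exists>\<kappa>. constant_curvature M h \<kappa>) \<and> killing_field M h W \<and> unit_length M h W"
  then obtain \<kappa> where M: "riemannian_manifold M h" and \<kappa>: "constant_curvature M h \<kappa>" by blast
  \<comment> \<open>An empty manifold offers no point at which to test the curvature, but there
    local isometry to Euclidean space is vacuous.\<close>
  have "points M = {} \<or> \<kappa> = 0 \<or> \<kappa> > 0 \<and> odd CARD('n)"
    using unit_killing_curvature_cases[OF M \<kappa>] * dim by blast
  then consider "points M = {}" | "\<kappa> = 0" | "\<kappa> > 0" "odd CARD('n)" by blast
  then show "locally_isometric M h (Euclid :: (real^'n, real^'n) mfd) Euclid_metric \<or>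
      (\<exists>m\<ge>2. CARD('n) = 2 * m - 1 \<and>
        (\<exists>r>0. locally_isometric M h (Sphere :: ((real^'n) \<times> real, real^'n) mfd) (scale_metric r Sphere_metric)))"
  proof cases
    case 1
    then show ?thesis by (simp add: locally_isometric_def)
  next
    case 2
    then show ?thesis using flat_locally_isometric[OF M] \<kappa> by blast
  next
    case 3
    then obtain j where "CARD('n) = 2 * j + 1" using oddE by blast
    \<comment> \<open>The witness is \<open>m = j + 1\<close>. Dimension at least 2 excludes
      \<open>j = 0\<close>, the circle.\<close>
    then have "j + 1 \<ge> 2" "CARD('n) = 2 * (j + 1) - 1" using dim by auto
    moreover have "1 / \<kappa> > 0" using 3 by simp
    ultimately show ?thesis using positive_curvature_locally_isometric[OF M \<kappa> 3(1)] by blast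
  qed
qed

end
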